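(* Let $p\in(3,4)$ and let $F:\mathbb{R}^3\to[0,\infty)$, $f_0:\mathbb{R}^3\times\mathbb{R}^3\to[0,\infty)$ and $A:[0,\infty)\times\mathbb{R}^3\to\mathbb{R}^3$ satisfy conditions (I)-(IV) listed in the context. Let $T>0$ and let $f$ be the $C^1$ solution on $[0,T]\times\mathbb{R}^3\times\mathbb{R}^3$ of the Vlasov-Poisson system $$\partial_t f+v\cdot\nabla_x f-(E+A)\cdot\nabla_v f=0,\qquad \rho(t,x)=\int_{\mathbb{R}^3}(F(v)-f(t,x,v))\,dv,$$ $$E(t,x)=\int_{\mathbb{R}^3}\rho(t,y)\frac{x-y}{|x-y|^3}\,dy,\qquad f(0,x,v)=f_0(x,v).$$ Then there is a constant $C$, independent of $t$, such that $$\left\|\int_{\mathbb{R}^3}(F-f)(t)\,dv\right\|_6\le C\qquad\text{for all }t\in[0,T],$$ that is, $|\rho(t,x)|\le C(1+|x|^2)^{-3}$ for all $t\in[0,T]$ and $x\in\mathbb{R}^3$.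
   Context: Notation: $R(x)=R(|x|)=(1+|x|^2)^{1/2}$. For a function $\rho$ on $\mathbb{R}^3$ and a real number $q$, $\|\rho\|_q:=\sup_{x\in\mathbb{R}^3}|\rho(x)|R^q(x)$ (a weighted sup norm, not an $L^q$ norm). "The $C^1$ solution" is the restriction to $[0,T]$ of the unique global nonnegative $C^1$ solution for which $\|\rho(t)\|_p$ is bounded on every bounded time interval; the constant $C$ may depend on $F$, $f_0$, $A$, $p$ and $T$. Conditions, holding for some constant $C>0$ (which may differ from line to line) and all $t\ge 0$, $x,v\in\mathbb{R}^3$ unless otherwise stated: (I) $F(v)=F_R(|v|)$ is nonnegative and $C^2$ with $F_R''(0)<0$, and there is $W\in(0,\infty)$ such that $F_R'(u)<0$ for $u\in(0,W)$ and $F_R(u)=0$ for $u\ge W$. (II) $f_0$ is $C^1$ and nonnegative. (III) $A$ is $C^1$ with $|A(t,x)|\le C^{(0)}R^{-2}(x)$ for a constant $C^{(0)}$, $|\partial_{x_i}A(t,x)|\le CR^{-3}(x)$ for $i=1,2,3$, and $\nabla_x\cdot A(t,x)=0$. Moreover there is a continuous function $a:[0,\infty)\to\mathbb{R}$ such that $\left|A(t,x)-a(t)\frac{x}{|x|^3}\right|\le CR^{1-p}(x)$ for all $t\ge 0$ and $|x|\ge 1$. (IV) $F-f_0$ has compact support in $v$ (there is a bounded set outside of which $F(v)-f_0(x,v)=0$ for all $x$), and there is $N>0$ such that $|F(v)-f_0(x,v)|\le CR^{-6}(x)$ for $|x|>N$ and all $v$. *)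

theory Defs
  imports "HOL-Analysis.Analysis"
begin

text \<open>Continuous differentiability up to the boundary. On the sets used below
  (\<open>UNIV\<close> and \<open>{0..} \<times> UNIV\<close>) the derivative within \<open>S\<close> is unique; at time 0 it
  is the one-sided derivative in time.\<close>

definition C1_on :: "('a::real_normed_vector \<Rightarrow> 'b::real_normed_vector) \<Rightarrow> 'a set \<Rightarrow> bool" where
  "C1_on g S \<longleftrightarrow>
     (\<exists>g' :: 'a \<Rightarrow> 'a \<Rightarrow>\<^sub>L 'b.
        (\<forall>z\<in>S. (g has_derivative blinfun_apply (g' z)) (at z within S)) \<and> continuous_on S g')"

definition C2_on :: "('a::real_normed_vector \<Rightarrow> 'b::real_normed_vector) \<Rightarrow> 'a set \<Rightarrow> bool" where
  "C2_on g S \<longleftrightarrow>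
     (\<exists>g' :: 'a \<Rightarrow> 'a \<Rightarrow>\<^sub>L 'b.
        (\<forall>z\<in>S. (g has_derivative blinfun_apply (g' z)) (at z within S)) \<and> C1_on g' S)"

definition partial_deriv :: "3 \<Rightarrow> (real^3 \<Rightarrow> 'b::real_normed_vector) \<Rightarrow> real^3 \<Rightarrow> 'b" where
  "partial_deriv i g x = vector_derivative (\<lambda>h. g (x + h *\<^sub>R axis i 1)) (at 0)"

definition grad :: "(real^3 \<Rightarrow> real) \<Rightarrow> real^3 \<Rightarrow> real^3" where
  "grad g x = (\<chi> i. partial_deriv i g x)"

definition divergence :: "(real^3 \<Rightarrow> real^3) \<Rightarrow> real^3 \<Rightarrow> real" where
  "divergence g x = (\<Sum>i\<in>UNIV. partial_deriv i (\<lambda>y. g y $ i) x)"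

definition R :: "real^3 \<Rightarrow> real" where
  "R x = (1 + (norm x)\<^sup>2) powr (1/2)"

text \<open>The weighted supremum norm; it takes the value \<open>\<infinity>\<close> when the weighted function is unbounded.\<close>

definition wnorm :: "real \<Rightarrow> (real^3 \<Rightarrow> real) \<Rightarrow> ereal" where
  "wnorm q g = (SUP x. ereal (\<bar>g x\<bar> * R x powr q))"

text \<open>The radial profile \<open>F\<^sub>R\<close> lives on \<open>[0,\<infinity>)\<close>, so its derivatives at 0 are one-sided;
  \<open>FR'\<close> is its first derivative and \<open>d\<close> is \<open>F\<^sub>R''(0)\<close>.\<close>

definition background_condition :: "(real^3 \<Rightarrow> real) \<Rightarrow> bool" where
  "background_condition F \<longleftrightarrow>
     (\<forall>v. 0 \<le> F v) \<and> C2_on F UNIV \<and>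
     (\<exists>FR FR' :: real \<Rightarrow> real. \<exists>d W :: real.
        (\<forall>v. F v = FR (norm v)) \<and>
        (\<forall>u\<ge>0. (FR has_real_derivative FR' u) (at u within {0..})) \<and>
        (FR' has_real_derivative d) (at 0 within {0..}) \<and> d < 0 \<and>
        0 < W \<and> (\<forall>u. 0 < u \<and> u < W \<longrightarrow> FR' u < 0) \<and> (\<forall>u\<ge>W. FR u = 0))"

definition initial_condition :: "((real^3) \<times> (real^3) \<Rightarrow> real) \<Rightarrow> bool" where
  "initial_condition f0 \<longleftrightarrow> C1_on f0 UNIV \<and> (\<forall>x v. 0 \<le> f0 (x, v))"

definition field_condition :: "real \<Rightarrow> (real \<times> (real^3) \<Rightarrow> real^3) \<Rightarrow> bool" where
  "field_condition p A \<longleftrightarrow>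
     C1_on A ({0..} \<times> UNIV) \<and>
     (\<exists>C>0. \<forall>t\<ge>0. \<forall>x. norm (A (t, x)) \<le> C * R x powr (-2)) \<and>
     (\<exists>C>0. \<forall>t\<ge>0. \<forall>x. \<forall>i. norm (partial_deriv i (\<lambda>y. A (t, y)) x) \<le> C * R x powr (-3)) \<and>
     (\<forall>t\<ge>0. \<forall>x. divergence (\<lambda>y. A (t, y)) x = 0) \<and>
     (\<exists>a :: real \<Rightarrow> real. continuous_on {0..} a \<and>
        (\<exists>C>0. \<forall>t\<ge>0. \<forall>x. 1 \<le> norm x \<longrightarrow>
           norm (A (t, x) - (a t / norm x ^ 3) *\<^sub>R x) \<le> C * R x powr (1 - p)))"

definition perturbation_condition ::
    "(real^3 \<Rightarrow> real) \<Rightarrow> ((real^3) \<times> (real^3) \<Rightarrow> real) \<Rightarrow> bool" where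
  "perturbation_condition F f0 \<longleftrightarrow>
     (\<exists>K. bounded K \<and> (\<forall>x v. v \<notin> K \<longrightarrow> F v - f0 (x, v) = 0)) \<and>
     (\<exists>N>0. \<exists>C>0. \<forall>x v. N < norm x \<longrightarrow> \<bar>F v - f0 (x, v)\<bar> \<le> C * R x powr (-6))"

definition rho ::
    "(real^3 \<Rightarrow> real) \<Rightarrow> (real \<times> (real^3) \<times> (real^3) \<Rightarrow> real) \<Rightarrow> real \<Rightarrow> real^3 \<Rightarrow> real" where
  "rho F f t x = (\<integral>v. (F v - f (t, x, v)) \<partial>lborel)"

definition efield ::
    "(real^3 \<Rightarrow> real) \<Rightarrow> (real \<times> (real^3) \<times> (real^3) \<Rightarrow> real) \<Rightarrow> real \<Rightarrow> real^3 \<Rightarrow> real^3" where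
  "efield F f t x = (\<integral>y. (rho F f t y / norm (x - y) ^ 3) *\<^sub>R (x - y) \<partial>lborel)"

text \<open>The integrability clauses say that the integrals defining the density and the field exist;
  without them the Bochner integral would silently be 0.\<close>

definition VP_solution ::
    "(real^3 \<Rightarrow> real) \<Rightarrow> ((real^3) \<times> (real^3) \<Rightarrow> real) \<Rightarrow> (real \<times> (real^3) \<Rightarrow> real^3) \<Rightarrow>
     (real \<times> (real^3) \<times> (real^3) \<Rightarrow> real) \<Rightarrow> bool" where
  "VP_solution F f0 A f \<longleftrightarrow>
     C1_on f ({0..} \<times> UNIV) \<and>
     (\<forall>t\<ge>0. \<forall>x. integrable lborel (\<lambda>v. F v - f (t, x, v))) \<and>
     (\<forall>t\<ge>0. \<forall>x. integrable lborel (\<lambda>y. (rho F f t y / norm (x - y) ^ 3) *\<^sub>R (x - y))) \<and>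
     (\<forall>t\<ge>0. \<forall>x v.
        vector_derivative (\<lambda>s. f (s, x, v)) (at t within {0..})
          + v \<bullet> grad (\<lambda>y. f (t, y, v)) x
          - (efield F f t x + A (t, x)) \<bullet> grad (\<lambda>w. f (t, x, w)) v = 0) \<and>
     (\<forall>x v. f (0, x, v) = f0 (x, v))"

text \<open>The class in which the global solution is unique: nonnegative, with \<open>wnorm p\<close> of the
  density bounded on bounded time intervals.\<close>

definition global_VP_solution ::
    "real \<Rightarrow> (real^3 \<Rightarrow> real) \<Rightarrow> ((real^3) \<times> (real^3) \<Rightarrow> real) \<Rightarrow> (real \<times> (real^3) \<Rightarrow> real^3) \<Rightarrow>
     (real \<times> (real^3) \<times> (real^3) \<Rightarrow> real) \<Rightarrow> bool" where
  "global_VP_solution p F f0 A f \<longleftrightarrow>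
     VP_solution F f0 A f \<and>
     (\<forall>t\<ge>0. \<forall>x v. 0 \<le> f (t, x, v)) \<and>
     (\<forall>\<tau>>0. \<exists>B::real. \<forall>t\<in>{0..\<tau>}. wnorm p (rho F f t) \<le> ereal B)"

end

theory Submission
  imports Defs
begin

text \<open>Write \<open>G = E + A\<close> and trace \<open>f\<close> back along the trajectory from \<open>(x, v)\<close> in the field frozen
  at \<open>x\<close>. For large \<open>x\<close> the field varies by \<open>O(R x powr (-3))\<close> over bounded distances and by
  \<open>O(R x powr (-6))\<close> over distances \<open>O(R x powr (-3))\<close>. Hence \<open>f (t, x, v) = F (v + c + d) +
  O(R x powr (-6))\<close>, where \<open>c\<close> is the time integral of \<open>G\<close> at \<open>x\<close>, independent of \<open>v\<close>, and
  \<open>d = O(R x powr (-3))\<close> is the time integral of the increments of \<open>G\<close> along the trajectory.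
  Integrating over \<open>v\<close>, the shift by \<open>c\<close> drops out and the quadratic term in \<open>d\<close> is
  \<open>O(R x powr (-6))\<close>, so the density is, up to \<open>O(R x powr (-6))\<close>, minus the integral of
  \<open>grad F (v + c) \<bullet> d\<close>. The trajectories are affine in \<open>v\<close>, so this is a time integral of
  the divergence of \<open>G\<close> averaged with weight \<open>F\<close>; since \<open>div A = 0\<close> and \<open>div E = 4 \<pi> \<rho>\<close>, it is
  controlled by earlier values of the density near \<open>x\<close>, and Gronwall's argument applies.\<close>

section \<open>Weights and radial integrals\<close>

text \<open>What is known of the density beforehand is its size, \<open>O (R x powr (-p))\<close>;
  its derivatives are not controlled at large \<open>x\<close>. So \<open>E\<close> comes with no
  gradient bound: its increments are estimated by interpolating, with an exponent \<theta> < 1,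
  between the size of the kernel and its Lipschitz bound, because the Lipschitz bound itself is not
  integrable at the singularity. For the same reason a maximum principle on thin tubes stands in for
  the characteristics, and the divergence of \<open>E\<close> enters only weakly, with
  \<open>F\<close> as the test function and no differentiation of the density. The assumption
  \<open>p > 3\<close> makes the density integrable, hence \<open>E\<close> of size
  \<open>R x powr (-2)\<close>, and leaves room for \<theta> < 1. Estimated by its size, the term
  linear in \<open>d\<close> would decay only like \<open>R x powr (-3)\<close>; integration by
  parts in the velocity trades it for the density itself. The resulting inequality is not pointwise
  in \<open>x\<close>: it involves the density within a fixed distance of \<open>x\<close>, where
  the weights are comparable, and therefore it closes in a weighted supremum norm.\<close>

lemma R_eq_norm_Pair: "R x = norm (1::real, x)"
  by (simp add: R_def norm_Pair powr_half_sqrt)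

lemma R_ge_1: "1 \<le> R x"
  using norm_fst_le[of "(1::real)" x] by (simp add: R_eq_norm_Pair)

lemma R_pos [simp]: "0 < R x"
  using R_ge_1[of x] by linarith

lemma R_nonneg [simp]: "0 \<le> R x" and R_neq_0 [simp]: "R x \<noteq> 0"
  using R_pos[of x] by linarith+

lemma norm_le_R: "norm x \<le> R x"
  using norm_snd_le[of x "1::real"] by (simp add: R_eq_norm_Pair)

lemma R_le_norm: "R x \<le> 1 + norm x"
  using norm_Pair_le[of "1::real" x] by (simp add: R_eq_norm_Pair)

text \<open>As the norm of the pair \<open>(1, x)\<close> the weight is 1-Lipschitz; this makes its
  values comparable at points whose distance is bounded or at most a fraction of the weight.\<close>

lemma R_triangle: "R x \<le> R y + norm (x - y)"
proof -
  have "norm ((1::real, x) - (1, y)) = norm (x - y)" by (simp add: norm_Pair)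
  then show ?thesis
    using norm_triangle_sub[of "(1::real, x)" "(1, y)"] by (simp add: R_eq_norm_Pair)
qed

lemma continuous_on_R: "continuous_on S R"
  unfolding R_eq_norm_Pair[abs_def] by (intro continuous_intros)

lemma borel_measurable_R [measurable]: "R \<in> borel_measurable borel"
  by (intro borel_measurable_continuous_onI continuous_on_R)

lemma R_powr_minus_le_1: "0 \<le> q \<Longrightarrow> R x powr (-q) \<le> 1"
  using powr_mono[of "-q" 0 "R x"] R_ge_1[of x] by simp

lemma R_powr_mono_minus: "q \<le> q' \<Longrightarrow> R x powr (-q') \<le> R x powr (-q)"
  using R_ge_1[of x] by (intro powr_mono) auto

lemma R_powr_minus_le_scaled:
  assumes "R x \<le> k * R y" "0 \<le> q"
  shows "R y powr (-q) \<le> k powr q * R x powr (-q)"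
proof -
  have k: "k > 0" using assms(1) R_pos[of x] R_pos[of y] by (smt (verit) mult_nonpos_nonneg)
  have "R x powr q \<le> k powr q * R y powr q"
    using powr_mono2[of q "R x" "k * R y"] assms k by (simp add: powr_mult less_imp_le)
  moreover have "R x powr q > 0" "R y powr q > 0" by (simp_all add: less_imp_neq[OF R_pos, symmetric])
  ultimately show ?thesis by (simp add: powr_minus divide_simps mult.commute)
qed

lemma R_powr_minus_near:
  assumes "norm (x - y) \<le> L" "0 \<le> q"
  shows "R y powr (-q) \<le> (1 + L) powr q * R x powr (-q)"
proof (rule R_powr_minus_le_scaled[OF _ assms(2)])
  have "L \<ge> 0" using assms(1) norm_ge_zero order_trans by blast
  have "R x \<le> R y + L" using R_triangle[of x y] assms by simp
  also have "\<dots> \<le> R y + L * R y" using R_ge_1[of y] \<open>L \<ge> 0\<close> by (simp add: mult_le_cancel_left1)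
  finally show "R x \<le> (1 + L) * R y" by (simp add: algebra_simps)
qed

lemma R_powr_minus_half:
  assumes "norm (x - y) \<le> R x / 2" "0 \<le> q"
  shows "R y powr (-q) \<le> 2 powr q * R x powr (-q)"
  by (rule R_powr_minus_le_scaled[OF _ assms(2)]) (use R_triangle[of x y] assms in simp)

text \<open>On the ball of radius \<open>r * k ^ n\<close> the bound \<open>C * b ^ n\<close>
  contributes a multiple of \<open>(b * k ^ 3) ^ n\<close>, and these contributions sum
  geometrically. With \<open>k = 1/2\<close> this treats a singularity at the origin, with
  \<open>k = 2\<close> a tail at infinity.\<close>

lemma nn_integral_dyadic_le:
  fixes g :: "real^3 \<Rightarrow> ennreal"
  assumes [measurable]: "g \<in> borel_measurable borel"
    and pos: "0 \<le> C" "0 \<le> r" "0 < b" "0 < k" and small: "b * k ^ 3 < 1"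
    and g: "\<And>z. g z \<noteq> 0 \<Longrightarrow> \<exists>n. g z \<le> ennreal (C * b ^ n) \<and> norm z \<le> r * k ^ n"
  shows "(\<integral>\<^sup>+z. g z \<partial>lborel) \<le> ennreal (C * unit_ball_vol 3 * r ^ 3 / (1 - b * k ^ 3))"
proof -
  let ?t = "\<lambda>n (z::real^3). ennreal (C * b ^ n) * indicator (cball 0 (r * k ^ n)) z"
  have le: "g z \<le> (\<Sum>n. ?t n z)" for z
  proof (cases "g z = 0")
    case False
    then obtain n where n: "g z \<le> ennreal (C * b ^ n)" "norm z \<le> r * k ^ n" using g by blast
    then have "g z \<le> ?t n z" by (simp add: indicator_def)
    also have "\<dots> = sum (\<lambda>n. ?t n z) {n}" by (simp only: sum.insert sum.empty finite.emptyI empty_iff not_False_eq_True add_0_right)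
    also have "\<dots> \<le> (\<Sum>n. ?t n z)" by (rule sum_le_suminf) auto
    finally show ?thesis .
  qed simp
  have "(\<integral>\<^sup>+z. g z \<partial>lborel) \<le> (\<integral>\<^sup>+z. (\<Sum>n. ?t n z) \<partial>lborel)"
    by (intro nn_integral_mono le)
  also have "\<dots> = (\<Sum>n. \<integral>\<^sup>+z. ?t n z \<partial>lborel)"
    by (rule nn_integral_suminf) (intro borel_measurable_times_ennreal borel_measurable_indicator, auto)
  also have "\<dots> = (\<Sum>n. ennreal (C * unit_ball_vol 3 * r ^ 3 * (b * k ^ 3) ^ n))"
  proof (intro suminf_cong)
    fix n
    have "(\<integral>\<^sup>+z. ?t n z \<partial>lborel) = ennreal (C * b ^ n) * emeasure lborel (cball (0::real^3) (r * k ^ n))"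
      by (subst nn_integral_cmult_indicator) auto
    also have "emeasure lborel (cball (0::real^3) (r * k ^ n)) = ennreal (unit_ball_vol 3 * (r * k ^ n) ^ 3)"
      using pos by (subst emeasure_cball) auto
    finally show "(\<integral>\<^sup>+z. ?t n z \<partial>lborel) = ennreal (C * unit_ball_vol 3 * r ^ 3 * (b * k ^ 3) ^ n)"
      using pos by (simp add: ennreal_mult[symmetric] power_mult_distrib mult_ac power_mult[symmetric])
  qed
  also have "\<dots> = ennreal (\<Sum>n. C * unit_ball_vol 3 * r ^ 3 * (b * k ^ 3) ^ n)"
    using pos small by (intro suminf_ennreal2 summable_mult summable_geometric) auto
  also have "(\<Sum>n. C * unit_ball_vol 3 * r ^ 3 * (b * k ^ 3) ^ n) = C * unit_ball_vol 3 * r ^ 3 / (1 - b * k ^ 3)"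
    using pos small by (subst suminf_mult) (auto simp: suminf_geometric summable_geometric)
  finally show ?thesis .
qed

lemma powr_norm_integrable_on_balls:
  assumes "0 \<le> q" "q < 3"
  obtains C where "0 < C"
    "\<And>r. 0 < r \<Longrightarrow> integrable lborel (\<lambda>z::real^3. indicator (cball 0 r) z * norm z powr (-q))"
    "\<And>r. 0 < r \<Longrightarrow> (\<integral>z. indicator (cball 0 r) z * norm (z::real^3) powr (-q) \<partial>lborel) \<le> C * r powr (3 - q)"
proof -
  define C where "C = 2 powr q * unit_ball_vol 3 / (1 - 2 powr (q - 3))"
  have small: "2 powr (q - 3) < 1" using assms by (simp add: powr_less_one)
  have C: "C > 0" unfolding C_def using small by (intro divide_pos_pos mult_pos_pos) auto
  have meas [measurable]: "(\<lambda>z::real^3. indicator (cball 0 r) z * norm z powr (-q)) \<in> borel_measurable borel" for r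
    by (intro borel_measurable_times borel_measurable_indicator) measurable
  have 1: "(\<integral>\<^sup>+z. ennreal (indicator (cball 0 r) z * norm (z::real^3) powr (-q)) \<partial>lborel) \<le> ennreal (C * r powr (3 - q))"
    if r: "0 < r" for r
  proof -
    have e: "2 powr q * (1/2) ^ 3 = 2 powr (q - 3)"
      by (simp add: powr_diff power3_eq_cube)
    have "(\<integral>\<^sup>+z. ennreal (indicator (cball 0 r) z * norm (z::real^3) powr (-q)) \<partial>lborel)
       \<le> ennreal ((2 powr q * r powr (-q)) * unit_ball_vol 3 * r ^ 3 / (1 - 2 powr q * (1/2) ^ 3))"
    proof (rule nn_integral_dyadic_le)
      fix z :: "real^3" assume "ennreal (indicator (cball 0 r) z * norm z powr (-q)) \<noteq> 0"
      \<comment> \<open>The origin drops out because \<open>0 powr (-q)\<close> is 0 by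
        convention.\<close>
      then have z: "norm z \<le> r" "z \<noteq> 0" by (auto simp: indicator_def split: if_splits)
      \<comment> \<open>Index of the dyadic shell of \<open>z\<close>: minimality gives the outer
        radius \<open>r * (1/2) ^ n\<close>, except for \<open>n = 0\<close>, where the indicator
        does.\<close>
      define n where "n = (LEAST n. r * (1/2) ^ Suc n < norm z)"
      obtain m where "(1/2) ^ m < norm z / r" using z r real_arch_pow_inv[of "norm z / r" "1/2"] by auto
      then have "r * (1/2) ^ m < norm z" using r by (simp add: field_simps)
      moreover have "r * (1/2) ^ Suc m \<le> r * (1/2) ^ m" using r by simp
      ultimately have "r * (1/2) ^ Suc m < norm z" by linarith
      then have n1: "r * (1/2) ^ Suc n < norm z" unfolding n_def by (rule LeastI)
      have n2: "norm z \<le> r * (1/2) ^ n"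
      proof (cases n)
        case (Suc k)
        then have "\<not> r * (1/2) ^ Suc k < norm z" unfolding n_def by (metis lessI n_def not_less_Least)
        then show ?thesis using Suc by simp
      qed (use z in simp)
      have "norm z powr (-q) \<le> (r * (1/2) ^ Suc n) powr (-q)"
        using n1 r assms by (intro powr_mono2') auto
      also have "\<dots> = 2 powr q * r powr (-q) * (2 powr q) ^ n"
      proof -
        have "(r * (1/2) ^ Suc n) powr (-q) = r powr (-q) * ((1/2) powr real (Suc n)) powr (-q)"
          using r by (simp only: powr_mult powr_realpow)
        also have "(1/2) powr real (Suc n) = 2 powr (- real (Suc n))"
          by (simp only: powr_minus_divide powr_divide powr_one_eq_one)
        also have "(2 powr (- real (Suc n))) powr (-q) = 2 powr (q * real n + q)"
          by (simp only: powr_powr) (simp add: algebra_simps)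
        also have "\<dots> = 2 powr q * (2 powr q) ^ n"
          by (simp only: powr_add powr_powr powr_realpow[symmetric])
            (simp add: powr_powr powr_realpow[symmetric])
        finally show ?thesis by (simp add: mult_ac)
      qed
      finally show "\<exists>n. ennreal (indicator (cball 0 r) z * norm z powr (-q)) \<le> ennreal (2 powr q * r powr (-q) * (2 powr q) ^ n)
            \<and> norm z \<le> r * (1/2) ^ n"
        using n2 z by (auto intro!: exI[of _ n] ennreal_leI)
    next
      show "2 powr q * (1/2) ^ 3 < (1::real)" unfolding e by (rule small)
    next
      show "(\<lambda>z. ennreal (indicator (cball 0 r) z * norm (z::real^3) powr (-q))) \<in> borel_measurable borel"
        using meas by (rule measurable_compose[OF _ measurable_ennreal])
    qed (use r in simp_all)
    also have "(2 powr q * r powr (-q)) * unit_ball_vol 3 * r ^ 3 / (1 - 2 powr q * (1/2) ^ 3) = C * r powr (3 - q)"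
      proof -
      have "r powr (-q) * r ^ 3 = r powr (3 - q)"
        using r powr_add[of r "-q" 3] by (simp add: add.commute)
      then have "2 powr q * r powr (-q) * unit_ball_vol 3 * r ^ 3 = 2 powr q * unit_ball_vol 3 * r powr (3 - q)"
        by (metis mult.assoc mult.commute)
      then show ?thesis unfolding C_def e by simp
    qed
    finally show ?thesis .
  qed
  have 2: "integrable lborel (\<lambda>z::real^3. indicator (cball 0 r) z * norm z powr (-q))" if "0 < r" for r
    using 1[OF that] by (intro integrableI_nonneg) (auto intro: le_less_trans)
  have 3: "(\<integral>z. indicator (cball 0 r) z * norm (z::real^3) powr (-q) \<partial>lborel) \<le> C * r powr (3 - q)"
    if "0 < r" for r
    using 1[OF that] C 2[OF that] by (subst (asm) nn_integral_eq_integral) (auto simp: ennreal_le_iff)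
  show ?thesis using that[OF C 2 3] by blast
qed

lemma integrable_R_powr:
  assumes "3 < p"
  shows "integrable lborel (\<lambda>z. R z powr (-p))"
proof -
  have e: "2 powr (-p) * 2 ^ 3 = 2 powr (3 - p)" by (simp add: powr_diff powr_minus field_simps)
  have small: "2 powr (3 - p) < (1::real)" using assms by (simp add: powr_less_one)
  have "(\<integral>\<^sup>+z. ennreal (R z powr (-p)) \<partial>lborel)
      \<le> ennreal (1 * unit_ball_vol 3 * 2 ^ 3 / (1 - 2 powr (-p) * 2 ^ 3))"
  proof (rule nn_integral_dyadic_le)
    fix z :: "real^3"
    define n where "n = nat \<lfloor>log 2 (R z)\<rfloor>"
    have l: "log 2 (R z) \<ge> 0" using R_ge_1[of z] by simp
    have n: "real n \<le> log 2 (R z)" "log 2 (R z) < real n + 1" unfolding n_def using l by linarith+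
    have 1: "2 powr real n \<le> R z" using n(1) by (simp add: le_log_iff)
    have 2: "R z < 2 powr (real n + 1)" using n(2) by (simp add: log_less_iff)
    have "R z powr (-p) \<le> (2 powr real n) powr (-p)" using 1 assms by (intro powr_mono2') auto
    also have "\<dots> = 1 * (2 powr (-p)) ^ n" by (simp add: powr_powr powr_realpow[symmetric] mult_ac)
    finally have "ennreal (R z powr (-p)) \<le> ennreal (1 * (2 powr (-p)) ^ n)" by (rule ennreal_leI)
    moreover have "norm z \<le> 2 * 2 ^ n"
      using 2 norm_le_R[of z] by (simp add: powr_add powr_realpow mult_ac)
    ultimately show "\<exists>n. ennreal (R z powr (-p)) \<le> ennreal (1 * (2 powr (-p)) ^ n) \<and> norm z \<le> 2 * 2 ^ n"
      by blast
  qed (use small e in auto)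
  then show ?thesis by (intro integrableI_nonneg) (auto intro: le_less_trans)
qed

lemma lborel_integral_affine:
  fixes g :: "real^3 \<Rightarrow> 'b::euclidean_space"
  assumes [measurable]: "g \<in> borel_measurable borel" and "c \<noteq> 0"
  shows "integrable lborel (\<lambda>z. g (x + c *\<^sub>R z)) \<longleftrightarrow> integrable lborel g"
    and "(\<integral>z. g z \<partial>lborel) = \<bar>c\<bar> ^ 3 *\<^sub>R (\<integral>z. g (x + c *\<^sub>R z) \<partial>lborel)"
proof -
  have l: "(lborel :: (real^3) measure) = density (distr lborel borel (\<lambda>z. x + c *\<^sub>R z)) (\<lambda>_. \<bar>c\<bar> ^ DIM(real^3))"
    using assms by (intro lborel_affine) auto
  have "integrable lborel g \<longleftrightarrow> integrable (distr lborel borel (\<lambda>z. x + c *\<^sub>R z)) (\<lambda>z. \<bar>c\<bar> ^ 3 *\<^sub>R g z)"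
    by (subst l, subst integrable_density) auto
  also have "\<dots> \<longleftrightarrow> integrable lborel (\<lambda>z. \<bar>c\<bar> ^ 3 *\<^sub>R g (x + c *\<^sub>R z))"
    by (subst integrable_distr_eq) auto
  also have "\<dots> \<longleftrightarrow> integrable lborel (\<lambda>z. g (x + c *\<^sub>R z))"
    proof
    assume "integrable lborel (\<lambda>z. \<bar>c\<bar> ^ 3 *\<^sub>R g (x + c *\<^sub>R z))"
    then have "integrable lborel (\<lambda>z. (1 / \<bar>c\<bar> ^ 3) *\<^sub>R \<bar>c\<bar> ^ 3 *\<^sub>R g (x + c *\<^sub>R z))"
      by (rule integrable_scaleR_right)
    then show "integrable lborel (\<lambda>z. g (x + c *\<^sub>R z))" using assms(2) by simp
  qed (rule integrable_scaleR_right)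
  finally show "integrable lborel (\<lambda>z. g (x + c *\<^sub>R z)) \<longleftrightarrow> integrable lborel g" by simp
  have "(\<integral>z. g z \<partial>lborel) = (\<integral>z. \<bar>c\<bar> ^ 3 *\<^sub>R g z \<partial>distr lborel borel (\<lambda>z. x + c *\<^sub>R z))"
    by (subst l, subst integral_density) auto
  also have "\<dots> = (\<integral>z. \<bar>c\<bar> ^ 3 *\<^sub>R g (x + c *\<^sub>R z) \<partial>lborel)"
    by (subst integral_distr) auto
  finally show "(\<integral>z. g z \<partial>lborel) = \<bar>c\<bar> ^ 3 *\<^sub>R (\<integral>z. g (x + c *\<^sub>R z) \<partial>lborel)" by simp
qed

lemma lborel_integral_reflect:
  fixes g :: "real^3 \<Rightarrow> 'b::euclidean_space"
  assumes [measurable]: "g \<in> borel_measurable borel"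
  shows "integrable lborel (\<lambda>z. g (x - z)) \<longleftrightarrow> integrable lborel g"
    and "(\<integral>z. g (x - z) \<partial>lborel) = (\<integral>z. g z \<partial>lborel)"
  using lborel_integral_affine[OF assms, of "-1" x] by simp_all

section \<open>The Coulomb kernel\<close>

text \<open>Minus the gradient of \<open>1 / norm z\<close>, with value 0 at the origin.\<close>

definition coulomb :: "real^3 \<Rightarrow> real^3" where
  "coulomb z = (1 / norm z ^ 3) *\<^sub>R z"

lemma norm_coulomb: "norm (coulomb z) = norm z powr (-2)"
  by (cases "z = 0") (auto simp: coulomb_def powr_minus powr_realpow field_simps power2_eq_square power3_eq_cube)

lemma coulomb_scale: "0 < c \<Longrightarrow> coulomb (c *\<^sub>R z) = (1 / c ^ 2) *\<^sub>R coulomb z"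
  by (simp add: coulomb_def power_mult_distrib power2_eq_square power3_eq_cube)

lemma borel_measurable_coulomb [measurable]: "coulomb \<in> borel_measurable borel"
  unfolding coulomb_def[abs_def] by measurable

text \<open>Changing the scalar factor costs 3 and changing the vector costs 1, which gives the 4.
  The longer vector keeps its own factor in the denominator, so that the quotient
  \<open>norm (a - b) / norm b\<close> is available for interpolation.\<close>

lemma coulomb_diff_le:
  assumes "0 < norm a" "norm a \<le> norm b"
  shows "norm (coulomb a - coulomb b) \<le> 4 * norm (a - b) / (norm a ^ 2 * norm b)"
proof -
  define s t where "s = norm a" and "t = norm b"
  have st: "0 < s" "s \<le> t" "0 < t" using assms by (auto simp: s_def t_def)
  have d: "t - s \<le> norm (a - b)" unfolding s_def t_def by (metis norm_minus_commute norm_triangle_ineq2)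
  have "coulomb a - coulomb b = (1 / s ^ 3 - 1 / t ^ 3) *\<^sub>R a + (1 / t ^ 3) *\<^sub>R (a - b)"
    by (simp add: coulomb_def s_def t_def algebra_simps)
  then have "norm (coulomb a - coulomb b) \<le> \<bar>1 / s ^ 3 - 1 / t ^ 3\<bar> * s + (1 / t ^ 3) * norm (a - b)"
    using norm_triangle_ineq[of "(1 / s ^ 3 - 1 / t ^ 3) *\<^sub>R a" "(1 / t ^ 3) *\<^sub>R (a - b)"] st
    by (simp add: s_def)
  also have "\<bar>1 / s ^ 3 - 1 / t ^ 3\<bar> * s = (t - s) * (t ^ 2 + t * s + s ^ 2) / (s ^ 2 * t ^ 3)"
  proof -
    have "1 / t ^ 3 \<le> 1 / s ^ 3" using st by (intro divide_left_mono power_mono) auto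
    then have "\<bar>1 / s ^ 3 - 1 / t ^ 3\<bar> * s = (1 / s ^ 3 - 1 / t ^ 3) * s" by simp
    also have "\<dots> = (t - s) * (t ^ 2 + t * s + s ^ 2) / (s ^ 2 * t ^ 3)"
      using st by (simp add: divide_simps) (simp add: algebra_simps power2_eq_square power3_eq_cube)
    finally show ?thesis .
  qed
  also have "\<dots> \<le> norm (a - b) * (3 * t ^ 2) / (s ^ 2 * t ^ 3)"
  proof -
    have "t * s \<le> t * t" "s * s \<le> t * t" using st by (auto intro!: mult_mono)
    then have "t ^ 2 + t * s + s ^ 2 \<le> 3 * t ^ 2" by (simp add: power2_eq_square)
    then have "(t - s) * (t ^ 2 + t * s + s ^ 2) \<le> norm (a - b) * (3 * t ^ 2)"
      using st d by (intro mult_mono) auto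
    then show ?thesis using st by (intro divide_right_mono) auto
  qed
  also have "\<dots> = 3 * norm (a - b) / (s ^ 2 * t)"
    using st by (simp add: power2_eq_square power3_eq_cube mult_ac)
  also have "1 / t ^ 3 * norm (a - b) \<le> norm (a - b) / (s ^ 2 * t)"
  proof -
    have "s ^ 2 * t \<le> t ^ 2 * t" using st by (intro mult_right_mono power_mono) auto
    also have "t ^ 2 * t = t ^ 3" by (simp add: power2_eq_square power3_eq_cube)
    finally show ?thesis using st by (simp add: divide_left_mono)
  qed
  finally show ?thesis by (simp add: s_def t_def add_divide_distrib[symmetric])
qed

text \<open>For \<open>norm a \<le> norm b\<close> the quotient
  \<open>norm (a - b) / (2 * norm b)\<close> is at most 1, so raising it to the power \<theta> only
  increases it. For \<theta> < 1 the resulting singularity of order \<open>2 + \<theta>\<close> is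
  locally integrable in dimension 3; the Lipschitz case \<theta> = 1 is not.\<close>

lemma coulomb_holder:
  assumes "a \<noteq> 0" "b \<noteq> 0" "0 \<le> \<theta>" "\<theta> \<le> 1"
  shows "norm (coulomb a - coulomb b)
    \<le> 8 * norm (a - b) powr \<theta> * (norm a powr (-(2 + \<theta>)) + norm b powr (-(2 + \<theta>)))"
proof -
  have le_case: "norm (coulomb a - coulomb b)
    \<le> 8 * norm (a - b) powr \<theta> * (norm a powr (-(2 + \<theta>)) + norm b powr (-(2 + \<theta>)))"
    if le: "norm a \<le> norm b" "a \<noteq> 0" "b \<noteq> 0" for a b
  proof -
    define d where "d = norm (a - b)"
    define s t where "s = norm a" and "t = norm b"
    have st: "0 < s" "s \<le> t" "0 < t" using le by (auto simp: s_def t_def)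
    have dt: "d / (2 * t) \<le> 1" "0 \<le> d"
      using norm_triangle_ineq4[of a b] st by (auto simp: d_def s_def t_def)
    have "norm (coulomb a - coulomb b) \<le> 8 * (1 / s ^ 2) * (d / (2 * t))"
      using coulomb_diff_le[of a b] le st by (simp add: s_def t_def d_def mult.commute)
    moreover have "d / (2 * t) \<le> (d / (2 * t)) powr \<theta>"
      using powr_mono'[of \<theta> 1 "d / (2 * t)"] dt st assms by simp
    moreover have "(d / (2 * t)) powr \<theta> \<le> d powr \<theta> * s powr (-\<theta>)"
    proof -
      have "(d / (2 * t)) powr \<theta> \<le> (d / s) powr \<theta>"
        using st dt assms by (intro powr_mono2 divide_left_mono) auto
      then show ?thesis using dt st by (simp add: powr_divide powr_minus_divide)
    qed
    ultimately have "norm (coulomb a - coulomb b) \<le> 8 * (1 / s ^ 2) * (d powr \<theta> * s powr (-\<theta>))"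
      using st by (smt (verit) mult_left_mono divide_nonneg_nonneg zero_le_power2)
    also have "8 * (1 / s ^ 2) * (d powr \<theta> * s powr (-\<theta>)) = 8 * d powr \<theta> * s powr (-(2 + \<theta>))"
      using st powr_add[of s 2 \<theta>] powr_minus_divide[of s \<theta>] powr_minus_divide[of s "2 + \<theta>"] by simp
    finally have "norm (coulomb a - coulomb b) \<le> 8 * d powr \<theta> * s powr (-(2 + \<theta>))" .
    also have "\<dots> \<le> 8 * d powr \<theta> * (s powr (-(2 + \<theta>)) + t powr (-(2 + \<theta>)))"
      by (intro mult_left_mono) auto
    finally show ?thesis by (simp add: d_def s_def t_def)
  qed
  show ?thesis
  proof (cases "norm a \<le> norm b")
    case False
    then show ?thesis using le_case[of b a] assms by (simp add: norm_minus_commute add.commute)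
  qed (use le_case assms in blast)
qed

text \<open>Near \<open>x\<close> the density is of size \<open>R x powr (-p)\<close> and the kernel is integrable; far from
  \<open>x\<close> the kernel is of size \<open>R x powr (-2)\<close> and the density is integrable.\<close>

lemma coulomb_field_bound:
  assumes p: "3 < p"
  obtains C where "0 < C" and
    "\<And>r B x. r \<in> borel_measurable borel \<Longrightarrow> (\<And>y. \<bar>r y\<bar> \<le> B * R y powr (-p)) \<Longrightarrow>
        integrable lborel (\<lambda>y. r y *\<^sub>R coulomb (x - y)) \<and>
        (\<integral>y. norm (r y *\<^sub>R coulomb (x - y)) \<partial>lborel) \<le> B * C * R x powr (-2)"
proof -
  obtain C2 where C2: "0 < C2"
    "\<And>r. 0 < r \<Longrightarrow> integrable lborel (\<lambda>z::real^3. indicator (cball 0 r) z * norm z powr (-2))"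
    "\<And>r. 0 < r \<Longrightarrow> (\<integral>z. indicator (cball 0 r) z * norm (z::real^3) powr (-2) \<partial>lborel) \<le> C2 * r powr (3 - 2)"
    by (rule powr_norm_integrable_on_balls[of 2]) auto
  define J where "J = (\<integral>z. R z powr (-p) \<partial>lborel)"
  have J: "J \<ge> 0" unfolding J_def by simp
  define C where "C = 2 powr p * C2 + 4 * J"
  have "C > 0" using C2 J unfolding C_def by (intro add_pos_nonneg mult_pos_pos) auto
  moreover have "integrable lborel (\<lambda>y. r y *\<^sub>R coulomb (x - y)) \<and>
        (\<integral>y. norm (r y *\<^sub>R coulomb (x - y)) \<partial>lborel) \<le> B * C * R x powr (-2)"
    if [measurable]: "r \<in> borel_measurable borel" and r: "\<And>y. \<bar>r y\<bar> \<le> B * R y powr (-p)" for r B x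
  proof -
    have "0 \<le> \<bar>r x\<bar>" by simp
    also have "\<dots> \<le> B * R x powr (-p)" by (rule r)
    finally have B: "0 \<le> B" by (simp add: zero_le_mult_iff less_imp_neq[OF R_pos, symmetric])
    define g where "g = (\<lambda>z::real^3. indicator (cball 0 (R x / 2)) z * norm z powr (-2))"
    have gm [measurable]: "g \<in> borel_measurable borel"
      unfolding g_def by (intro borel_measurable_times borel_measurable_indicator) measurable
    have gi: "integrable lborel (\<lambda>y. g (x - y))" "(\<integral>y. g (x - y) \<partial>lborel) \<le> C2 * R x"
    proof -
      show "integrable lborel (\<lambda>y. g (x - y))"
        using lborel_integral_reflect(1)[OF gm, of x] C2(2)[of "R x / 2"] by (simp add: g_def)
      have "(\<integral>y. g (x - y) \<partial>lborel) \<le> C2 * (R x / 2) powr 1"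
        using lborel_integral_reflect(2)[OF gm, of x] C2(3)[of "R x / 2"] by (simp add: g_def)
      also have "\<dots> \<le> C2 * R x" using C2(1) R_pos[of x] by (simp add: less_imp_le)
      finally show "(\<integral>y. g (x - y) \<partial>lborel) \<le> C2 * R x" .
    qed
    define h where "h y = B * (2 powr p * R x powr (-p)) * g (x - y) + B * (4 * R x powr (-2)) * R y powr (-p)" for y
    have hi: "integrable lborel h"
      unfolding h_def by (intro Bochner_Integration.integrable_add integrable_mult_right gi integrable_R_powr p)
    have le: "norm (r y *\<^sub>R coulomb (x - y)) \<le> h y" for y
    proof (cases "norm (x - y) \<le> R x / 2")
      case True
      have "norm (r y *\<^sub>R coulomb (x - y)) = \<bar>r y\<bar> * g (x - y)"
        using True by (simp add: norm_coulomb g_def)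
      also have "\<dots> \<le> B * (2 powr p * R x powr (-p)) * g (x - y)"
        using r[of y] R_powr_minus_half[OF True, of p] p B
        by (intro mult_right_mono order_trans[OF r] mult_left_mono) (auto simp: g_def)
      also have "\<dots> \<le> h y" unfolding h_def using B by simp
      finally show ?thesis .
    next
      case False
      have "norm (coulomb (x - y)) \<le> (R x / 2) powr (-2)"
        unfolding norm_coulomb using False by (intro powr_mono2') auto
      also have "\<dots> = 4 * R x powr (-2)"
        by (simp add: powr_divide powr_minus_divide)
      finally have "norm (r y *\<^sub>R coulomb (x - y)) \<le> (B * R y powr (-p)) * (4 * R x powr (-2))"
        using r[of y] by (simp add: mult_mono)
      also have "\<dots> \<le> h y" unfolding h_def using B by (simp add: g_def mult_ac)
      finally show ?thesis .
    qed
    have 1: "integrable lborel (\<lambda>y. r y *\<^sub>R coulomb (x - y))"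
      using le by (intro Bochner_Integration.integrable_bound[OF hi]) (auto intro: order_trans[OF le[simplified] abs_ge_self])
    have "(\<integral>y. norm (r y *\<^sub>R coulomb (x - y)) \<partial>lborel) \<le> (\<integral>y. h y \<partial>lborel)"
      by (intro integral_mono integrable_norm 1 hi le)
    also have "\<dots> = B * (2 powr p * R x powr (-p)) * (\<integral>y. g (x - y) \<partial>lborel) + B * (4 * R x powr (-2)) * J"
      unfolding h_def J_def
      by (subst Bochner_Integration.integral_add) (use gi integrable_R_powr[OF p] in \<open>auto intro!: integrable_mult_right\<close>)
    also have "\<dots> \<le> B * (2 powr p * R x powr (-p)) * (C2 * R x) + B * (4 * R x powr (-2)) * J"
      using gi B by (intro add_right_mono mult_left_mono) auto
    also have "\<dots> = B * (2 powr p * C2 * (R x powr (-p) * R x powr 1) + 4 * J * R x powr (-2))"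
      using R_pos[of x] by (simp add: algebra_simps)
    also have "R x powr (-p) * R x powr 1 = R x powr (1 - p)"
      by (subst powr_add[symmetric]) simp
    \<comment> \<open>The contribution of the points near \<open>x\<close> decays like
      \<open>R x powr (1 - p)\<close>, and \<open>p > 3\<close> makes it no larger than the far
      contribution.\<close>
    also have "B * (2 powr p * C2 * R x powr (1 - p) + 4 * J * R x powr (-2))
       \<le> B * (2 powr p * C2 * R x powr (-2) + 4 * J * R x powr (-2))"
      using B C2 p R_ge_1[of x] by (intro mult_left_mono add_right_mono powr_mono) auto
    also have "\<dots> = B * C * R x powr (-2)" unfolding C_def by (simp add: algebra_simps)
    finally show ?thesis using 1 by simp
  qed
  ultimately show ?thesis using that by blast
qed

text \<open>Within distance \<open>R x / 2\<close> of \<open>x\<close> the Hoelder bound of the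
  kernel meets a density of size \<open>R x powr (-p)\<close>. Beyond that distance, since
  \<open>y\<close> is within \<open>R x / 4\<close> of \<open>x\<close>, both arguments of the
  kernel have norm at least \<open>R x / 4\<close>; the Lipschitz bound of order
  \<open>R x powr (-3)\<close> then meets the finite mass of the weight.\<close>

lemma coulomb_field_diff:
  assumes p: "3 < p" and \<theta>: "0 \<le> \<theta>" "\<theta> < 1"
  obtains C where "0 < C" and
    "\<And>r B x y. r \<in> borel_measurable borel \<Longrightarrow> (\<And>y. \<bar>r y\<bar> \<le> B * R y powr (-p)) \<Longrightarrow>
        norm (x - y) \<le> R x / 4 \<Longrightarrow>
        norm ((\<integral>z. r z *\<^sub>R coulomb (x - z) \<partial>lborel) - (\<integral>z. r z *\<^sub>R coulomb (y - z) \<partial>lborel))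
        \<le> B * C * (norm (x - y) * R x powr (-3) + norm (x - y) powr \<theta> * R x powr (1 - \<theta> - p))"
proof -
  obtain C1 where C1: "\<And>r B x. r \<in> borel_measurable borel \<Longrightarrow> (\<And>y. \<bar>r y\<bar> \<le> B * R y powr (-p)) \<Longrightarrow>
        integrable lborel (\<lambda>y. r y *\<^sub>R coulomb (x - y))"
    by (rule coulomb_field_bound[OF p]) blast
  obtain C2 where C2: "0 < C2"
    "\<And>r. 0 < r \<Longrightarrow> integrable lborel (\<lambda>z::real^3. indicator (cball 0 r) z * norm z powr (-(2 + \<theta>)))"
    "\<And>r. 0 < r \<Longrightarrow> (\<integral>z. indicator (cball 0 r) z * norm (z::real^3) powr (-(2 + \<theta>)) \<partial>lborel) \<le> C2 * r powr (3 - (2 + \<theta>))"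
    by (rule powr_norm_integrable_on_balls[of "2 + \<theta>"]) (use \<theta> in auto)
  define J where "J = (\<integral>z. R z powr (-p) \<partial>lborel)"
  have J: "J \<ge> 0" unfolding J_def by simp
  define C where "C = 16 * 2 powr p * C2 + 256 * J"
  have "C > 0" using C2 J unfolding C_def by (intro add_pos_nonneg mult_pos_pos) auto
  moreover have "norm ((\<integral>z. r z *\<^sub>R coulomb (x - z) \<partial>lborel) - (\<integral>z. r z *\<^sub>R coulomb (y - z) \<partial>lborel))
        \<le> B * C * (norm (x - y) * R x powr (-3) + norm (x - y) powr \<theta> * R x powr (1 - \<theta> - p))"
    if [measurable]: "r \<in> borel_measurable borel" and r: "\<And>y. \<bar>r y\<bar> \<le> B * R y powr (-p)"
      and xy: "norm (x - y) \<le> R x / 4" for r B x y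
  proof -
    have "0 \<le> \<bar>r x\<bar>" by simp
    also have "\<dots> \<le> B * R x powr (-p)" by (rule r)
    finally have B: "0 \<le> B" by (simp add: zero_le_mult_iff less_imp_neq[OF R_pos, symmetric])
    define d where "d = norm (x - y)"
    \<comment> \<open>Cut off at \<open>R x\<close> instead of \<open>R x / 2\<close>, so that one
      ball serves the singularity at \<open>x\<close> and the one at \<open>y\<close>.\<close>
    define g where "g = (\<lambda>z::real^3. indicator (cball 0 (R x)) z * norm z powr (-(2 + \<theta>)))"
    have gm [measurable]: "g \<in> borel_measurable borel"
      unfolding g_def by (intro borel_measurable_times borel_measurable_indicator) measurable
    have g0: "0 \<le> g z" for z by (simp add: g_def)
    have gi: "integrable lborel (\<lambda>z. g (u - z))" "(\<integral>z. g (u - z) \<partial>lborel) \<le> C2 * R x powr (1 - \<theta>)" for u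
      using lborel_integral_reflect[OF gm, of u] C2(2,3)[of "R x"] by (simp_all add: g_def)
    define near where "near = B * (2 powr p * R x powr (-p)) * (8 * d powr \<theta>)"
    define far where "far = B * (256 * d * R x powr (-3))"
    have nf: "0 \<le> near" "0 \<le> far" unfolding near_def far_def d_def using B by auto
    define h where "h z = near * g (x - z) + near * g (y - z) + far * R z powr (-p)" for z
    have hi: "integrable lborel h"
      unfolding h_def by (intro Bochner_Integration.integrable_add integrable_mult_right gi integrable_R_powr p)
    have le: "norm (r z *\<^sub>R coulomb (x - z) - r z *\<^sub>R coulomb (y - z)) \<le> h z" if z: "z \<noteq> x" "z \<noteq> y" for z
    proof (cases "norm (x - z) \<le> R x / 2")
      case True
      have y: "norm (y - z) \<le> R x"
      proof -
        have "norm (y - z) \<le> norm (x - y) + norm (x - z)"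
          using norm_triangle_ineq[of "y - x" "x - z"] by (simp add: norm_minus_commute)
        then show ?thesis using True xy R_pos[of x] by linarith
      qed
      have "norm (r z *\<^sub>R coulomb (x - z) - r z *\<^sub>R coulomb (y - z)) = \<bar>r z\<bar> * norm (coulomb (x - z) - coulomb (y - z))"
        by (simp add: scaleR_diff_right[symmetric])
      also have "\<dots> \<le> (B * (2 powr p * R x powr (-p))) * (8 * d powr \<theta> * (norm (x - z) powr (-(2 + \<theta>)) + norm (y - z) powr (-(2 + \<theta>))))"
      proof (rule mult_mono)
        show "\<bar>r z\<bar> \<le> B * (2 powr p * R x powr (-p))"
          using R_powr_minus_half[OF True, of p] p B by (intro order_trans[OF r] mult_left_mono) auto
        show "norm (coulomb (x - z) - coulomb (y - z)) \<le> 8 * d powr \<theta> * (norm (x - z) powr (-(2 + \<theta>)) + norm (y - z) powr (-(2 + \<theta>)))"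
          using coulomb_holder[of "x - z" "y - z" \<theta>] z \<theta> by (simp add: d_def)
      qed (use B in auto)
      also have "\<dots> = near * g (x - z) + near * g (y - z)"
      proof -
        have "norm (x - z) \<le> R x" using True R_pos[of x] by linarith
        then have "x - z \<in> cball 0 (R x)" "y - z \<in> cball 0 (R x)" using y by simp_all
        then show ?thesis
          unfolding near_def g_def by (simp only: indicator_simps) (simp add: algebra_simps)
      qed
      also have "\<dots> \<le> h z" unfolding h_def using nf by simp
      finally show ?thesis .
    next
      case False
      have a: "R x / 4 \<le> norm (x - z)" using False R_pos[of x] by linarith
      have b: "R x / 4 \<le> norm (y - z)"
        using norm_triangle_ineq[of "x - y" "y - z"] False xy by simp
      have *: "4 * d / (s ^ 2 * t) \<le> 256 * d * R x powr (-3)" if "R x / 4 \<le> s" "R x / 4 \<le> t" for s t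
      proof -
        have "(R x / 4) ^ 2 * (R x / 4) \<le> s ^ 2 * t"
          using that less_imp_le[OF R_pos[of x]] by (intro mult_mono power_mono) auto
        then have "4 * d / (s ^ 2 * t) \<le> 4 * d / ((R x / 4) ^ 2 * (R x / 4))"
          using R_pos[of x] by (intro divide_left_mono) (auto simp: d_def intro!: mult_pos_pos zero_less_power less_le_trans[OF _ that(1)] less_le_trans[OF _ that(2)])
        also have "\<dots> = 256 * d * R x powr (-3)"
          using R_pos[of x] by (simp add: powr_minus_divide power2_eq_square power3_eq_cube)
        finally show ?thesis .
      qed
      have "norm (coulomb (x - z) - coulomb (y - z)) \<le> 256 * d * R x powr (-3)"
      proof (cases "norm (x - z) \<le> norm (y - z)")
        case True
        then show ?thesis using coulomb_diff_le[of "x - z" "y - z"] *[OF a b] z by (simp add: d_def)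
      next
        case False
        then show ?thesis using coulomb_diff_le[of "y - z" "x - z"] *[OF b a] z
          by (simp add: d_def norm_minus_commute)
      qed
      then have "norm (r z *\<^sub>R coulomb (x - z) - r z *\<^sub>R coulomb (y - z)) \<le> (B * R z powr (-p)) * (256 * d * R x powr (-3))"
        using mult_mono[OF r[of z]] B by (simp add: scaleR_diff_right[symmetric])
      also have "\<dots> \<le> h z" unfolding h_def far_def using nf g0 by (simp add: mult_ac)
      finally show ?thesis .
    qed
    \<comment> \<open>The kernel estimates require both arguments to be nonzero; the two excluded
      points form a null set.\<close>
    have "AE z in lborel. z \<noteq> x" "AE z in lborel. z \<noteq> y"
      by (auto intro!: AE_lborel_singleton)
    then have ae: "AE z in lborel. norm (r z *\<^sub>R coulomb (x - z) - r z *\<^sub>R coulomb (y - z)) \<le> h z"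
      by eventually_elim (rule le)
    have i: "integrable lborel (\<lambda>z. r z *\<^sub>R coulomb (u - z))" for u
      by (rule C1[OF \<open>r \<in> borel_measurable borel\<close> r])
    have "norm ((\<integral>z. r z *\<^sub>R coulomb (x - z) \<partial>lborel) - (\<integral>z. r z *\<^sub>R coulomb (y - z) \<partial>lborel))
       = norm (\<integral>z. r z *\<^sub>R coulomb (x - z) - r z *\<^sub>R coulomb (y - z) \<partial>lborel)"
      by (subst Bochner_Integration.integral_diff[OF i i]) simp
    also have "\<dots> \<le> (\<integral>z. norm (r z *\<^sub>R coulomb (x - z) - r z *\<^sub>R coulomb (y - z)) \<partial>lborel)"
      by (rule integral_norm_bound)
    also have "\<dots> \<le> (\<integral>z. h z \<partial>lborel)"
      by (intro integral_mono_AE integrable_norm Bochner_Integration.integrable_diff i hi ae)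
    also have "\<dots> = near * (\<integral>z. g (x - z) \<partial>lborel) + near * (\<integral>z. g (y - z) \<partial>lborel) + far * J"
      unfolding h_def J_def using gi(1) integrable_R_powr[OF p] by simp
    also have "\<dots> \<le> near * (C2 * R x powr (1 - \<theta>)) + near * (C2 * R x powr (1 - \<theta>)) + far * J"
      using nf gi(2) by (intro add_mono mult_left_mono) auto
    also have "\<dots> = B * (16 * 2 powr p * C2 * (d powr \<theta> * (R x powr (-p) * R x powr (1 - \<theta>))) + 256 * J * (d * R x powr (-3)))"
      unfolding near_def far_def by (simp add: algebra_simps)
    also have "R x powr (-p) * R x powr (1 - \<theta>) = R x powr (1 - \<theta> - p)"
      by (simp add: powr_add[symmetric])
    also have "B * (16 * 2 powr p * C2 * (d powr \<theta> * R x powr (1 - \<theta> - p)) + 256 * J * (d * R x powr (-3)))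
      \<le> B * (C * (d powr \<theta> * R x powr (1 - \<theta> - p)) + C * (d * R x powr (-3)))"
      unfolding C_def using B J C2 by (intro mult_left_mono add_mono mult_right_mono) (auto simp: d_def)
    finally show ?thesis by (simp add: d_def algebra_simps)
  qed
  ultimately show ?thesis using that by blast
qed

text \<open>Substituting \<open>z = x - y\<close> moves the dependence on \<open>x\<close> from the
  singular kernel to the density, which is continuous. Dominated convergence then applies along
  sequences, because a convergent sequence of points is bounded and bounded shifts change the weight
  by a constant factor only.\<close>

lemma continuous_on_coulomb_field:
  fixes \<rho> :: "real \<times> (real^3) \<Rightarrow> real"
  assumes p: "3 < p" and cont: "continuous_on (S \<times> UNIV) \<rho>"
    and bd: "\<And>t y. t \<in> S \<Longrightarrow> \<bar>\<rho> (t, y)\<bar> \<le> B * R y powr (-p)"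
  shows "continuous_on (S \<times> UNIV) (\<lambda>(t, x). \<integral>y. \<rho> (t, y) *\<^sub>R coulomb (x - y) \<partial>lborel)"
proof -
  have slice: "continuous_on UNIV (\<lambda>y. \<rho> (t, y))" if "t \<in> S" for t
    by (rule continuous_on_compose2[OF cont]) (use that in \<open>auto intro!: continuous_intros\<close>)
  then have meas: "(\<lambda>y. \<rho> (t, y)) \<in> borel_measurable borel" if "t \<in> S" for t
    using that by (intro borel_measurable_continuous_onI)
  have shift: "(\<integral>y. \<rho> (t, y) *\<^sub>R coulomb (x - y) \<partial>lborel) = (\<integral>z. \<rho> (t, x - z) *\<^sub>R coulomb z \<partial>lborel)"
    if "t \<in> S" for t x
  proof -
    have [measurable]: "(\<lambda>y. \<rho> (t, y)) \<in> borel_measurable borel" by (rule meas[OF that])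
    show ?thesis
      using lborel_integral_reflect(2)[of "\<lambda>z. \<rho> (t, x - z) *\<^sub>R coulomb z" x] by simp
  qed
  obtain C2 where C2: "\<And>r. 0 < r \<Longrightarrow> integrable lborel (\<lambda>z::real^3. indicator (cball 0 r) z * norm z powr (-2))"
    by (rule powr_norm_integrable_on_balls[of 2]) auto
  show ?thesis
    unfolding continuous_on_sequentially
  proof (intro allI ballI impI, elim conjE)
    fix X :: "nat \<Rightarrow> real \<times> (real^3)" and a
    assume a: "a \<in> S \<times> UNIV" and XS: "\<forall>n. X n \<in> S \<times> UNIV" and lim: "X \<longlonglongrightarrow> a"
    obtain t x where tx: "a = (t, x)" by force
    define s where "s = (\<lambda>n. fst (X n))"
    define y where "y = (\<lambda>n. snd (X n))"
    have X: "X n = (s n, y n)" for n by (simp add: s_def y_def)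
    have S: "t \<in> S" "s n \<in> S" for n using a XS[rule_format, of n] X[of n] tx by auto
    have "y \<longlonglongrightarrow> x" using tendsto_snd[OF lim] by (simp add: y_def tx)
    then obtain M where M: "\<And>n. norm (y n) \<le> M" "M \<ge> 0"
      using convergent_imp_Bseq[of y] unfolding convergent_def Bseq_def by (metis less_imp_le)
    \<comment> \<open>Dominating function: the kernel singularity inside the unit ball, the weight
      outside, and \<open>(1 + M) powr p\<close> for shifts of norm at most
      \<open>M\<close>.\<close>
    define w where "w z = B * (1 + M) powr p * (indicator (cball 0 1) z * norm z powr (-2) + R z powr (-p))" for z :: "real^3"
    have "0 \<le> \<bar>\<rho> (t, x)\<bar>" by simp
    also have "\<dots> \<le> B * R x powr (-p)" by (rule bd[OF S(1)])
    finally have B: "0 \<le> B" by (simp add: zero_le_mult_iff less_imp_neq[OF R_pos, symmetric])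
    have "(\<lambda>n. \<integral>z. \<rho> (s n, y n - z) *\<^sub>R coulomb z \<partial>lborel) \<longlonglongrightarrow> (\<integral>z. \<rho> (t, x - z) *\<^sub>R coulomb z \<partial>lborel)"
    proof (rule integral_dominated_convergence[where w = w])
      show "(\<lambda>z. \<rho> (t, x - z) *\<^sub>R coulomb z) \<in> borel_measurable lborel"
        using measurable_compose[OF _ meas[OF S(1)], of "\<lambda>z. x - z"] by simp
      show "(\<lambda>z. \<rho> (s n, y n - z) *\<^sub>R coulomb z) \<in> borel_measurable lborel" for n
        using measurable_compose[OF _ meas[OF S(2)[of n]], of "\<lambda>z. y n - z"] by simp
      show "integrable lborel w" unfolding w_def
        by (intro integrable_mult_right Bochner_Integration.integrable_add C2 integrable_R_powr p) auto
      show "AE z in lborel. (\<lambda>n. \<rho> (s n, y n - z) *\<^sub>R coulomb z) \<longlonglongrightarrow> \<rho> (t, x - z) *\<^sub>R coulomb z"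
      proof (intro AE_I2 tendsto_scaleR tendsto_const)
        fix z
        have l: "(\<lambda>n. (s n, y n - z)) \<longlonglongrightarrow> (t, x - z)"
          using lim \<open>y \<longlonglongrightarrow> x\<close> tendsto_fst[OF lim]
          by (intro tendsto_Pair tendsto_diff tendsto_const) (auto simp: s_def tx)
        have "(\<rho> \<circ> (\<lambda>n. (s n, y n - z))) \<longlonglongrightarrow> \<rho> (t, x - z)"
          using cont[unfolded continuous_on_sequentially] S l by auto
        then show "(\<lambda>n. \<rho> (s n, y n - z)) \<longlonglongrightarrow> \<rho> (t, x - z)" by (simp add: o_def)
      qed
      show "AE z in lborel. norm (\<rho> (s n, y n - z) *\<^sub>R coulomb z) \<le> w z" for n
      proof (rule AE_I2)
        fix z
        have "norm (z - (- (y n - z))) \<le> M" using M(1)[of n] by (simp add: norm_minus_commute)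
        then have 1: "R (y n - z) powr (-p) \<le> (1 + M) powr p * R z powr (-p)"
          using R_powr_minus_near[of z "-(y n - z)" M p] p by (simp add: R_def norm_minus_commute)
        have 2: "R z powr (-p) * norm z powr (-2) \<le> indicator (cball 0 1) z * norm z powr (-2) + R z powr (-p)"
        proof (cases "norm z \<le> 1")
          case True
          then show ?thesis
            using mult_right_mono[OF R_powr_minus_le_1[of p z], of "norm z powr (-2)"] p
            by (simp add: add_increasing2)
        next
          case False
          then have "norm z powr (-2) \<le> 1 powr (-2)" by (intro powr_mono2') auto
          then show ?thesis using mult_left_mono[of "norm z powr (-2)" 1 "R z powr (-p)"] False by simp
        qed
        have "norm (\<rho> (s n, y n - z) *\<^sub>R coulomb z) \<le> (B * R (y n - z) powr (-p)) * norm z powr (-2)"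
          using bd[OF S(2)[of n], of "y n - z"] by (simp add: norm_coulomb mult_right_mono)
        also have "\<dots> \<le> (B * ((1 + M) powr p * R z powr (-p))) * norm z powr (-2)"
          using 1 B by (intro mult_right_mono mult_left_mono) auto
        also have "\<dots> = B * (1 + M) powr p * (R z powr (-p) * norm z powr (-2))" by simp
        also have "\<dots> \<le> w z" unfolding w_def using 2 B by (intro mult_left_mono) auto
        finally show "norm (\<rho> (s n, y n - z) *\<^sub>R coulomb z) \<le> w z" .
      qed
    qed
    then show "((\<lambda>(t, x). \<integral>y. \<rho> (t, y) *\<^sub>R coulomb (x - y) \<partial>lborel) \<circ> X)
      \<longlonglongrightarrow> (case a of (t, x) \<Rightarrow> \<integral>y. \<rho> (t, y) *\<^sub>R coulomb (x - y) \<partial>lborel)"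
      using S by (simp add: o_def X tx shift)
  qed
qed

section \<open>A maximum principle along approximate characteristics\<close>

lemma partial_deriv_eq:
  assumes "(g has_derivative g') (at x)"
  shows "partial_deriv i g x = g' (axis i 1)"
proof -
  have "((\<lambda>h. g (x + h *\<^sub>R axis i 1)) has_derivative (\<lambda>h. g' (h *\<^sub>R axis i 1))) (at 0)"
    by (rule has_derivative_compose[of "\<lambda>h. x + h *\<^sub>R axis i 1", where g = g])
      (use assms in \<open>auto intro!: derivative_eq_intros\<close>)
  then have "((\<lambda>h. g (x + h *\<^sub>R axis i 1)) has_vector_derivative g' (axis i 1)) (at 0)"
    by (simp add: has_vector_derivative_def linear_cmul[OF has_derivative_linear[OF assms]])
  then show ?thesis
    unfolding partial_deriv_def by (rule vector_derivative_at)
qed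

lemma inner_grad_eq:
  assumes "(g has_derivative g') (at x)"
  shows "v \<bullet> grad g x = g' v"
proof -
  have lin: "linear g'" by (rule has_derivative_linear[OF assms])
  have "v \<bullet> grad g x = (\<Sum>i\<in>UNIV. v $ i * g' (axis i 1))"
    by (simp add: inner_vec_def grad_def partial_deriv_eq[OF assms])
  also have "\<dots> = g' (\<Sum>i\<in>UNIV. v $ i *\<^sub>R axis i 1)"
    by (simp add: linear_sum[OF lin] linear_cmul[OF lin])
  also have "(\<Sum>i\<in>UNIV. v $ i *\<^sub>R axis i 1) = v"
    using basis_expansion[of v] by (simp add: scalar_mult_eq_scaleR)
  finally show ?thesis .
qed

lemma has_derivative_compose_within:
  assumes "(f has_derivative f') (at x within S)" "f ` S \<subseteq> T" "(g has_derivative g') (at (f x) within T)"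
  shows "((\<lambda>x. g (f x)) has_derivative (\<lambda>h. g' (f' h))) (at x within S)"
  using has_derivative_in_compose[OF assms(1) has_derivative_subset[OF assms(3,2)]] .

text \<open>The derivatives in the equation are components of one full derivative within the half
  space of nonnegative times, so the equation says that \<open>f\<close> has derivative 0 in the
  characteristic direction.\<close>

lemma transport_derivative:
  fixes f :: "real \<times> (real^3) \<times> (real^3) \<Rightarrow> real"
  assumes df: "(f has_derivative f') (at (t, x, v) within {0..} \<times> UNIV)" and t: "0 \<le> t"
    and pde: "vector_derivative (\<lambda>s. f (s, x, v)) (at t within {0..})
          + v \<bullet> grad (\<lambda>y. f (t, y, v)) x - G \<bullet> grad (\<lambda>w. f (t, x, w)) v = 0"
  shows "f' (1, v, - G) = 0"
proof -
  have lin: "linear f'" by (rule has_derivative_linear[OF df])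
  have 1: "((\<lambda>s. f (s, x, v)) has_derivative (\<lambda>h. f' (h, 0, 0))) (at t within {0..})"
    by (rule has_derivative_compose_within[where f = "\<lambda>s. (s, x, v)" and g = f and g' = f' and T = "{0..} \<times> UNIV"])
      (auto intro!: derivative_eq_intros simp: t df zero_prod_def)
  have 2: "((\<lambda>y. f (t, y, v)) has_derivative (\<lambda>h. f' (0, h, 0))) (at x)"
    by (rule has_derivative_compose_within[where f = "\<lambda>y. (t, y, v)" and g = f and g' = f' and T = "{0..} \<times> UNIV"])
      (auto intro!: derivative_eq_intros simp: t df zero_prod_def)
  have 3: "((\<lambda>w. f (t, x, w)) has_derivative (\<lambda>h. f' (0, 0, h))) (at v)"
    by (rule has_derivative_compose_within[where f = "\<lambda>w. (t, x, w)" and g = f and g' = f' and T = "{0..} \<times> UNIV"])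
      (auto intro!: derivative_eq_intros simp: t df zero_prod_def)
  have "((\<lambda>s. f (s, x, v)) has_vector_derivative f' (1, 0, 0)) (at t within {0..})"
  proof -
    have *: "f' (h, 0, 0) = h *\<^sub>R f' (1, 0, 0)" for h
      using linear_cmul[OF lin, of h "(1, 0, 0)"] by (simp add: zero_prod_def)
    show ?thesis unfolding has_vector_derivative_def *[symmetric] by (rule 1)
  qed
  \<comment> \<open>Needed for \<open>vector_derivative\<close> to single out the derivative, in
    particular for the one-sided one at time 0.\<close>
  moreover have "at t within {0..} \<noteq> bot"
  proof -
    have "t islimpt {0..}"
      unfolding islimpt_approachable_real
    proof (intro allI impI)
      fix e :: real assume "0 < e"
      then show "\<exists>s\<in>{0..}. s \<noteq> t \<and> \<bar>s - t\<bar> < e"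
        using t by (intro bexI[of _ "t + e / 2"]) auto
    qed
    then show ?thesis by (simp add: trivial_limit_within)
  qed
  ultimately have "vector_derivative (\<lambda>s. f (s, x, v)) (at t within {0..}) = f' (1, 0, 0)"
    by (intro vector_derivative_within)
  then have "f' (1, 0, 0) + f' (0, v, 0) - f' (0, 0, G) = 0"
    using pde by (simp add: inner_grad_eq[OF 2] inner_grad_eq[OF 3])
  moreover have "f' ((1, 0, 0) + (0, v, 0) - (0, 0, G)) = f' (1, 0, 0) + f' (0, v, 0) - f' (0, 0, G)"
    by (simp only: linear_add[OF lin] linear_diff[OF lin])
  ultimately show ?thesis by simp
qed

text \<open>The gap between \<open>norm d\<close> and \<open>a\<close> absorbs the error of the
  linear approximation for small \<open>h\<close>. This is the only place where the strict
  inequalities of the tube condition are spent.\<close>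

lemma norm_increment_le:
  assumes "(D has_vector_derivative d) (at 0 within {0..s})" "norm d < a"
  obtains \<delta> where "0 < \<delta>" "\<And>h. 0 \<le> h \<Longrightarrow> h < \<delta> \<Longrightarrow> h \<le> s \<Longrightarrow> norm (D h - D 0) \<le> a * h"
proof -
  obtain \<delta> where "0 < \<delta>" and \<delta>: "\<And>h. h \<in> {0..s} \<Longrightarrow> norm (h - 0) < \<delta> \<Longrightarrow>
      norm (D h - D 0 - (h - 0) *\<^sub>R d) \<le> (a - norm d) * norm (h - 0)"
    using assms unfolding has_vector_derivative_def has_derivative_within_alt
    by (metis diff_gt_0_iff_gt)
  show ?thesis
  proof (rule that[OF \<open>0 < \<delta>\<close>])
    fix h assume h: "0 \<le> h" "h < \<delta>" "h \<le> s"
    have "norm (D h - D 0) \<le> norm (D h - D 0 - h *\<^sub>R d) + norm (h *\<^sub>R d)"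
      using norm_triangle_ineq[of "D h - D 0 - h *\<^sub>R d" "h *\<^sub>R d"] by simp
    also have "\<dots> \<le> (a - norm d) * h + h * norm d"
      using \<delta>[of h] h by (intro add_mono) auto
    finally show "norm (D h - D 0) \<le> a * h" by (simp add: algebra_simps)
  qed
qed

text \<open>A maximum principle replacing the characteristics: the tube around the approximate
  characteristic \<open>(Y, U)\<close> shrinks fast enough for the true backward characteristic direction
  \<open>(-1, -w, G)\<close> to point into it everywhere, so that \<open>f - \<epsilon> s\<close> attains its maximum over
  the tube at time 0.\<close>

lemma tube_principle:
  fixes f :: "real \<times> (real^3) \<times> (real^3) \<Rightarrow> real"
  assumes df: "\<And>s y w. 0 \<le> s \<Longrightarrow> (f has_derivative f' (s, y, w)) (at (s, y, w) within {0..} \<times> UNIV)"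
    and transport: "\<And>s y w. 0 \<le> s \<Longrightarrow> s \<le> t \<Longrightarrow> f' (s, y, w) (1, w, - G s y) = 0"
    and t: "0 < t"
    and Y: "\<And>s. s \<in> {0..t} \<Longrightarrow> (Y has_vector_derivative P s) (at s within {0..t})"
    and U: "\<And>s. s \<in> {0..t} \<Longrightarrow> (U has_vector_derivative - \<Gamma> s) (at s within {0..t})"
    and tube: "\<And>s y w. 0 < s \<Longrightarrow> s \<le> t \<Longrightarrow> norm (y - Y s) \<le> a * (t - s) \<Longrightarrow> norm (w - U s) \<le> b * (t - s) \<Longrightarrow>
       norm (w - P s) < a \<and> norm (G s y - \<Gamma> s) < b"
    and init: "\<And>y w. norm (y - Y 0) \<le> a * t \<Longrightarrow> norm (w - U 0) \<le> b * t \<Longrightarrow> f (0, y, w) \<le> M"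
  shows "f (t, Y t, U t) \<le> M"
proof (rule ccontr)
  assume "\<not> f (t, Y t, U t) \<le> M"
  then have gt: "f (t, Y t, U t) > M" by simp
  \<comment> \<open>Half of the excess over \<open>M\<close>, spread over the time \<open>t\<close>:
    at the tip of the tube \<open>f - \<epsilon> s\<close> still exceeds \<open>M\<close>.\<close>
  define \<epsilon> where "\<epsilon> = (f (t, Y t, U t) - M) / (2 * t)"
  have \<epsilon>: "0 < \<epsilon>" "\<epsilon> * t < f (t, Y t, U t) - M" using gt t by (auto simp: \<epsilon>_def)
  have "norm (U t - P t) < a \<and> norm (G t (Y t) - \<Gamma> t) < b" using tube[of t "Y t" "U t"] t by simp
  then have ab: "0 < a" "0 < b" using norm_ge_zero order_le_less_trans by blast+
  \<comment> \<open>The tube is the image of a compact product under a continuous map which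
    contracts the cross section at time \<open>t\<close> to the tip; this supplies the
    maximum.\<close>
  define \<Phi> where "\<Phi> = (\<lambda>(s, \<eta>, \<omega>). (s, Y s + (t - s) *\<^sub>R \<eta>, U s + (t - s) *\<^sub>R \<omega>))"
  define K where "K = {0..t} \<times> cball (0::real^3) a \<times> cball (0::real^3) b"
  have cY: "continuous_on {0..t} Y" and cU: "continuous_on {0..t} U"
    using Y U by (blast intro: has_vector_derivative_continuous continuous_on_eq_continuous_within[THEN iffD2])+
  have c\<Phi>: "continuous_on K \<Phi>"
    unfolding \<Phi>_def K_def split_def
    by (intro continuous_intros continuous_on_compose2[OF cY] continuous_on_compose2[OF cU]) auto
  have cf: "continuous_on ({0..} \<times> UNIV) f"
    unfolding continuous_on_eq_continuous_within
  proof
    fix z :: "real \<times> (real^3) \<times> (real^3)" assume "z \<in> {0..} \<times> UNIV"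
    then show "continuous (at z within {0..} \<times> UNIV) f"
      using df[of "fst z" "fst (snd z)" "snd (snd z)"] by (auto intro: has_derivative_continuous)
  qed
  define \<phi> where "\<phi> = (\<lambda>z. f z - \<epsilon> * fst z)"
  have "continuous_on K (\<lambda>k. \<phi> (\<Phi> k))"
    unfolding \<phi>_def
    by (intro continuous_intros continuous_on_compose2[OF cf c\<Phi>] continuous_on_fst c\<Phi>)
      (auto simp: \<Phi>_def K_def)
  moreover have "compact K" unfolding K_def by (intro compact_Times compact_cball) simp
  moreover have K0: "(t, 0, 0) \<in> K" using ab t by (simp add: K_def)
  ultimately obtain k where k: "k \<in> K" and max: "\<And>k'. k' \<in> K \<Longrightarrow> \<phi> (\<Phi> k') \<le> \<phi> (\<Phi> k)"
    using continuous_attains_sup[of K "\<lambda>k. \<phi> (\<Phi> k)"] by (metis empty_iff)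
  obtain s \<eta> \<omega> where seo: "k = (s, \<eta>, \<omega>)" using prod_cases3 by blast
  define y w where "y = Y s + (t - s) *\<^sub>R \<eta>" and "w = U s + (t - s) *\<^sub>R \<omega>"
  have \<Phi>k: "\<Phi> k = (s, y, w)" by (simp add: \<Phi>_def seo y_def w_def)
  have s: "0 \<le> s" "s \<le> t" and e: "norm \<eta> \<le> a" "norm \<omega> \<le> b" using k by (auto simp: K_def seo)
  have y: "norm (y - Y s) \<le> a * (t - s)" and w: "norm (w - U s) \<le> b * (t - s)"
    using s e by (auto simp: y_def w_def mult.commute mult_right_mono)
  have big: "\<phi> (s, y, w) > M"
    using max[OF K0] \<epsilon> by (simp add: \<Phi>k) (simp add: \<Phi>_def \<phi>_def)
  \<comment> \<open>At time 0 the initial bound keeps the function below \<open>M\<close>, whereas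
    the maximum is at least its value at the tip.\<close>
  have spos: "0 < s"
  proof (rule ccontr)
    assume "\<not> 0 < s"
    then have "s = 0" using s by simp
    then show False using init[of y w] y w big by (simp add: \<phi>_def)
  qed
  define g where "g = G s y"
  \<comment> \<open>Moving back in time from the maximum: \<open>f\<close> is stationary by the
    transport equation while \<open>- \<epsilon> s\<close> grows, so \<open>c\<close> increases at
    rate \<epsilon>.\<close>
  define c where "c h = \<phi> (s - h, y - h *\<^sub>R w, w + h *\<^sub>R g)" for h
  have "((\<lambda>h. f (s - h, y - h *\<^sub>R w, w + h *\<^sub>R g)) has_derivative (\<lambda>h. f' (s, y, w) (- h, - (h *\<^sub>R w), h *\<^sub>R g))) (at 0 within {0..s})"
    using df[of s y w] s
    by (intro has_derivative_compose_within[where T = "{0..} \<times> UNIV" and g = f and f = "\<lambda>h. (s - h, y - h *\<^sub>R w, w + h *\<^sub>R g)"])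
      (auto intro!: derivative_eq_intros)
  moreover have "f' (s, y, w) (- h, - (h *\<^sub>R w), h *\<^sub>R g) = 0" for h
  proof -
    have lin: "linear (f' (s, y, w))" by (rule has_derivative_linear[OF df[OF s(1)]])
    show ?thesis using linear_cmul[OF lin, of "-h" "(1, w, - g)"] transport[OF s, of y w] by (simp add: g_def)
  qed
  ultimately have "(c has_real_derivative \<epsilon>) (at 0 within {0..s})"
    unfolding c_def \<phi>_def has_field_derivative_def by (auto intro!: derivative_eq_intros)
  then obtain \<delta>1 where \<delta>1: "0 < \<delta>1" "\<And>h. 0 < h \<Longrightarrow> h \<le> s \<Longrightarrow> h < \<delta>1 \<Longrightarrow> c 0 < c h"
    using has_real_derivative_pos_inc_right[of c \<epsilon> 0 "{0..s}"] \<epsilon> by auto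
  have backwards: "((\<lambda>h. Z (s - h)) has_vector_derivative - d) (at 0 within {0..s})"
    if "(Z has_vector_derivative d) (at s within {0..t})" for Z :: "real \<Rightarrow> real^3" and d
  proof -
    have "((\<lambda>h. Z (s - h)) has_derivative (\<lambda>h. (- h) *\<^sub>R d)) (at 0 within {0..s})"
      using that s unfolding has_vector_derivative_def
      by (intro has_derivative_compose_within[where T = "{0..t}" and g = Z and f = "\<lambda>h. s - h"])
        (auto intro!: derivative_eq_intros)
    then show ?thesis by (simp add: has_vector_derivative_def)
  qed
  have "((\<lambda>h. y - h *\<^sub>R w - Y (s - h)) has_vector_derivative - w - (- P s)) (at 0 within {0..s})"
    by (intro has_vector_derivative_diff backwards Y) (use s in \<open>auto intro!: derivative_eq_intros\<close>)
  moreover have "norm (- w - (- P s)) < a" using tube[OF spos s(2) y w] by (simp add: norm_minus_commute)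
  ultimately obtain \<delta>2 where \<delta>2: "0 < \<delta>2"
    "\<And>h. 0 \<le> h \<Longrightarrow> h < \<delta>2 \<Longrightarrow> h \<le> s \<Longrightarrow> norm (y - h *\<^sub>R w - Y (s - h) - (y - Y s)) \<le> a * h"
    by (rule norm_increment_le) auto
  have "((\<lambda>h. w + h *\<^sub>R g - U (s - h)) has_vector_derivative g - (- (- \<Gamma> s))) (at 0 within {0..s})"
    by (intro has_vector_derivative_diff backwards U) (use s in \<open>auto intro!: derivative_eq_intros\<close>)
  moreover have "norm (g - (- (- \<Gamma> s))) < b" using tube[OF spos s(2) y w] by (simp add: g_def)
  ultimately obtain \<delta>3 where \<delta>3: "0 < \<delta>3"
    "\<And>h. 0 \<le> h \<Longrightarrow> h < \<delta>3 \<Longrightarrow> h \<le> s \<Longrightarrow> norm (w + h *\<^sub>R g - U (s - h) - (w - U s)) \<le> b * h"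
    by (rule norm_increment_le) auto
  define h where "h = min s (min \<delta>1 (min \<delta>2 \<delta>3)) / 2"
  have h: "0 < h" "h \<le> s" "h < \<delta>1" "h < \<delta>2" "h < \<delta>3" using spos \<delta>1 \<delta>2 \<delta>3 by (auto simp: h_def)
  have th: "0 < t - (s - h)" using h s by simp
  \<comment> \<open>Going back by \<open>h\<close> the radius of the tube grows by
    \<open>r * h\<close>, and the offset from its centre grows by no more, so the new point is still
    in the tube. There \<open>c\<close> exceeds the maximum.\<close>
  have in_tube: "norm ((1 / (t - (s - h))) *\<^sub>R (z - Z)) \<le> r"
    if "norm (z0 - Z0) \<le> r * (t - s)" "norm (z - Z - (z0 - Z0)) \<le> r * h" for z Z z0 Z0 :: "real^3" and r
  proof -
    have "norm (z - Z) \<le> r * (t - s) + r * h"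
      using that norm_triangle_ineq[of "z - Z - (z0 - Z0)" "z0 - Z0"] by simp
    also have "\<dots> = r * (t - (s - h))" by (simp add: algebra_simps)
    finally show ?thesis using th unfolding norm_scaleR by (simp add: pos_divide_le_eq)
  qed
  let ?k = "(s - h, (1 / (t - (s - h))) *\<^sub>R (y - h *\<^sub>R w - Y (s - h)), (1 / (t - (s - h))) *\<^sub>R (w + h *\<^sub>R g - U (s - h)))"
  have "?k \<in> K"
    using in_tube[OF y \<delta>2(2)[of h]] in_tube[OF w \<delta>3(2)[of h]] h s
    unfolding K_def mem_Times_iff mem_cball dist_0_norm fst_conv snd_conv by simp
  then have "\<phi> (\<Phi> ?k) \<le> \<phi> (\<Phi> k)" by (rule max)
  moreover have "\<Phi> ?k = (s - h, y - h *\<^sub>R w, w + h *\<^sub>R g)" using th by (simp add: \<Phi>_def)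
  ultimately have "c h \<le> c 0" by (simp add: c_def \<Phi>k)
  then show False using \<delta>1(2)[of h] h by simp
qed

section \<open>Fluxes through the velocity profile\<close>

lemma integrable_compact_support:
  fixes g :: "real^3 \<Rightarrow> 'b::euclidean_space"
  assumes c: "continuous_on UNIV g" and z: "\<And>u. M < norm u \<Longrightarrow> g u = 0"
  shows "integrable lborel g"
proof -
  have "integrable lborel (\<lambda>x. indicator (cball 0 M) x *\<^sub>R g x)"
    by (intro borel_integrable_compact compact_cball continuous_on_subset[OF c]) auto
  moreover have "(\<lambda>x. indicator (cball 0 M) x *\<^sub>R g x) = g"
    using z by (auto simp: indicator_def fun_eq_iff not_le)
  ultimately show "integrable lborel g" by simp
qed

lemma bounded_compact_support:
  fixes g :: "'a::euclidean_space \<Rightarrow> 'b::real_normed_vector"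
  assumes c: "continuous_on UNIV g" and z: "\<And>u. M < norm u \<Longrightarrow> g u = 0"
  shows "\<exists>C>0. \<forall>u. norm (g u) \<le> C"
proof -
  have "compact (g ` cball 0 M)"
    by (intro compact_continuous_image compact_cball continuous_on_subset[OF c]) auto
  then obtain C where C: "C > 0" "\<And>u. u \<in> cball 0 M \<Longrightarrow> norm (g u) \<le> C"
    using compact_imp_bounded[of "g ` cball 0 M"] by (auto simp: bounded_pos)
  then have "norm (g u) \<le> C" for u using z[of u] by (cases "norm u \<le> M") auto
  then show "\<exists>C>0. \<forall>u. norm (g u) \<le> C" using C(1) by blast
qed

lemma has_derivative_zero_outside:
  fixes \<phi> :: "'a::real_normed_vector \<Rightarrow> 'b::real_normed_vector"
  assumes d: "(\<phi> has_derivative \<phi>') (at u)" and z: "\<And>u. M < norm u \<Longrightarrow> \<phi> u = 0" and u: "M < norm u"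
  shows "\<phi>' = (\<lambda>_. 0)"
proof -
  have "eventually (\<lambda>x. x \<in> {x. norm x > M}) (nhds u)"
    by (rule eventually_nhds_in_open) (use u in \<open>auto intro!: open_Collect_less continuous_intros\<close>)
  then have "eventually (\<lambda>x. 0 = \<phi> x) (at u)"
    unfolding eventually_at_filter by (rule eventually_mono) (simp add: z)
  then have "(\<phi> has_derivative (\<lambda>_. 0)) (at u)"
    using has_derivative_transform_eventually[of "\<lambda>_. 0" "\<lambda>_. 0" u UNIV \<phi>] z[OF u] by simp
  then show ?thesis by (rule has_derivative_unique[OF d])
qed

text \<open>Translation invariance makes the integral of every difference quotient of \<phi> vanish.
  The mean value theorem bounds the quotients by the maximum of the directional derivative, so the
  limit may be taken under the integral.\<close>

lemma integral_directional_derivative_eq_0: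
  fixes \<phi> :: "real^3 \<Rightarrow> real"
  assumes d: "\<And>u. (\<phi> has_derivative \<phi>' u) (at u)" and c: "continuous_on UNIV (\<lambda>u. \<phi>' u e)"
    and z: "\<And>u. M < norm u \<Longrightarrow> \<phi> u = 0"
  shows "integrable lborel (\<lambda>u. \<phi>' u e)" "(\<integral>u. \<phi>' u e \<partial>lborel) = 0"
proof -
  have c\<phi>: "continuous_on UNIV \<phi>"
    using d by (intro continuous_at_imp_continuous_on) (auto intro: has_derivative_continuous)
  have i\<phi>: "integrable lborel \<phi>" by (rule integrable_compact_support[OF c\<phi> z])
  have [measurable]: "\<phi> \<in> borel_measurable borel" using c\<phi> by (rule borel_measurable_continuous_onI)
  have line: "((\<lambda>h. \<phi> (u + h *\<^sub>R e)) has_real_derivative \<phi>' (u + h *\<^sub>R e) e) (at h)" for u h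
  proof -
    have "((\<lambda>h. \<phi> (u + h *\<^sub>R e)) has_derivative (\<lambda>k. \<phi>' (u + h *\<^sub>R e) (k *\<^sub>R e))) (at h)"
      by (rule has_derivative_compose[of "\<lambda>h. u + h *\<^sub>R e" _ _ _ \<phi>, OF _ d]) (auto intro!: derivative_eq_intros)
    moreover have "(\<lambda>k. \<phi>' (u + h *\<^sub>R e) (k *\<^sub>R e)) = (\<lambda>k. \<phi>' (u + h *\<^sub>R e) e * k)"
      by (simp add: linear_cmul[OF has_derivative_linear[OF d]] fun_eq_iff)
    ultimately show ?thesis by (simp add: has_field_derivative_def)
  qed
  have z': "\<phi>' u e = 0" if "M < norm u" for u
  proof -
    have "\<phi>' u = (\<lambda>_. 0)" using d z that by (rule has_derivative_zero_outside)
    then show ?thesis by simp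
  qed
  show 1: "integrable lborel (\<lambda>u. \<phi>' u e)" by (rule integrable_compact_support[OF c z'])
  obtain C where C: "C > 0" "\<And>u. \<bar>\<phi>' u e\<bar> \<le> C" using bounded_compact_support[OF c z'] by auto
  define k where "k n = inverse (real (Suc n))" for n
  have k: "0 < k n" "k n \<le> 1" for n unfolding k_def by (auto simp: field_simps)
  define q where "q n u = (\<phi> (u + k n *\<^sub>R e) - \<phi> u) / k n" for n u
  have shift: "integrable lborel (\<lambda>u. \<phi> (u + h *\<^sub>R e))" "(\<integral>u. \<phi> (u + h *\<^sub>R e) \<partial>lborel) = (\<integral>u. \<phi> u \<partial>lborel)" for h
    using lborel_integral_affine[of \<phi> 1 "h *\<^sub>R e"] i\<phi> by (simp_all add: add.commute)
  have q0: "(\<integral>u. q n u \<partial>lborel) = 0" for n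
    unfolding q_def using shift[of "k n"] i\<phi> by simp
  have "(\<lambda>n. \<integral>u. q n u \<partial>lborel) \<longlonglongrightarrow> (\<integral>u. \<phi>' u e \<partial>lborel)"
  \<comment> \<open>The step sizes are at most 1, so all quotients vanish outside the support
    enlarged by \<open>norm e\<close>.\<close>
  proof (rule integral_dominated_convergence[where w = "\<lambda>u. C * indicator (cball 0 (M + norm e)) u"])
    show "(\<lambda>u. \<phi>' u e) \<in> borel_measurable lborel" "\<And>n. q n \<in> borel_measurable lborel"
      using c by (auto simp: q_def[abs_def] intro: borel_measurable_continuous_onI)
    show "integrable lborel (\<lambda>u. C * indicator (cball 0 (M + norm e)) u)"
      by (intro integrable_mult_right integrable_real_indicator) (auto intro: emeasure_bounded_finite[unfolded infinity_ennreal_def])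
    show "AE u in lborel. (\<lambda>n. q n u) \<longlonglongrightarrow> \<phi>' u e"
    proof (rule AE_I2)
      fix u
      have "((\<lambda>h. (\<phi> (u + h *\<^sub>R e) - \<phi> u) / h) \<longlongrightarrow> \<phi>' u e) (at 0)"
        using line[of u 0] by (simp add: DERIV_def)
      moreover have "filterlim k (at 0) sequentially"
        unfolding k_def[abs_def] filterlim_at using LIMSEQ_inverse_real_of_nat by auto
      ultimately show "(\<lambda>n. q n u) \<longlonglongrightarrow> \<phi>' u e"
        unfolding q_def by (rule filterlim_compose)
    qed
    show "AE u in lborel. norm (q n u) \<le> C * indicator (cball 0 (M + norm e)) u" for n
    proof (rule AE_I2)
      fix u
      obtain h where h: "0 < h" "h < k n" "\<phi> (u + k n *\<^sub>R e) - \<phi> u = k n * \<phi>' (u + h *\<^sub>R e) e"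
        using MVT2[of 0 "k n" "\<lambda>h. \<phi> (u + h *\<^sub>R e)" "\<lambda>h. \<phi>' (u + h *\<^sub>R e) e"] line k(1)[of n] by auto
      then have q: "q n u = \<phi>' (u + h *\<^sub>R e) e" using k(1)[of n] by (simp add: q_def)
      show "norm (q n u) \<le> C * indicator (cball 0 (M + norm e)) u"
      proof (cases "norm u \<le> M + norm e")
        case True
        then show ?thesis using C(2) q by simp
      next
        case False
        have "norm (h *\<^sub>R e) \<le> norm e" using h k[of n] by (simp add: mult_left_le_one_le)
        then have "norm (u + h *\<^sub>R e) > M"
          using False norm_triangle_ineq2[of u "- (h *\<^sub>R e)"] by simp
        then show ?thesis using q z' False by simp
      qed
    qed
  qed
  then show "(\<integral>u. \<phi>' u e \<partial>lborel) = 0" using q0 by (simp add: LIMSEQ_const_iff)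
qed

text \<open>Each \<open>\<psi> i\<close> below is the i-th partial derivative of the i-th component
  of \<open>F u *\<^sub>R a (z - \<tau> *\<^sub>R u)\<close>, so its integral is 0. In the sum over
  \<open>i\<close> the terms containing derivatives of \<open>a\<close> combine to its divergence
  and disappear.\<close>

lemma integral_gradient_divergence_free:
  fixes F :: "real^3 \<Rightarrow> real" and a :: "real^3 \<Rightarrow> real^3"
  assumes dF: "\<And>u. (F has_derivative (\<lambda>h. g u \<bullet> h)) (at u)" and cg: "continuous_on UNIV g"
    and zF: "\<And>u. M < norm u \<Longrightarrow> F u = 0"
    and da: "\<And>x. (a has_derivative a' x) (at x)" and ca: "\<And>h. continuous_on UNIV (\<lambda>x. a' x h)"
    and div: "\<And>x. (\<Sum>i\<in>UNIV. a' x (axis i 1) $ i) = 0"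
  shows "(\<integral>u. g u \<bullet> a (z - \<tau> *\<^sub>R u) \<partial>lborel) = 0"
proof -
  define \<psi> where "\<psi> i u = g u $ i * a (z - \<tau> *\<^sub>R u) $ i - \<tau> * F u * a' (z - \<tau> *\<^sub>R u) (axis i 1) $ i" for i u
  have cF: "continuous_on UNIV F"
    using dF by (intro continuous_at_imp_continuous_on) (auto intro: has_derivative_continuous)
  have caa: "continuous_on UNIV a"
    using da by (intro continuous_at_imp_continuous_on) (auto intro: has_derivative_continuous)
  have \<psi>: "integrable lborel (\<psi> i) \<and> (\<integral>u. \<psi> i u \<partial>lborel) = 0" for i
  proof -
    let ?\<phi> = "\<lambda>u. F u * a (z - \<tau> *\<^sub>R u) $ i"
    let ?\<phi>' = "\<lambda>u h. F u * a' (z - \<tau> *\<^sub>R u) (- \<tau> *\<^sub>R h) $ i + (g u \<bullet> h) * a (z - \<tau> *\<^sub>R u) $ i"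
    have d: "(?\<phi> has_derivative ?\<phi>' u) (at u)" for u
    proof -
      have "((\<lambda>u. a (z - \<tau> *\<^sub>R u)) has_derivative (\<lambda>h. a' (z - \<tau> *\<^sub>R u) (- \<tau> *\<^sub>R h))) (at u)"
        by (rule has_derivative_compose[of "\<lambda>u. z - \<tau> *\<^sub>R u" _ _ _ a, OF _ da]) (auto intro!: derivative_eq_intros)
      then have "((\<lambda>u. a (z - \<tau> *\<^sub>R u) $ i) has_derivative (\<lambda>h. a' (z - \<tau> *\<^sub>R u) (- \<tau> *\<^sub>R h) $ i)) (at u)"
        by (rule bounded_linear.has_derivative[OF bounded_linear_vec_nth])
      from has_derivative_mult[OF dF this] show ?thesis .
    qed
    have \<psi>': "?\<phi>' u (axis i 1) = \<psi> i u" for u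
      by (simp add: \<psi>_def inner_axis linear_cmul[OF has_derivative_linear[OF da]]
          linear_neg[OF has_derivative_linear[OF da]] scaleR_minus_left[symmetric] del: scaleR_minus_left)
    have c: "continuous_on UNIV (\<lambda>u. ?\<phi>' u (axis i 1))"
      unfolding \<psi>' \<psi>_def
      by (intro continuous_intros cF cg continuous_on_compose2[OF caa] continuous_on_compose2[OF ca]) auto
    have zz: "M < norm u \<Longrightarrow> ?\<phi> u = 0" for u using zF by simp
    show ?thesis
      using integral_directional_derivative_eq_0[of ?\<phi> ?\<phi>' "axis i 1" M, OF d c zz] unfolding \<psi>' by blast
  qed
  have "g u \<bullet> a (z - \<tau> *\<^sub>R u) = (\<Sum>i\<in>UNIV. \<psi> i u)" for u
  proof -
    have "(\<Sum>i\<in>UNIV. \<psi> i u) = g u \<bullet> a (z - \<tau> *\<^sub>R u) - \<tau> * F u * (\<Sum>i\<in>UNIV. a' (z - \<tau> *\<^sub>R u) (axis i 1) $ i)"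
      by (simp add: \<psi>_def inner_vec_def sum_subtractf sum_distrib_left)
    then show ?thesis by (simp add: div)
  qed
  then show ?thesis using \<psi> by (simp add: Bochner_Integration.integral_sum)
qed

section \<open>Recovering a function from its gradient by the Coulomb kernel\<close>

lemma set_integral_Icc_FTC:
  fixes f :: "real \<Rightarrow> 'b::euclidean_space"
  assumes "a \<le> b" and F: "\<And>x. a \<le> x \<Longrightarrow> x \<le> b \<Longrightarrow> (F has_vector_derivative f x) (at x within {a..b})"
    and c: "continuous_on {a..b} f"
  shows "(\<integral>x. indicator {a..b} x *\<^sub>R f x \<partial>lborel) = F b - F a"
proof -
  have "set_integrable lborel {a..b} f"
    unfolding set_integrable_def by (rule borel_integrable_compact[OF compact_Icc c])
  then have "(LINT x:{a..b}|lborel. f x) = integral {a..b} f"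
    by (rule set_borel_integral_eq_integral(2))
  also have "\<dots> = F b - F a"
    using assms by (intro integral_unique fundamental_theorem_of_calculus) auto
  finally show ?thesis by (simp add: set_lebesgue_integral_def)
qed

lemma has_bochner_integral_inverse_power4:
  assumes "0 < (c::real)"
  shows "has_bochner_integral lborel (\<lambda>s. indicator {c..} s * (1 / s ^ 4)) (1 / (3 * c ^ 3))"
proof (rule has_bochner_integral_nn_integral)
  have "(\<integral>\<^sup>+s. ennreal (1 / s ^ 4) * indicator {c..} s \<partial>lborel) = ennreal (0 - (- 1 / (3 * c ^ 3)))"
  proof (rule nn_integral_FTC_atLeast[where F = "\<lambda>s. - 1 / (3 * s ^ 3)"])
    show "((\<lambda>s. - 1 / (3 * s ^ 3)) has_real_derivative 1 / x ^ 4) (at x)" if "c \<le> x" for x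
      using that assms by (auto intro!: derivative_eq_intros simp: field_simps power2_eq_square power3_eq_cube power4_eq_xxxx)
    show "((\<lambda>s::real. - 1 / (3 * s ^ 3)) \<longlongrightarrow> 0) at_top"
      by (intro tendsto_divide_0[OF tendsto_const] filterlim_at_top_imp_at_infinity
          filterlim_tendsto_pos_mult_at_top[OF tendsto_const] filterlim_pow_at_top filterlim_ident) auto
  qed (use assms in auto)
  then show "(\<integral>\<^sup>+s. ennreal (indicator {c..} s * (1 / s ^ 4)) \<partial>lborel) = ennreal (1 / (3 * c ^ 3))"
    by (subst nn_integral_cong[of _ _ "\<lambda>s. ennreal (1 / s ^ 4) * indicator {c..} s"]) (auto simp: indicator_def)
qed (use assms in \<open>auto simp: indicator_def\<close>)

text \<open>Write \<open>1 / norm w ^ 3\<close> as the integral of \<open>3 / s ^ 4\<close> over \<open>s \<ge> norm w\<close>, exchange the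
  integrals and rescale \<open>w\<close> to the unit ball: what remains is the integral of a derivative
  along each ray.\<close>

lemma newton_representation:
  fixes \<phi> :: "real^3 \<Rightarrow> real"
  assumes d: "\<And>u. (\<phi> has_derivative (\<lambda>h. g u \<bullet> h)) (at u)" and c: "continuous_on UNIV g"
    and z: "\<And>u. M < norm u \<Longrightarrow> \<phi> u = 0"
  shows "integrable lborel (\<lambda>w. g (z - w) \<bullet> coulomb w)"
    and "(\<integral>w. g (z - w) \<bullet> coulomb w \<partial>lborel) = 3 * unit_ball_vol 3 * \<phi> z"
proof -
  have [measurable]: "g \<in> borel_measurable borel" using c by (rule borel_measurable_continuous_onI)
  have zg: "g u = 0" if "M < norm u" for u
    using fun_cong[OF has_derivative_zero_outside[OF d z that], of "g u"] by simp
  obtain C where C: "C > 0" "\<And>u. norm (g u) \<le> C" using bounded_compact_support[OF c zg] by auto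
  define N where "N = max M 0 + norm z + 1"
  have N: "0 < N" by (simp add: N_def add_nonneg_pos)
  have gN: "g (z - w) = 0" "\<phi> (z - w) = 0" if "N \<le> norm w" for w
  proof -
    have "M < norm (z - w)" using that norm_triangle_ineq2[of w z] by (simp add: N_def norm_minus_commute)
    then show "g (z - w) = 0" "\<phi> (z - w) = 0" using zg z by auto
  qed
  obtain K where K: "\<And>r. 0 < r \<Longrightarrow> integrable lborel (\<lambda>z::real^3. indicator (cball 0 r) z * norm z powr (-2))"
    by (rule powr_norm_integrable_on_balls[of 2]) auto
  show int: "integrable lborel (\<lambda>w. g (z - w) \<bullet> coulomb w)"
  proof (rule Bochner_Integration.integrable_bound)
    show "integrable lborel (\<lambda>w. C * (indicator (cball 0 N) w * norm (w::real^3) powr (-2)))"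
      by (intro integrable_mult_right K N)
    show "AE w in lborel. norm (g (z - w) \<bullet> coulomb w) \<le> norm (C * (indicator (cball 0 N) w * norm w powr (-2)))"
    proof (rule AE_I2)
      fix w
      have "\<bar>g (z - w) \<bullet> coulomb w\<bar> \<le> C * norm w powr (-2)"
        using Cauchy_Schwarz_ineq2[of "g (z - w)" "coulomb w"] mult_right_mono[OF C(2)[of "z - w"], of "norm w powr (-2)"]
        by (simp add: norm_coulomb)
      then show "norm (g (z - w) \<bullet> coulomb w) \<le> norm (C * (indicator (cball 0 N) w * norm w powr (-2)))"
        using C(1) gN[of w] by (cases "norm w \<le> N") (auto simp: abs_mult)
    qed
  qed measurable
  \<comment> \<open>\<open>H1\<close> is the integrand after the layering in \<open>s\<close>, and
    \<open>H\<close> is what the substitution of \<open>s *\<^sub>R w\<close> for \<open>w\<close>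
    makes of it: the Jacobian \<open>s ^ 3\<close>, the weight \<open>1 / s ^ 4\<close> and the
    factor \<open>s\<close> of the vector cancel, so that no singular weight remains.\<close>
  define H where "H w s = indicator (cball 0 1) w * (indicator {0..} s * (g (z - s *\<^sub>R w) \<bullet> w))" for w s
  define H1 where "H1 w s = indicator {norm w..} s * (1 / s ^ 4) * (g (z - w) \<bullet> w)" for w and s :: real
  have H1_alt: "case_prod H1 = (\<lambda>(w, s). if norm w \<le> s then (1 / s ^ 4) * (g (z - w) \<bullet> w) else 0)"
    by (auto simp: H1_def fun_eq_iff indicator_def)
  have H_alt: "case_prod H = (\<lambda>(w, s). if norm w \<le> 1 \<and> 0 \<le> s then g (z - s *\<^sub>R w) \<bullet> w else 0)"
    by (auto simp: H_def fun_eq_iff indicator_def)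
  have mH [measurable]: "case_prod H \<in> borel_measurable (lborel \<Otimes>\<^sub>M lborel)"
    unfolding H_alt by measurable
  have mH1 [measurable]: "case_prod H1 \<in> borel_measurable (lborel \<Otimes>\<^sub>M lborel)"
    unfolding H1_alt by measurable
  have inner1: "has_bochner_integral lborel (\<lambda>s. indicator {norm w..} s * (1 / s ^ 4) * k) (1 / (3 * norm w ^ 3) * k)"
    if "w = 0 \<Longrightarrow> k = 0" for w :: "real^3" and k :: real
  proof (cases "w = 0")
    case False
    then show ?thesis
      using has_bochner_integral_mult_left[OF has_bochner_integral_inverse_power4[of "norm w"]] by simp
  qed (use that in \<open>simp add: has_bochner_integral_zero\<close>)
  have H1i: "integrable lborel (\<lambda>s. H1 w s)" "(\<integral>s. H1 w s \<partial>lborel) = (g (z - w) \<bullet> coulomb w) / 3" for w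
    using inner1[of w "g (z - w) \<bullet> w"]
    by (auto simp: H1_def coulomb_def has_bochner_integral_iff)
  have H1n: "(\<integral>s. norm (H1 w s) \<partial>lborel) = norm (g (z - w) \<bullet> coulomb w) / 3" for w
  proof -
    have "norm (H1 w s) = indicator {norm w..} s * (1 / s ^ 4) * \<bar>g (z - w) \<bullet> w\<bar>" for s
      by (simp add: H1_def abs_mult)
    then show ?thesis using inner1[of w "\<bar>g (z - w) \<bullet> w\<bar>"]
      by (simp add: coulomb_def has_bochner_integral_iff abs_mult)
  qed
  have pH1: "integrable (lborel \<Otimes>\<^sub>M lborel) (case_prod H1)"
  proof (rule lborel_pair.Fubini_integrable[OF mH1])
    show "integrable lborel (\<lambda>w. \<integral>s. norm (case_prod H1 (w, s)) \<partial>lborel)"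
      using int unfolding prod.case H1n by (intro integrable_divide integrable_norm)
  qed (simp add: H1i)
  have cut: "indicator {0..} s * (g (z - s *\<^sub>R w) \<bullet> w) = indicator {0..N / norm w} s *\<^sub>R (g (z - s *\<^sub>R w) \<bullet> w)"
    if "w \<noteq> 0" for s w
  proof (cases "N / norm w < s")
    case True
    then have "N \<le> norm (s *\<^sub>R w)" using that N
      by (simp add: divide_less_eq) (smt (verit) divide_pos_pos mult_right_mono norm_ge_zero)
    then show ?thesis using gN by simp
  qed (auto simp: indicator_def)
  have cont: "continuous_on S (\<lambda>s. g (z - s *\<^sub>R w) \<bullet> w)" for S w
    by (intro continuous_intros continuous_on_compose2[OF c]) auto
  have Hi: "integrable lborel (H w)" for w
  proof (cases "w = 0")
    case False
    have "integrable lborel (\<lambda>s. indicator {0..N / norm w} s *\<^sub>R (g (z - s *\<^sub>R w) \<bullet> w))"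
      by (intro borel_integrable_compact compact_Icc cont)
    then show ?thesis unfolding H_def[abs_def] cut[OF False] by (rule integrable_mult_right)
  qed (simp add: H_def[abs_def])
  have Hv: "(\<integral>s. H w s \<partial>lborel) = indicator (cball 0 1) w * \<phi> z" if "w \<noteq> 0" for w
  proof -
    \<comment> \<open>Along the ray the integrand is the derivative of
      \<open>- \<phi> (z - s *\<^sub>R w)\<close>; only the end \<open>s = 0\<close> contributes, as
      the other end lies outside the support.\<close>
    have "(\<integral>s. indicator {0..N / norm w} s *\<^sub>R (g (z - s *\<^sub>R w) \<bullet> w) \<partial>lborel)
        = (- \<phi> (z - (N / norm w) *\<^sub>R w)) - (- \<phi> (z - 0 *\<^sub>R w))"
    proof (rule set_integral_Icc_FTC[OF _ _ cont])
      fix s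
      have "((\<lambda>s. \<phi> (z - s *\<^sub>R w)) has_derivative (\<lambda>k. g (z - s *\<^sub>R w) \<bullet> (- (k *\<^sub>R w)))) (at s within {0..N / norm w})"
        by (rule has_derivative_compose[of "\<lambda>s. z - s *\<^sub>R w" _ _ _ \<phi>, OF _ d]) (auto intro!: derivative_eq_intros)
      from has_derivative_minus[OF this]
      show "((\<lambda>s. - \<phi> (z - s *\<^sub>R w)) has_vector_derivative g (z - s *\<^sub>R w) \<bullet> w) (at s within {0..N / norm w})"
        by (simp add: has_vector_derivative_def)
    qed (use N in simp)
    also have "\<phi> (z - (N / norm w) *\<^sub>R w) = 0" using N that by (intro gN) simp
    finally show ?thesis unfolding H_def cut[OF that] by simp
  qed
  \<comment> \<open>The ray meets the support for a parameter length of at most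
    \<open>N / norm w\<close>, and the integrand is at most \<open>C * norm w\<close>; the product
    stays bounded as \<open>w\<close> tends to 0, which makes the exchange of integrals
    legitimate.\<close>
  have Hn: "(\<integral>s. norm (H w s) \<partial>lborel) \<le> C * N * indicator (cball 0 1) w" for w
  proof (cases "w = 0")
    case False
    have "(\<integral>s. norm (H w s) \<partial>lborel) \<le> (\<integral>s. indicator (cball 0 1) w * (indicator {0..N / norm w} s *\<^sub>R (C * norm w)) \<partial>lborel)"
    proof (rule integral_mono)
      show "integrable lborel (\<lambda>s. indicator (cball 0 1) w * (indicator {0..N / norm w} s *\<^sub>R (C * norm w)))"
        by (intro integrable_mult_right borel_integrable_compact compact_Icc continuous_on_const)
      show "norm (H w s) \<le> indicator (cball 0 1) w * (indicator {0..N / norm w} s *\<^sub>R (C * norm w))" for s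
        unfolding H_def cut[OF False] norm_mult norm_scaleR
        using Cauchy_Schwarz_ineq2[of "g (z - s *\<^sub>R w)" w] mult_right_mono[OF C(2)[of "z - s *\<^sub>R w"], of "norm w"]
        by (auto simp: indicator_def)
    qed (intro integrable_norm Hi)
    also have "\<dots> = C * N * indicator (cball 0 1) w" using False N by simp
    finally show ?thesis .
  qed (use C N in \<open>simp add: H_def\<close>)
  have pH: "integrable (lborel \<Otimes>\<^sub>M lborel) (case_prod H)"
  proof (rule lborel_pair.Fubini_integrable[OF mH])
    show "integrable lborel (\<lambda>w. \<integral>s. norm (case_prod H (w, s)) \<partial>lborel)"
    proof (rule Bochner_Integration.integrable_bound)
      show "integrable lborel (\<lambda>w. C * N * indicator (cball (0::real^3) 1) w)"
        by (intro integrable_mult_right integrable_real_indicator) (auto intro: emeasure_bounded_finite[unfolded infinity_ennreal_def])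
      show "AE w in lborel. norm (\<integral>s. norm (case_prod H (w, s)) \<partial>lborel) \<le> norm (C * N * indicator (cball 0 1) w)"
        using Hn C N by (auto simp: abs_mult intro!: AE_I2 order_trans[OF _ abs_ge_self])
    qed measurable
  qed (simp add: Hi)
  have swap: "(\<integral>w. H w s \<partial>lborel) = (\<integral>w. H1 w s \<partial>lborel)" if "s \<noteq> 0" for s
  proof (cases "0 < s")
    case True
    have "(\<integral>w. H1 w s \<partial>lborel) = \<bar>s\<bar> ^ 3 *\<^sub>R (\<integral>w. H1 (0 + s *\<^sub>R w) s \<partial>lborel)"
    proof (rule lborel_integral_affine(2)[OF _ that])
      have "H1 w s = (if norm w \<le> s then (1 / s ^ 4) * (g (z - w) \<bullet> w) else 0)" for w
        by (simp add: H1_def)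
      then show "(\<lambda>w. H1 w s) \<in> borel_measurable borel" by simp
    qed
    also have "\<dots> = (\<integral>w. \<bar>s\<bar> ^ 3 * H1 (s *\<^sub>R w) s \<partial>lborel)" by simp
    also have "\<dots> = (\<integral>w. H w s \<partial>lborel)"
    proof (rule Bochner_Integration.integral_cong[OF refl])
      fix w
      show "\<bar>s\<bar> ^ 3 * H1 (s *\<^sub>R w) s = H w s"
        using True by (auto simp: H_def H1_def indicator_def power3_eq_cube power4_eq_xxxx)
    qed
    finally show ?thesis by simp
  next
    case False
    then have "s < 0" using that by simp
    then have "\<not> norm w \<le> s" for w :: "real^3" using norm_ge_zero[of w] by linarith
    with \<open>s < 0\<close> have "H w s = 0" "H1 w s = 0" for w by (auto simp: H_def H1_def)
    then show ?thesis by simp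
  qed
  have "(\<integral>w. g (z - w) \<bullet> coulomb w \<partial>lborel) = 3 * (\<integral>w. \<integral>s. H1 w s \<partial>lborel \<partial>lborel)"
    by (simp add: H1i)
  also have "(\<integral>w. \<integral>s. H1 w s \<partial>lborel \<partial>lborel) = (\<integral>s. \<integral>w. H1 w s \<partial>lborel \<partial>lborel)"
    by (rule lborel_pair.Fubini_integral[OF pH1, symmetric])
  also have "\<dots> = (\<integral>s. \<integral>w. H w s \<partial>lborel \<partial>lborel)"
  proof (rule integral_cong_AE)
    have "AE s in lborel. s \<noteq> (0::real)" by (rule AE_lborel_singleton)
    then show "AE s in lborel. (\<integral>w. H1 w s \<partial>lborel) = (\<integral>w. H w s \<partial>lborel)"
      by eventually_elim (simp add: swap)
  qed measurable
  also have "\<dots> = (\<integral>w. \<integral>s. H w s \<partial>lborel \<partial>lborel)"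
    by (rule lborel_pair.Fubini_integral[OF pH])
  also have "\<dots> = (\<integral>w. indicator (cball (0::real^3) 1) w * \<phi> z \<partial>lborel)"
  proof (rule integral_cong_AE)
    have "AE w in lborel. w \<noteq> (0::real^3)" by (rule AE_lborel_singleton)
    then show "AE w in lborel. (\<integral>s. H w s \<partial>lborel) = indicator (cball (0::real^3) 1) w * \<phi> z"
      by eventually_elim (rule Hv)
    show "(\<lambda>w. indicator (cball (0::real^3) 1) w * \<phi> z) \<in> borel_measurable lborel"
      by (intro borel_measurable_times borel_measurable_indicator borel_measurable_const) simp
  qed measurable
  \<comment> \<open>Together with the 3 from the layering this is the familiar constant 4
    \<pi>.\<close>
  also have "\<dots> = unit_ball_vol 3 * \<phi> z"
    by (simp add: content_cball)
  finally show "(\<integral>w. g (z - w) \<bullet> coulomb w \<partial>lborel) = 3 * unit_ball_vol 3 * \<phi> z" by simp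
qed

text \<open>The weak form of \<open>div E = 4 \<pi> \<rho>\<close>, tested with \<open>F\<close>; it is local in the density.\<close>

lemma integral_gradient_coulomb_field_le:
  fixes F :: "real^3 \<Rightarrow> real"
  assumes d: "\<And>u. (F has_derivative (\<lambda>h. g u \<bullet> h)) (at u)" and c: "continuous_on UNIV g"
    and z: "\<And>u. M < norm u \<Longrightarrow> F u = 0" and F0: "\<And>u. 0 \<le> F u"
    and p: "3 < p" and r [measurable]: "r \<in> borel_measurable borel"
    and rb: "\<And>y. \<bar>r y\<bar> \<le> B * R y powr (-p)"
    and \<tau>: "0 < \<tau>" and m: "\<And>y. norm (\<xi> - y) \<le> \<tau> * M \<Longrightarrow> \<bar>r y\<bar> \<le> m"
  shows "\<bar>\<integral>u. g u \<bullet> (\<integral>y. r y *\<^sub>R coulomb (\<xi> - \<tau> *\<^sub>R u - y) \<partial>lborel) \<partial>lborel\<bar>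
    \<le> 3 * unit_ball_vol 3 * \<tau> * m * (\<integral>u. F u \<partial>lborel)"
proof -
  have [measurable]: "g \<in> borel_measurable borel" using c by (rule borel_measurable_continuous_onI)
  have cF: "continuous_on UNIV F"
    using d by (intro continuous_at_imp_continuous_on) (auto intro: has_derivative_continuous)
  then have [measurable]: "F \<in> borel_measurable borel" by (rule borel_measurable_continuous_onI)
  have iF: "integrable lborel F" by (rule integrable_compact_support[OF cF z])
  have zg: "g u = 0" if "M < norm u" for u
    using fun_cong[OF has_derivative_zero_outside[OF d z that], of "g u"] by simp
  have ig: "integrable lborel g" by (rule integrable_compact_support[OF c zg])
  obtain C where C: "0 < C" "\<And>r B x. r \<in> borel_measurable borel \<Longrightarrow> (\<And>y. \<bar>r y\<bar> \<le> B * R y powr (-p)) \<Longrightarrow>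
        integrable lborel (\<lambda>y. r y *\<^sub>R coulomb (x - y)) \<and>
        (\<integral>y. norm (r y *\<^sub>R coulomb (x - y)) \<partial>lborel) \<le> B * C * R x powr (-2)"
    by (rule coulomb_field_bound[OF p]) blast
  have Ei: "integrable lborel (\<lambda>y. r y *\<^sub>R coulomb (x - y))"
    and En: "(\<integral>y. norm (r y *\<^sub>R coulomb (x - y)) \<partial>lborel) \<le> B * C" for x
  proof -
    note CC = C(2)[OF r rb, of x]
    show "integrable lborel (\<lambda>y. r y *\<^sub>R coulomb (x - y))" using CC by blast
    have "0 \<le> \<bar>r x\<bar>" by simp
    also have "\<dots> \<le> B * R x powr (-p)" by (rule rb)
    finally have "0 \<le> B" by (simp add: zero_le_mult_iff)
    then have "B * C * R x powr (-2) \<le> B * C"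
      using C(1) R_powr_minus_le_1[of 2 x] by (simp add: mult_left_le)
    then show "(\<integral>y. norm (r y *\<^sub>R coulomb (x - y)) \<partial>lborel) \<le> B * C" using CC by linarith
  qed
  define h where "h u y = r y * (g u \<bullet> coulomb (\<xi> - \<tau> *\<^sub>R u - y))" for u y
  have mh [measurable]: "case_prod h \<in> borel_measurable (lborel \<Otimes>\<^sub>M lborel)"
    unfolding h_def split_def by measurable
  have h_alt: "h u y = g u \<bullet> (r y *\<^sub>R coulomb (\<xi> - \<tau> *\<^sub>R u - y))" for u y by (simp add: h_def)
  have hi: "integrable lborel (h u)" for u
    unfolding h_alt[abs_def] by (intro integrable_inner_right Ei)
  have hn: "(\<integral>y. norm (h u y) \<partial>lborel) \<le> norm (g u) * (B * C)" for u
  proof -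
    have "(\<integral>y. norm (h u y) \<partial>lborel) \<le> (\<integral>y. norm (g u) * norm (r y *\<^sub>R coulomb (\<xi> - \<tau> *\<^sub>R u - y)) \<partial>lborel)"
      unfolding h_alt
      by (intro integral_mono integrable_norm integrable_mult_right integrable_inner_right Ei) (simp only: real_norm_def Cauchy_Schwarz_ineq2)
    also have "\<dots> \<le> norm (g u) * (B * C)"
      using En by (simp add: mult_left_mono del: norm_scaleR)
    finally show ?thesis .
  qed
  have ih: "integrable (lborel \<Otimes>\<^sub>M lborel) (case_prod h)"
  proof (rule lborel_pair.Fubini_integrable[OF mh])
    show "integrable lborel (\<lambda>u. \<integral>y. norm (case_prod h (u, y)) \<partial>lborel)"
    proof (rule Bochner_Integration.integrable_bound)
      show "integrable lborel (\<lambda>u. norm (g u) * (B * C))" using ig by (intro integrable_mult_left integrable_norm)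
      show "AE u in lborel. norm (\<integral>y. norm (case_prod h (u, y)) \<partial>lborel) \<le> norm (norm (g u) * (B * C))"
        using hn by (auto intro!: AE_I2 order_trans[OF _ abs_ge_self] simp del: abs_mult)
    qed measurable
  qed (simp add: hi)
  \<comment> \<open>With \<open>u = Z - w\<close> and
    \<open>Z = (1 / \<tau>) *\<^sub>R (\<xi> - y)\<close> the argument of the kernel becomes
    \<open>\<tau> *\<^sub>R w\<close>; homogeneity of degree -2 leaves the value of \<open>F\<close>
    at \<open>Z\<close>.\<close>
  have inner: "(\<integral>u. h u y \<partial>lborel) = r y * (1 / \<tau> ^ 2 * (3 * unit_ball_vol 3 * F ((1 / \<tau>) *\<^sub>R (\<xi> - y))))" for y
  proof -
    define \<psi> where "\<psi> u = g u \<bullet> coulomb (\<xi> - \<tau> *\<^sub>R u - y)" for u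
    have [measurable]: "\<psi> \<in> borel_measurable borel" unfolding \<psi>_def by measurable
    define Z where "Z = (1 / \<tau>) *\<^sub>R (\<xi> - y)"
    have e: "\<xi> - \<tau> *\<^sub>R (Z - w) - y = \<tau> *\<^sub>R w" for w
      using \<tau> by (simp add: Z_def scaleR_diff_right algebra_simps)
    have "(\<integral>u. \<psi> u \<partial>lborel) = (\<integral>w. \<psi> (Z - w) \<partial>lborel)"
      by (rule lborel_integral_reflect(2)[symmetric]) measurable
    also have "\<dots> = (\<integral>w. 1 / \<tau> ^ 2 * (g (Z - w) \<bullet> coulomb w) \<partial>lborel)"
      unfolding \<psi>_def e coulomb_scale[OF \<tau>] by simp
    also have "\<dots> = 1 / \<tau> ^ 2 * (3 * unit_ball_vol 3 * F Z)"
    proof -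
      have "(\<integral>w. g (Z - w) \<bullet> coulomb w \<partial>lborel) = 3 * unit_ball_vol 3 * F Z"
        by (rule newton_representation(2)[OF d c]) (rule z)
      then show ?thesis by simp
    qed
    finally show ?thesis unfolding h_def \<psi>_def Z_def by simp
  qed
  have scaled: "integrable lborel (\<lambda>y. F ((1 / \<tau>) *\<^sub>R (\<xi> - y)))"
    "(\<integral>y. F ((1 / \<tau>) *\<^sub>R (\<xi> - y)) \<partial>lborel) = \<tau> ^ 3 * (\<integral>u. F u \<partial>lborel)"
  proof -
    have e: "(1 / \<tau>) *\<^sub>R \<xi> + (- 1 / \<tau>) *\<^sub>R y = (1 / \<tau>) *\<^sub>R (\<xi> - y)" for y by (simp add: scaleR_diff_right)
    show "integrable lborel (\<lambda>y. F ((1 / \<tau>) *\<^sub>R (\<xi> - y)))"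
      using lborel_integral_affine(1)[of F "- 1 / \<tau>" "(1 / \<tau>) *\<^sub>R \<xi>"] iF \<tau> unfolding e by simp
    show "(\<integral>y. F ((1 / \<tau>) *\<^sub>R (\<xi> - y)) \<partial>lborel) = \<tau> ^ 3 * (\<integral>u. F u \<partial>lborel)"
      using lborel_integral_affine(2)[of F "- 1 / \<tau>" "(1 / \<tau>) *\<^sub>R \<xi>"] \<tau> unfolding e by (simp add: power_divide)
  qed
  have "(\<integral>u. g u \<bullet> (\<integral>y. r y *\<^sub>R coulomb (\<xi> - \<tau> *\<^sub>R u - y) \<partial>lborel) \<partial>lborel) = (\<integral>u. \<integral>y. h u y \<partial>lborel \<partial>lborel)"
    unfolding h_alt by (intro Bochner_Integration.integral_cong refl integral_inner_right[symmetric] Ei)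
  also have "\<dots> = (\<integral>y. \<integral>u. h u y \<partial>lborel \<partial>lborel)"
    by (rule lborel_pair.Fubini_integral[OF ih, symmetric])
  also have "\<bar>\<dots>\<bar> \<le> (\<integral>y. m * (1 / \<tau> ^ 2 * (3 * unit_ball_vol 3 * F ((1 / \<tau>) *\<^sub>R (\<xi> - y)))) \<partial>lborel)"
  proof (rule integral_abs_bound_integral)
    show "integrable lborel (\<lambda>y. \<integral>u. h u y \<partial>lborel)" using lborel_pair.integrable_snd[OF ih] by simp
    show "integrable lborel (\<lambda>y. m * (1 / \<tau> ^ 2 * (3 * unit_ball_vol 3 * F ((1 / \<tau>) *\<^sub>R (\<xi> - y)))))"
      by (intro integrable_mult_right scaled)
    fix y
    show "\<bar>\<integral>u. h u y \<partial>lborel\<bar> \<le> m * (1 / \<tau> ^ 2 * (3 * unit_ball_vol 3 * F ((1 / \<tau>) *\<^sub>R (\<xi> - y))))"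
    \<comment> \<open>Locality: where \<open>F\<close> vanishes both sides are 0, so the bound
      \<open>m\<close> is invoked only for \<open>y\<close> within \<open>\<tau> * M\<close> of
      \<xi>.\<close>
    proof (cases "F ((1 / \<tau>) *\<^sub>R (\<xi> - y)) = 0")
      case False
      then have "norm ((1 / \<tau>) *\<^sub>R (\<xi> - y)) \<le> M" using z by force
      then have "norm (\<xi> - y) / \<tau> \<le> M" unfolding norm_scaleR using \<tau> by simp
      then have "\<bar>r y\<bar> \<le> m" using \<tau> by (intro m) (simp add: field_simps)
      then show ?thesis unfolding inner abs_mult
        using F0 by (intro mult_mono) (auto simp: abs_mult)
    qed (simp add: inner)
  qed
  \<comment> \<open>The kernel scales with \<open>1 / \<tau> ^ 2\<close> and the volume with
    \<open>\<tau> ^ 3\<close>, so a single factor \<tau> survives.\<close>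
  also have "\<dots> = m * (1 / \<tau> ^ 2 * (3 * unit_ball_vol 3 * (\<tau> ^ 3 * (\<integral>u. F u \<partial>lborel))))"
    using scaled by simp
  also have "\<dots> = 3 * unit_ball_vol 3 * \<tau> * m * (\<integral>u. F u \<partial>lborel)"
    using \<tau> by (simp add: power2_eq_square power3_eq_cube)
  finally show ?thesis .
qed

section \<open>Decay of the density\<close>

lemma integral_norm_le_const:
  fixes h :: "real \<Rightarrow> real^3"
  assumes "continuous_on {s..t} h" "\<And>\<tau>. \<tau> \<in> {s..t} \<Longrightarrow> norm (h \<tau>) \<le> B" "0 \<le> B" "t - s \<le> T" "s \<le> t"
  shows "norm (integral {s..t} h) \<le> B * T"
proof -
  have "norm (integral {s..t} h) \<le> B * (t - s)"
    using assms integral_bound[of s t h B] by simp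
  also have "\<dots> \<le> B * T" using assms by (intro mult_left_mono) auto
  finally show ?thesis .
qed

text \<open>Here \<open>G\<close> is the total field and \<open>r\<close> the density; \<open>flux\<close> expresses \<open>div G = 4 \<pi> r\<close> tested
  with \<open>F\<close>.\<close>

locale vlasov_bounds =
  fixes T W Q CF CG :: real
    and F :: "real^3 \<Rightarrow> real" and g :: "real^3 \<Rightarrow> real^3"
    and f :: "real \<times> (real^3) \<times> (real^3) \<Rightarrow> real"
    and f' :: "real \<times> (real^3) \<times> (real^3) \<Rightarrow> real \<times> (real^3) \<times> (real^3) \<Rightarrow> real"
    and G :: "real \<Rightarrow> real^3 \<Rightarrow> real^3" and r :: "real \<Rightarrow> real^3 \<Rightarrow> real"
  assumes T: "0 < T"
    and F_deriv: "\<And>u. (F has_derivative (\<lambda>h. g u \<bullet> h)) (at u)"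
    and continuous_g: "continuous_on UNIV g"
    and F_support: "\<And>u. W < norm u \<Longrightarrow> F u = 0"
    and F_taylor: "\<And>v d. \<bar>F (v + d) - F v - g v \<bullet> d\<bar> \<le> CF * norm d ^ 2"
    and F_lipschitz: "\<And>v w. \<bar>F v - F w\<bar> \<le> CF * norm (v - w)"
    and f_deriv: "\<And>s y w. 0 \<le> s \<Longrightarrow> (f has_derivative f' (s, y, w)) (at (s, y, w) within {0..} \<times> UNIV)"
    and transport: "\<And>s y w. 0 \<le> s \<Longrightarrow> s \<le> T \<Longrightarrow> f' (s, y, w) (1, w, - G s y) = 0"
    and f_initial: "\<exists>C N. \<forall>y w. N < norm y \<longrightarrow> \<bar>f (0, y, w) - F w\<bar> \<le> C * R y powr (-6)"
    and f_support: "\<And>s y w. 0 \<le> s \<Longrightarrow> s \<le> T \<Longrightarrow> Q < norm w \<Longrightarrow> f (s, y, w) = 0"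
    and continuous_G: "continuous_on ({0..T} \<times> UNIV) (\<lambda>(s, y). G s y)"
    and G_bound: "\<And>s y. 0 \<le> s \<Longrightarrow> s \<le> T \<Longrightarrow> norm (G s y) \<le> CG"
    and G_diff: "\<And>L. 0 \<le> L \<Longrightarrow> \<exists>C N. \<forall>s\<in>{0..T}. \<forall>x y. N \<le> R x \<longrightarrow> norm (y - x) \<le> L \<longrightarrow>
        norm (G s y - G s x) \<le> C * R x powr (-3)"
    and G_diff_near: "\<And>L D. 0 \<le> L \<Longrightarrow> 0 \<le> D \<Longrightarrow> \<exists>C N. \<forall>s\<in>{0..T}. \<forall>x y y'. N \<le> R x \<longrightarrow> norm (y - x) \<le> L \<longrightarrow>
        norm (y' - x) \<le> L \<longrightarrow> norm (y - y') \<le> D * R x powr (-3) \<longrightarrow> norm (G s y - G s y') \<le> C * R x powr (-6)"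
    and flux: "\<And>s \<sigma> \<xi> m. 0 \<le> s \<Longrightarrow> s \<le> T \<Longrightarrow> 0 < \<sigma> \<Longrightarrow> (\<And>y. norm (\<xi> - y) \<le> \<sigma> * W \<Longrightarrow> \<bar>r s y\<bar> \<le> m) \<Longrightarrow>
        \<bar>\<integral>u. g u \<bullet> G s (\<xi> - \<sigma> *\<^sub>R u) \<partial>lborel\<bar> \<le> 3 * unit_ball_vol 3 * \<sigma> * m * (\<integral>u. F u \<partial>lborel)"
    and r_eq: "\<And>s x. 0 \<le> s \<Longrightarrow> s \<le> T \<Longrightarrow> r s x = (\<integral>v. F v - f (s, x, v) \<partial>lborel)"
begin

lemma CG_nonneg: "0 \<le> CG" and CF_nonneg: "0 \<le> CF"
proof -
  show "0 \<le> CG" using G_bound[of 0 0] T norm_ge_zero[of "G 0 0"] by linarith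
  have "0 \<le> \<bar>F 0 - F (axis 1 1)\<bar>" by simp
  also have "\<dots> \<le> CF * norm (0 - axis 1 1 :: real^3)" by (rule F_lipschitz)
  finally show "0 \<le> CF" by (simp add: norm_axis_1)
qed

section \<open>Trajectories in the field frozen at a point\<close>

lemma continuous_on_G_compose:
  assumes "continuous_on S a" "continuous_on S b" "\<And>z. z \<in> S \<Longrightarrow> a z \<in> {0..T}"
  shows "continuous_on S (\<lambda>z. G (a z) (b z))"
proof -
  have "continuous_on S (\<lambda>z. case (a z, b z) of (s, y) \<Rightarrow> G s y)"
    by (rule continuous_on_compose2[OF continuous_G]) (use assms in \<open>auto intro!: continuous_on_Pair\<close>)
  then show ?thesis by simp
qed

text \<open>The value \<open>drift t x 0\<close> is the shift \<open>c\<close> of the overview.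
  Since it does not depend on \<open>v\<close>, it can be removed by translating the velocity
  variable.\<close>

definition drift :: "real \<Rightarrow> real^3 \<Rightarrow> real \<Rightarrow> real^3" where
  "drift t x s = integral {s..t} (\<lambda>\<tau>. G \<tau> x)"

definition drift2 :: "real \<Rightarrow> real^3 \<Rightarrow> real \<Rightarrow> real^3" where
  "drift2 t x s = integral {s..t} (drift t x)"

text \<open>Backward trajectory from \<open>(x, v)\<close> at time \<open>t\<close> in the field frozen at \<open>x\<close>.\<close>

definition path :: "real \<Rightarrow> real^3 \<Rightarrow> real^3 \<Rightarrow> real \<Rightarrow> real^3" where
  "path t x v s = x - (t - s) *\<^sub>R v - drift2 t x s"

definition kick :: "real \<Rightarrow> real^3 \<Rightarrow> real^3 \<Rightarrow> real \<Rightarrow> real^3" where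
  "kick t x v s = integral {s..t} (\<lambda>\<tau>. G \<tau> (path t x v \<tau>))"

lemma
  assumes t: "0 \<le> t" "t \<le> T" and s: "s \<in> {0..t}"
  shows drift_deriv: "(drift t x has_vector_derivative - G s x) (at s within {0..t})"
    and drift2_deriv: "(drift2 t x has_vector_derivative - drift t x s) (at s within {0..t})"
    and path_deriv: "(path t x v has_vector_derivative v + drift t x s) (at s within {0..t})"
    and kick_deriv: "(kick t x v has_vector_derivative - G s (path t x v s)) (at s within {0..t})"
proof -
  have 1: "(drift t x has_vector_derivative - G s x) (at s within {0..t})" if "s \<in> {0..t}" for s
    unfolding drift_def[abs_def]
    by (rule integral_has_vector_derivative') (use t that in \<open>auto intro!: continuous_on_G_compose continuous_intros\<close>)
  then show "(drift t x has_vector_derivative - G s x) (at s within {0..t})" using s .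
  have "continuous_on {0..t} (drift t x)"
    using 1 by (blast intro: has_vector_derivative_continuous continuous_on_eq_continuous_within[THEN iffD2])
  then have 2: "(drift2 t x has_vector_derivative - drift t x s) (at s within {0..t})" if "s \<in> {0..t}" for s
    unfolding drift2_def[abs_def] by (rule integral_has_vector_derivative') (use that in auto)
  then show "(drift2 t x has_vector_derivative - drift t x s) (at s within {0..t})" using s .
  have 3: "(path t x v has_vector_derivative v + drift t x s) (at s within {0..t})" if "s \<in> {0..t}" for s
  proof -
    have "((\<lambda>s. x - (t - s) *\<^sub>R v) has_vector_derivative v) (at s within {0..t})"
      by (auto intro!: derivative_eq_intros)
    from has_vector_derivative_diff[OF this 2[OF that]] show ?thesis
      by (simp add: path_def[abs_def])
  qed
  then show "(path t x v has_vector_derivative v + drift t x s) (at s within {0..t})" using s .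
  have "continuous_on {0..t} (path t x v)"
    using 3 by (blast intro: has_vector_derivative_continuous continuous_on_eq_continuous_within[THEN iffD2])
  then show "(kick t x v has_vector_derivative - G s (path t x v s)) (at s within {0..t})"
    unfolding kick_def[abs_def]
    by (intro integral_has_vector_derivative') (use t s in \<open>auto intro!: continuous_on_G_compose continuous_intros\<close>)
qed

lemma
  assumes t: "0 \<le> t" "t \<le> T"
  shows continuous_on_drift2: "continuous_on {0..t} (drift2 t x)"
    and continuous_on_drift: "continuous_on {0..t} (drift t x)"
    and continuous_on_path: "continuous_on {0..t} (path t x v)"
  using drift_deriv[OF t] drift2_deriv[OF t] path_deriv[OF t]
  by (blast intro: has_vector_derivative_continuous continuous_on_eq_continuous_within[THEN iffD2])+

lemma
  assumes t: "t \<le> T" and s: "s \<in> {0..t}"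
  shows norm_drift_le: "norm (drift t x s) \<le> CG * T"
    and norm_drift2_le: "norm (drift2 t x s) \<le> CG * T * T"
    and norm_path_le: "norm (path t x v s - x) \<le> T * norm v + CG * T * T"
proof -
  have 1: "norm (drift t x s) \<le> CG * T" if "s \<in> {0..t}" for s
    unfolding drift_def
    by (rule integral_norm_le_const)
      (use t that G_bound CG_nonneg in \<open>auto intro!: continuous_on_G_compose continuous_intros\<close>)
  then show "norm (drift t x s) \<le> CG * T" using s .
  have "continuous_on {s..t} (drift t x)"
    using continuous_on_drift[of t x] t s by (auto elim: continuous_on_subset)
  then show 2: "norm (drift2 t x s) \<le> CG * T * T"
    unfolding drift2_def by (rule integral_norm_le_const) (use 1 t s CG_nonneg T in auto)
  have "norm (path t x v s - x) = norm ((t - s) *\<^sub>R v + drift2 t x s)"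
    using norm_minus_cancel[of "(t - s) *\<^sub>R v + drift2 t x s"] by (simp add: path_def)
  also have "\<dots> \<le> norm ((t - s) *\<^sub>R v) + norm (drift2 t x s)" by (rule norm_triangle_ineq)
  also have "norm ((t - s) *\<^sub>R v) \<le> T * norm v" using t s by (simp add: mult_right_mono)
  finally show "norm (path t x v s - x) \<le> T * norm v + CG * T * T" using 2 by linarith
qed

lemma tracking:
  assumes P: "0 \<le> P"
  shows "\<exists>C N. 0 \<le> C \<and> (\<forall>t x v. 0 \<le> t \<longrightarrow> t \<le> T \<longrightarrow> norm v \<le> P \<longrightarrow> N \<le> R x \<longrightarrow>
    norm (kick t x v 0 - drift t x 0) \<le> C * R x powr (-3) \<and>
    \<bar>f (t, x, v) - F (v + kick t x v 0)\<bar> \<le> C * R x powr (-6))"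
proof -
  define L0 where "L0 = T * P + CG * T * T"
  have L0: "0 \<le> L0" using P CG_nonneg T by (simp add: L0_def)
  obtain C1 N1 where C1: "\<And>s x y. s \<in> {0..T} \<Longrightarrow> N1 \<le> R x \<Longrightarrow> norm (y - x) \<le> L0 \<Longrightarrow>
      norm (G s y - G s x) \<le> C1 * R x powr (-3)"
    using G_diff[OF L0] by blast
  \<comment> \<open>\<open>T * \<bar>C1\<bar>\<close> covers the difference between
    \<open>kick\<close> and \<open>drift\<close>, one unit covers the velocity radius of the tube,
    and the last one gives strictness.\<close>
  define K1 where "K1 = T * \<bar>C1\<bar> + 2"
  have K1: "0 < K1" using T by (simp add: K1_def add_nonneg_pos)
  define L where "L = L0 + T * K1"
  have L: "L0 \<le> L" "T * K1 \<le> L" "0 \<le> L" "0 \<le> T * K1" using L0 T K1 by (auto simp: L_def)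
  obtain C2 N2 where C2: "\<And>s x y y'. s \<in> {0..T} \<Longrightarrow> N2 \<le> R x \<Longrightarrow> norm (y - x) \<le> L \<Longrightarrow>
      norm (y' - x) \<le> L \<Longrightarrow> norm (y - y') \<le> T * K1 * R x powr (-3) \<Longrightarrow> norm (G s y - G s y') \<le> C2 * R x powr (-6)"
    using G_diff_near[OF L(3,4)] by blast
  define K2 where "K2 = \<bar>C2\<bar> + 1"
  have K2: "0 < K2" by (simp add: K2_def)
  obtain C0 N0 where C0: "\<And>y w. N0 < norm y \<Longrightarrow> \<bar>f (0, y, w) - F w\<bar> \<le> C0 * R y powr (-6)"
    using f_initial by blast
  \<comment> \<open>The bound \<open>T * K2\<close> makes the velocity radius at most
    \<open>R x powr (-3)\<close>; \<open>N0 + 2 + L\<close> keeps the whole tube at time 0 in the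
    region where the initial perturbation decays.\<close>
  define N where "N = max (max N1 N2) (max (T * K2) (N0 + 2 + L))"
  define C3 where "C3 = CF * K2 * T + \<bar>C0\<bar> * (1 + L) powr 6"
  have C3: "0 \<le> C3" using CF_nonneg K2 T by (simp add: C3_def)
  have C3': "\<bar>C0\<bar> \<le> C3"
  proof -
    have "1 \<le> (1 + L) powr 6" using L ge_one_powr_ge_zero[of "1 + L" 6] by simp
    then have "\<bar>C0\<bar> * 1 \<le> \<bar>C0\<bar> * (1 + L) powr 6" by (intro mult_left_mono) auto
    moreover have "0 \<le> CF * K2 * T" using CF_nonneg K2 T by simp
    ultimately show ?thesis unfolding C3_def by linarith
  qed
  define C where "C = T * \<bar>C1\<bar> + C3"
  have C: "0 \<le> C" "T * \<bar>C1\<bar> \<le> C" "C3 \<le> C" using C3 T by (auto simp: C_def)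
  have main: "norm (kick t x v 0 - drift t x 0) \<le> T * \<bar>C1\<bar> * R x powr (-3) \<and>
    \<bar>f (t, x, v) - F (v + kick t x v 0)\<bar> \<le> C3 * R x powr (-6)"
    if t: "0 \<le> t" "t \<le> T" and v: "norm v \<le> P" and x: "N \<le> R x" for t x v
  proof -
    have N: "N1 \<le> R x" "N2 \<le> R x" "T * K2 \<le> R x" "N0 + 2 + L \<le> R x" using x by (auto simp: N_def)
    have far: "N0 < norm y" if "norm (y - x) \<le> L" for y
      using that N(4) R_le_norm[of x] norm_triangle_ineq2[of x y] by (simp add: norm_minus_commute)
    have px: "norm (path t x v s - x) \<le> L0" if "s \<in> {0..t}" for s
    proof -
      have "norm (path t x v s - x) \<le> T * norm v + CG * T * T" by (rule norm_path_le[OF t(2) that])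
      also have "\<dots> \<le> L0" using v T by (simp add: L0_def mult_left_mono)
      finally show ?thesis .
    qed
    have kd: "norm (kick t x v s - drift t x s) \<le> T * \<bar>C1\<bar> * R x powr (-3)" if s: "s \<in> {0..t}" for s
    proof -
      have c1: "continuous_on {s..t} (\<lambda>\<tau>. G \<tau> (path t x v \<tau>))"
        by (intro continuous_on_G_compose continuous_intros continuous_on_subset[OF continuous_on_path[OF t]])
          (use s t in auto)
      have c2: "continuous_on {s..t} (\<lambda>\<tau>. G \<tau> x)"
        by (intro continuous_on_G_compose continuous_intros) (use s t in auto)
      have "kick t x v s - drift t x s = integral {s..t} (\<lambda>\<tau>. G \<tau> (path t x v \<tau>) - G \<tau> x)"
        unfolding kick_def drift_def
        by (rule Henstock_Kurzweil_Integration.integral_diff[symmetric])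
          (use c1 c2 in \<open>auto intro: integrable_continuous_interval\<close>)
      also have "norm \<dots> \<le> (\<bar>C1\<bar> * R x powr (-3)) * T"
      proof (rule integral_norm_le_const)
        fix \<tau> assume \<tau>: "\<tau> \<in> {s..t}"
        have "norm (G \<tau> (path t x v \<tau>) - G \<tau> x) \<le> C1 * R x powr (-3)"
          using \<tau> s t px[of \<tau>] N by (intro C1) auto
        also have "\<dots> \<le> \<bar>C1\<bar> * R x powr (-3)" by (intro mult_right_mono) auto
        finally show "norm (G \<tau> (path t x v \<tau>) - G \<tau> x) \<le> \<bar>C1\<bar> * R x powr (-3)" .
      qed (use s t c1 c2 in \<open>auto intro: continuous_on_diff\<close>)
      finally show ?thesis by (simp add: mult_ac)
    qed
    have "\<bar>f (t, x, v) - F (v + kick t x v 0)\<bar> \<le> C3 * R x powr (-6)"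
    proof (cases "t = 0")
      case True
      have "\<bar>f (0, x, v) - F v\<bar> \<le> C0 * R x powr (-6)" using far[of x] L by (intro C0) simp
      also have "\<dots> \<le> C3 * R x powr (-6)" using C3' by (intro mult_right_mono) auto
      finally show ?thesis using True by (simp add: kick_def)
    next
      case False
      then have tpos: "0 < t" using t by simp
      \<comment> \<open>The centre moves with velocity \<open>v + drift\<close> while velocities in
        the tube are near \<open>v + kick\<close>; this mismatch dictates the position rate
        \<open>a\<close>. Only increments of the field over distances \<open>a * T\<close> enter
        \<open>b\<close>, whence its smaller order.\<close>
      define a b where "a = K1 * R x powr (-3)" and "b = K2 * R x powr (-6)"
      have ab: "0 \<le> a" "0 \<le> b" using K1 K2 by (auto simp: a_def b_def)
      have aT: "a * T \<le> T * K1"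
        using R_powr_minus_le_1[of 3 x] K1 T unfolding a_def by (simp add: mult_left_le)
      have bT: "b * T \<le> R x powr (-3)"
      proof -
        have "R x powr (-1) \<ge> R x powr (-3)" by (rule R_powr_mono_minus) simp
        then have "T * K2 * R x powr (-3) \<le> R x * R x powr (-1)"
          using N(3) T K2 by (intro mult_mono) auto
        also have "\<dots> = 1" by (simp add: powr_minus_divide)
        finally have "T * K2 * R x powr (-3) * R x powr (-3) \<le> 1 * R x powr (-3)"
          by (intro mult_right_mono) auto
        moreover have "R x powr (-3) * R x powr (-3) = R x powr (-6)" by (simp add: powr_add[symmetric])
        ultimately show ?thesis by (simp add: b_def mult_ac)
      qed
      have dU: "((\<lambda>s. v + kick t x v s) has_vector_derivative - G s (path t x v s)) (at s within {0..t})" if "s \<in> {0..t}" for s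
        using has_vector_derivative_add[OF has_vector_derivative_const kick_deriv[OF t that]] by simp
      have ends: "path t x v t = x" "v + kick t x v t = v" by (simp_all add: path_def drift2_def kick_def)
      have tube: "norm (w - (v + drift t x s)) < a \<and> norm (G s y - G s (path t x v s)) < b"
        if s: "0 < s" "s \<le> t" and y: "norm (y - path t x v s) \<le> a * (t - s)" and w: "norm (w - (v + kick t x v s)) \<le> b * (t - s)" for s y w
      proof
        have st: "s \<in> {0..t}" using s by simp
        have "a * (t - s) \<le> a * T" "b * (t - s) \<le> b * T" using s t ab by (auto intro: mult_left_mono)
        then have y': "norm (y - path t x v s) \<le> a * T" and w': "norm (w - (v + kick t x v s)) \<le> b * T"
          using y w by linarith+
        have "norm (w - (v + drift t x s)) \<le> norm (w - (v + kick t x v s)) + norm (kick t x v s - drift t x s)"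
        proof -
          have e: "w - (v + drift t x s) = (w - (v + kick t x v s)) + (kick t x v s - drift t x s)" by simp
          show ?thesis unfolding e by (rule norm_triangle_ineq)
        qed
        also have "\<dots> \<le> R x powr (-3) + T * \<bar>C1\<bar> * R x powr (-3)" using w' bT kd[OF st] by linarith
        also have "\<dots> < a" by (simp add: a_def K1_def algebra_simps)
        finally show "norm (w - (v + drift t x s)) < a" .
        have "norm (G s y - G s (path t x v s)) \<le> C2 * R x powr (-6)"
        proof (rule C2)
          have "norm (y - x) \<le> norm (y - path t x v s) + norm (path t x v s - x)"
            using norm_triangle_ineq[of "y - path t x v s" "path t x v s - x"] by simp
          then show "norm (y - x) \<le> L" using y' aT px[OF st] by (simp add: L_def)
          show "norm (path t x v s - x) \<le> L" using px[OF st] L by linarith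
          show "norm (y - path t x v s) \<le> T * K1 * R x powr (-3)" using y' by (simp add: a_def mult_ac)
        qed (use s t N in auto)
        also have "\<dots> < b" unfolding b_def K2_def by (intro mult_strict_right_mono) (auto simp: less_le)
        finally show "norm (G s y - G s (path t x v s)) < b" .
      qed
      have init: "\<bar>f (0, y, w) - F (v + kick t x v 0)\<bar> \<le> C3 * R x powr (-6)"
        if y: "norm (y - path t x v 0) \<le> a * t" and w: "norm (w - (v + kick t x v 0)) \<le> b * t" for y w
      proof -
        have "a * t \<le> a * T" "b * t \<le> b * T" using t ab by (auto intro: mult_left_mono)
        moreover have "norm (y - x) \<le> norm (y - path t x v 0) + norm (path t x v 0 - x)"
          using norm_triangle_ineq[of "y - path t x v 0" "path t x v 0 - x"] by simp
        ultimately have yx: "norm (y - x) \<le> L" using y aT px[of 0] t by (simp add: L_def)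
        have "\<bar>f (0, y, w) - F w\<bar> \<le> C0 * R y powr (-6)" by (rule C0[OF far[OF yx]])
        also have "\<dots> \<le> \<bar>C0\<bar> * ((1 + L) powr 6 * R x powr (-6))"
          using yx by (intro mult_mono R_powr_minus_near) (auto simp: norm_minus_commute)
        finally have 1: "\<bar>f (0, y, w) - F w\<bar> \<le> \<bar>C0\<bar> * (1 + L) powr 6 * R x powr (-6)" by simp
        have "\<bar>F w - F (v + kick t x v 0)\<bar> \<le> CF * norm (w - (v + kick t x v 0))" by (rule F_lipschitz)
        also have "\<dots> \<le> CF * (b * T)" using w \<open>b * t \<le> b * T\<close> CF_nonneg by (intro mult_left_mono) auto
        finally have 2: "\<bar>F w - F (v + kick t x v 0)\<bar> \<le> CF * K2 * T * R x powr (-6)" by (simp add: b_def mult_ac)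
        show ?thesis using 1 2 unfolding C3_def by (simp add: algebra_simps)
      qed
      \<comment> \<open>The upper bound comes from \<open>f\<close> and the lower one from
        \<open>- f\<close>, which satisfies the same transport equation.\<close>
      have "f (t, path t x v t, v + kick t x v t) \<le> F (v + kick t x v 0) + C3 * R x powr (-6)"
      proof (rule tube_principle[where f' = f' and G = G and Y = "path t x v" and U = "\<lambda>s. v + kick t x v s" and P = "\<lambda>s. v + drift t x s" and \<Gamma> = "\<lambda>s. G s (path t x v s)" and a = a and b = b])
        show "f (0, y, w) \<le> F (v + kick t x v 0) + C3 * R x powr (-6)"
          if "norm (y - path t x v 0) \<le> a * t" "norm (w - (v + kick t x v 0)) \<le> b * t" for y w
          using init[OF that] by linarith
      qed (use f_deriv transport tpos t path_deriv[OF t] dU tube in auto)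
      moreover have "- f (t, path t x v t, v + kick t x v t) \<le> - F (v + kick t x v 0) + C3 * R x powr (-6)"
      proof (rule tube_principle[where f = "\<lambda>z. - f z" and f' = "\<lambda>z h. - f' z h" and G = G and Y = "path t x v" and U = "\<lambda>s. v + kick t x v s" and P = "\<lambda>s. v + drift t x s" and \<Gamma> = "\<lambda>s. G s (path t x v s)" and a = a and b = b])
        show "- f (0, y, w) \<le> - F (v + kick t x v 0) + C3 * R x powr (-6)"
          if "norm (y - path t x v 0) \<le> a * t" "norm (w - (v + kick t x v 0)) \<le> b * t" for y w
          using init[OF that] by linarith
      qed (use has_derivative_minus[OF f_deriv] transport tpos t path_deriv[OF t] dU tube in auto)
      ultimately show ?thesis by (simp add: ends abs_le_iff)
    qed
    then show ?thesis using kd[of 0] t by simp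
  qed
  show ?thesis
  proof (rule exI[of _ C], rule exI[of _ N], intro conjI allI impI C(1))
    fix t x and v :: "real^3" assume *: "0 \<le> t" "t \<le> T" "norm v \<le> P" "N \<le> R x"
    show "norm (kick t x v 0 - drift t x 0) \<le> C * R x powr (-3)"
      using main[OF *] order_trans[OF _ mult_right_mono[OF C(2) powr_ge_zero[of "R x" "-3"]]] by blast
    show "\<bar>f (t, x, v) - F (v + kick t x v 0)\<bar> \<le> C * R x powr (-6)"
      using main[OF *] order_trans[OF _ mult_right_mono[OF C(3) powr_ge_zero[of "R x" "-6"]]] by blast
  qed
qed

end

text \<open>A passage to the gauge integral over a box, where continuity of the integrand alone
  justifies exchanging integrals and yields continuity in parameters.\<close>

lemma lborel_integral_eq_integral_cbox:
  fixes k :: "real^3 \<Rightarrow> real"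
  assumes "continuous_on UNIV k" "\<And>u. M < norm u \<Longrightarrow> k u = 0" "cball 0 M \<subseteq> cbox a b"
  shows "(\<integral>u. k u \<partial>lborel) = integral (cbox a b) k"
proof -
  have "k u = 0" if "u \<notin> cbox a b" for u
    using assms(2)[of u] assms(3) that by (force simp: not_le[symmetric])
  then have e: "(\<lambda>u. if u \<in> cbox a b then k u else 0) = k" by (auto simp: fun_eq_iff)
  have "(\<integral>u. k u \<partial>lborel) = integral UNIV k"
    by (rule integral_lborel[symmetric]) (rule integrable_compact_support[OF assms(1,2)])
  also have "\<dots> = integral (cbox a b) k"
    using integral_restrict_UNIV[of "cbox a b" k] by (simp add: e)
  finally show ?thesis .
qed

context vlasov_bounds
begin

section \<open>The density as a time integral of fluxes\<close>

lemma g_support: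
  assumes "W < norm u"
  shows "g u = 0"
  using fun_cong[OF has_derivative_zero_outside[OF F_deriv F_support assms], of "g u"] by simp

lemma integral_g_inner: "(\<integral>u. g u \<bullet> e \<partial>lborel) = 0"
  by (rule integral_directional_derivative_eq_0(2)[where \<phi> = F and \<phi>' = "\<lambda>u h. g u \<bullet> h" and M = W])
    (auto intro: F_deriv F_support continuous_on_inner continuous_g continuous_on_const)

lemma continuous_on_F: "continuous_on UNIV F"
  using F_deriv by (intro continuous_at_imp_continuous_on) (auto intro: has_derivative_continuous)

lemma continuous_on_kick:
  assumes t: "0 \<le> t" "t \<le> T" and a: "continuous_on S a"
  shows "continuous_on S (\<lambda>z. kick t x (a z) 0)"
proof -
  have "continuous_on S (\<lambda>z. integral (cbox 0 t) (\<lambda>\<tau>. G \<tau> (path t x (a z) \<tau>)))"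
  proof (rule integral_continuous_on_param)
    show "continuous_on (S \<times> cbox 0 t) (\<lambda>(z, \<tau>). G \<tau> (path t x (a z) \<tau>))"
      unfolding split_def path_def
      by (intro continuous_on_G_compose continuous_intros continuous_on_compose2[OF a]
          continuous_on_compose2[OF continuous_on_drift2[OF t]]) (use t in auto)
  qed
  then show ?thesis by (simp add: kick_def)
qed

text \<open>In the variable \<open>u = v + drift t x 0\<close> the trajectories are affine, so the leading
  term of the density is a time integral of fluxes.\<close>

lemma integral_g_kick_le:
  assumes t: "0 \<le> t" "t \<le> T" and K: "0 < K" and \<mu>: "0 \<le> \<mu>"
    and m: "\<And>s y. 0 \<le> s \<Longrightarrow> s \<le> t \<Longrightarrow> norm (y - x) \<le> T * \<bar>W\<bar> + 2 * (CG * T * T) \<Longrightarrow> \<bar>r s y\<bar> \<le> \<mu> * exp (K * s)"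
    and F0: "\<And>u. 0 \<le> F u"
  shows "\<bar>\<integral>u. g u \<bullet> (kick t x (u - drift t x 0) 0 - drift t x 0) \<partial>lborel\<bar>
     \<le> 3 * unit_ball_vol 3 * T * (\<integral>u. F u \<partial>lborel) * (\<mu> * exp (K * t) / K)"
proof -
  define c where "c = drift t x 0"
  \<comment> \<open>The centre of the affine family: in terms of \<open>u = v + c\<close> the
    trajectory is \<open>\<xi> \<tau> - (t - \<tau>) *\<^sub>R u\<close>, the form to which
    \<open>flux\<close> applies with \<open>\<sigma> = t - \<tau>\<close>.\<close>
  define \<xi> where "\<xi> \<tau> = x + (t - \<tau>) *\<^sub>R c - drift2 t x \<tau>" for \<tau>
  define h where "h u \<tau> = g u \<bullet> (G \<tau> (\<xi> \<tau> - (t - \<tau>) *\<^sub>R u) - G \<tau> x)" for u \<tau>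
  define I where "I = (\<integral>u. F u \<partial>lborel)"
  have I: "0 \<le> I" unfolding I_def using F0 by simp
  define \<kappa> where "\<kappa> = 3 * unit_ball_vol 3 * T * I * \<mu>"
  have \<kappa>: "0 \<le> \<kappa>" using I T \<mu> by (simp add: \<kappa>_def)
  obtain b where b: "cball 0 W \<subseteq> cbox (- b) (b :: real^3)"
    using bounded_subset_cbox_symmetric[OF bounded_cball] by blast
  have cxi: "continuous_on {0..t} \<xi>"
    unfolding \<xi>_def[abs_def] by (intro continuous_intros continuous_on_drift2 t)
  have path: "path t x (u - c) \<tau> = \<xi> \<tau> - (t - \<tau>) *\<^sub>R u" for u \<tau>
    by (simp add: path_def \<xi>_def algebra_simps)
  have ch: "continuous_on (UNIV \<times> {0..t}) (\<lambda>(u, \<tau>). h u \<tau>)"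
    unfolding split_def h_def
    by (intro continuous_intros continuous_on_G_compose continuous_on_compose2[OF cxi] continuous_on_compose2[OF continuous_g])
      (use t in auto)
  have chu: "continuous_on UNIV (\<lambda>u. h u \<tau>)" if "\<tau> \<in> {0..t}" for \<tau>
  proof -
    have "continuous_on UNIV (\<lambda>u. case (u, \<tau>) of (u, \<tau>) \<Rightarrow> h u \<tau>)"
      by (rule continuous_on_compose2[OF ch]) (use that in \<open>auto intro!: continuous_on_Pair\<close>)
    then show ?thesis by simp
  qed
  have cpath: "continuous_on {0..t} (\<lambda>\<tau>. G \<tau> (path t x v \<tau>))" for v
    by (intro continuous_on_G_compose continuous_intros continuous_on_path) (use t in auto)
  have cG: "continuous_on {0..t} (\<lambda>\<tau>. G \<tau> x)"
    by (intro continuous_on_G_compose continuous_intros) (use t in auto)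
  have inner: "g u \<bullet> (kick t x (u - c) 0 - c) = integral (cbox 0 t) (h u)" for u
  proof -
    have "kick t x (u - c) 0 - c = integral {0..t} (\<lambda>\<tau>. G \<tau> (path t x (u - c) \<tau>) - G \<tau> x)"
      unfolding kick_def c_def drift_def
      by (rule Henstock_Kurzweil_Integration.integral_diff[symmetric])
        (use cpath cG in \<open>auto intro: integrable_continuous_interval\<close>)
    also have "g u \<bullet> \<dots> = integral {0..t} ((\<lambda>z. g u \<bullet> z) \<circ> (\<lambda>\<tau>. G \<tau> (path t x (u - c) \<tau>) - G \<tau> x))"
      by (rule integral_linear[symmetric])
        (use cpath cG in \<open>auto intro!: integrable_continuous_interval continuous_on_diff bounded_linear_inner_right\<close>)
    also have "\<dots> = integral (cbox 0 t) (h u)"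
      by (simp add: o_def h_def[abs_def] path)
    finally show ?thesis .
  qed
  have hint: "\<bar>integral (cbox (- b) b) (\<lambda>u. h u \<tau>)\<bar> \<le> \<kappa> * exp (K * \<tau>)" if \<tau>: "\<tau> \<in> {0..t}" for \<tau>
  proof (cases "\<tau> = t")
    case True
    \<comment> \<open>The assumption \<open>flux\<close> requires a positive scale; at the final
      time the trajectory is at \<open>x\<close> and the increment is 0.\<close>
    have "h u \<tau> = 0" for u by (simp add: h_def \<xi>_def True drift2_def)
    then show ?thesis using \<kappa> by simp
  next
    case False
    have ge: "continuous_on UNIV (\<lambda>u. g u \<bullet> G \<tau> (\<xi> \<tau> - (t - \<tau>) *\<^sub>R u))"
      by (intro continuous_intros continuous_on_G_compose continuous_g) (use t \<tau> in auto)
    have "integral (cbox (- b) b) (\<lambda>u. h u \<tau>) = (\<integral>u. h u \<tau> \<partial>lborel)"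
      by (rule lborel_integral_eq_integral_cbox[OF chu[OF \<tau>] _ b, symmetric]) (simp add: h_def g_support)
    also have "\<dots> = (\<integral>u. g u \<bullet> G \<tau> (\<xi> \<tau> - (t - \<tau>) *\<^sub>R u) \<partial>lborel) - (\<integral>u. g u \<bullet> G \<tau> x \<partial>lborel)"
      unfolding h_def inner_diff_right
      by (rule Bochner_Integration.integral_diff)
        (auto intro!: integrable_compact_support[where M = W] ge continuous_intros continuous_g simp: g_support)
    also have "\<dots> = (\<integral>u. g u \<bullet> G \<tau> (\<xi> \<tau> - (t - \<tau>) *\<^sub>R u) \<partial>lborel)" by (simp add: integral_g_inner)
    also have "\<bar>\<dots>\<bar> \<le> 3 * unit_ball_vol 3 * (t - \<tau>) * (\<mu> * exp (K * \<tau>)) * (\<integral>u. F u \<partial>lborel)"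
    proof (rule flux)
      fix y assume y: "norm (\<xi> \<tau> - y) \<le> (t - \<tau>) * W"
      have "(t - \<tau>) * W \<le> (t - \<tau>) * \<bar>W\<bar>" using \<tau> by (intro mult_left_mono) auto
      also have "\<dots> \<le> T * \<bar>W\<bar>" using \<tau> t by (intro mult_right_mono) auto
      finally have "(t - \<tau>) * W \<le> T * \<bar>W\<bar>" .
      moreover have "norm (\<xi> \<tau> - x) \<le> 2 * (CG * T * T)"
      proof -
        have "norm (\<xi> \<tau> - x) \<le> norm ((t - \<tau>) *\<^sub>R c) + norm (drift2 t x \<tau>)"
        proof -
          have e: "\<xi> \<tau> - x = (t - \<tau>) *\<^sub>R c - drift2 t x \<tau>" by (simp add: \<xi>_def)
          show ?thesis unfolding e by (rule norm_triangle_ineq4)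
        qed
        moreover have "norm ((t - \<tau>) *\<^sub>R c) \<le> T * (CG * T)"
        proof -
          have "norm c \<le> CG * T" unfolding c_def by (rule norm_drift_le[OF t(2)]) (use t in simp)
          then show ?thesis unfolding norm_scaleR using \<tau> t T by (intro mult_mono) auto
        qed
        moreover have "norm (drift2 t x \<tau>) \<le> CG * T * T" by (rule norm_drift2_le[OF t(2) \<tau>])
        ultimately show ?thesis by (simp add: mult_ac)
      qed
      moreover have "norm (y - x) \<le> norm (\<xi> \<tau> - y) + norm (\<xi> \<tau> - x)"
      proof -
        have e: "y - x = (\<xi> \<tau> - x) - (\<xi> \<tau> - y)" by simp
        show ?thesis unfolding e using norm_triangle_ineq4[of "\<xi> \<tau> - x" "\<xi> \<tau> - y"] by linarith
      qed
      ultimately show "\<bar>r \<tau> y\<bar> \<le> \<mu> * exp (K * \<tau>)" using y \<tau> by (intro m) auto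
    qed (use \<tau> t False in auto)
    also have "\<dots> \<le> 3 * unit_ball_vol 3 * T * (\<mu> * exp (K * \<tau>)) * (\<integral>u. F u \<partial>lborel)"
      using \<tau> t I \<mu> unfolding I_def by (intro mult_right_mono mult_left_mono) auto
    also have "\<dots> = \<kappa> * exp (K * \<tau>)" by (simp add: \<kappa>_def I_def mult_ac)
    finally show ?thesis .
  qed
  have ck: "continuous_on UNIV (\<lambda>u. g u \<bullet> (kick t x (u - c) 0 - c))"
    by (intro continuous_intros continuous_on_kick continuous_g t)
  have "(\<integral>u. g u \<bullet> (kick t x (u - c) 0 - c) \<partial>lborel) = integral (cbox (- b) b) (\<lambda>u. integral (cbox 0 t) (h u))"
    unfolding inner[symmetric]
    by (rule lborel_integral_eq_integral_cbox[OF ck _ b]) (simp add: g_support)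
  also have "\<dots> = integral (cbox 0 t) (\<lambda>\<tau>. integral (cbox (- b) b) (\<lambda>u. h u \<tau>))"
    by (rule integral_swap_continuous) (rule continuous_on_subset[OF ch], auto simp: cbox_Pair_eq)
  also have "norm \<dots> \<le> integral (cbox 0 t) (\<lambda>\<tau>. \<kappa> * exp (K * \<tau>))"
  proof (rule Henstock_Kurzweil_Integration.integral_norm_bound_integral)
    have "continuous_on {0..t} (\<lambda>\<tau>. integral (cbox (- b) b) (\<lambda>u. h u \<tau>))"
    proof (rule integral_continuous_on_param)
      show "continuous_on ({0..t} \<times> cbox (- b) b) (\<lambda>(\<tau>, u). h u \<tau>)"
      proof -
        have "continuous_on ({0..t} \<times> cbox (- b) b) (\<lambda>z. case (snd z, fst z) of (u, \<tau>) \<Rightarrow> h u \<tau>)"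
          by (rule continuous_on_compose2[OF ch]) (auto intro!: continuous_on_Pair continuous_on_fst continuous_on_snd continuous_on_id)
        then show ?thesis by (simp add: split_def)
      qed
    qed
    then show "(\<lambda>\<tau>. integral (cbox (- b) b) (\<lambda>u. h u \<tau>)) integrable_on cbox 0 t"
      by (simp add: integrable_continuous_interval)
    show "(\<lambda>\<tau>. \<kappa> * exp (K * \<tau>)) integrable_on cbox 0 t"
      by (auto intro!: integrable_continuous_interval continuous_intros)
  qed (use hint in auto)
  \<comment> \<open>Integrating the exponential weight produces the factor \<open>1 / K\<close>, the
    smallness on which the Gronwall argument rests.\<close>
  also have "\<dots> = \<kappa> * exp (K * t) / K - \<kappa> * exp (K * 0) / K"
  proof -
    have "((\<lambda>\<tau>. \<kappa> * exp (K * \<tau>)) has_integral (\<kappa> * exp (K * t) / K - \<kappa> * exp (K * 0) / K)) {0..t}"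
      using t K by (intro fundamental_theorem_of_calculus)
        (auto intro!: derivative_eq_intros simp flip: has_real_derivative_iff_has_vector_derivative)
    then show ?thesis unfolding cbox_interval by (rule integral_unique)
  qed
  also have "\<dots> \<le> \<kappa> * exp (K * t) / K" using \<kappa> K by simp
  finally show ?thesis by (simp add: c_def \<kappa>_def I_def mult_ac)
qed

text \<open>After translating \<open>F\<close> by \<open>c\<close>, the density is the integral of
  an error \<open>e\<close> minus the integral of the linear term \<open>k\<close>. The error
  combines the Taylor remainder of \<open>F\<close> with the tracking error; \<open>k\<close>
  integrates to a flux. The constants are fixed before \<mu> and \<open>K\<close>, so
  \<open>K\<close> may later be chosen large in terms of them.\<close>

lemma density_estimate:
  assumes F0: "\<And>u. 0 \<le> F u"
  shows "\<exists>C L N. 0 \<le> C \<and> 0 \<le> L \<and> (\<forall>t x \<mu> K. 0 \<le> t \<longrightarrow> t \<le> T \<longrightarrow> N \<le> R x \<longrightarrow> 0 < K \<longrightarrow> 0 \<le> \<mu> \<longrightarrow>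
    (\<forall>s\<in>{0..t}. \<forall>y. norm (y - x) \<le> L \<longrightarrow> \<bar>r s y\<bar> \<le> \<mu> * exp (K * s)) \<longrightarrow>
    \<bar>r t x\<bar> \<le> C * R x powr (-6) + C * (\<mu> * exp (K * t) / K))"
proof -
  \<comment> \<open>Beyond this radius \<open>f\<close> vanishes, and so do \<open>F\<close> and
    \<open>g\<close> at the shifted velocity, because the shift is at most
    \<open>CG * T\<close>.\<close>
  define P where "P = max 0 (max Q (W + CG * T))"
  have P: "0 \<le> P" "Q \<le> P" "W + CG * T \<le> P" by (auto simp: P_def)
  obtain C N where C: "0 \<le> C" and
    track: "\<And>t x v. 0 \<le> t \<Longrightarrow> t \<le> T \<Longrightarrow> norm v \<le> P \<Longrightarrow> N \<le> R x \<Longrightarrow>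
      norm (kick t x v 0 - drift t x 0) \<le> C * R x powr (-3) \<and>
      \<bar>f (t, x, v) - F (v + kick t x v 0)\<bar> \<le> C * R x powr (-6)"
    using tracking[OF P(1)] by blast
  define L where "L = T * \<bar>W\<bar> + 2 * (CG * T * T)"
  define V where "V = measure lborel (cball (0::real^3) P)"
  define C1 where "C1 = C + CF * C ^ 2"
  have C1: "0 \<le> C1" using C CF_nonneg by (simp add: C1_def)
  define I where "I = 3 * unit_ball_vol 3 * T * (\<integral>u. F u \<partial>lborel)"
  have I: "0 \<le> I" unfolding I_def using F0 T by simp
  have main: "\<bar>r t x\<bar> \<le> C1 * V * R x powr (-6) + I * (\<mu> * exp (K * t) / K)"
    if t: "0 \<le> t" "t \<le> T" and x: "N \<le> R x" and K: "0 < K" and \<mu>: "0 \<le> \<mu>"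
      and m: "\<And>s y. s \<in> {0..t} \<Longrightarrow> norm (y - x) \<le> L \<Longrightarrow> \<bar>r s y\<bar> \<le> \<mu> * exp (K * s)" for t x \<mu> K
  proof -
    define c where "c = drift t x 0"
    have c: "norm c \<le> CG * T" unfolding c_def using t by (intro norm_drift_le) auto
    have vc: "W < norm (v + c)" if "P < norm v" for v
      using that c P(3) norm_triangle_ineq2[of v "- c"] by simp
    define k where "k v = g (v + c) \<bullet> (kick t x v 0 - c)" for v
    have ck: "continuous_on UNIV k"
      unfolding k_def[abs_def]
      by (intro continuous_intros continuous_on_kick continuous_on_compose2[OF continuous_g] t) auto
    have ik: "integrable lborel k"
      by (rule integrable_compact_support[OF ck, of P]) (simp add: k_def g_support vc)
    have iF: "integrable lborel F" by (rule integrable_compact_support[OF continuous_on_F F_support])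
    have Fc: "integrable lborel (\<lambda>v. F (v + c))" "(\<integral>v. F (v + c) \<partial>lborel) = (\<integral>v. F v \<partial>lborel)"
      using lborel_integral_affine[of F 1 c] iF borel_measurable_continuous_onI[OF continuous_on_F]
      by (simp_all add: add.commute)
    have cf: "continuous_on UNIV (\<lambda>v. f (t, x, v))"
    proof -
      have "((\<lambda>v. f (t, x, v)) has_derivative (\<lambda>h. f' (t, x, v) (0, 0, h))) (at v)" for v
        by (rule has_derivative_compose_within[where f = "\<lambda>v. (t, x, v)" and g = f and g' = "f' (t, x, v)" and T = "{0..} \<times> UNIV"])
          (use t f_deriv[of t x v] in \<open>auto intro!: derivative_eq_intros simp: zero_prod_def\<close>)
      then show ?thesis by (intro continuous_at_imp_continuous_on) (auto intro: has_derivative_continuous)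
    qed
    have if': "integrable lborel (\<lambda>v. f (t, x, v))"
      by (rule integrable_compact_support[OF cf, of Q]) (use t in \<open>simp add: f_support\<close>)
    define e where "e v = F (v + c) - f (t, x, v) + k v" for v
    have ie: "integrable lborel e"
      unfolding e_def[abs_def] by (intro Bochner_Integration.integrable_add Bochner_Integration.integrable_diff Fc if' ik)
    have "r t x = (\<integral>v. F v \<partial>lborel) - (\<integral>v. f (t, x, v) \<partial>lborel)"
      using r_eq[OF t] iF if' by simp
    also have "\<dots> = (\<integral>v. e v \<partial>lborel) - (\<integral>v. k v \<partial>lborel)"
      unfolding e_def using Fc if' ik by simp
    finally have r: "r t x = (\<integral>v. e v \<partial>lborel) - (\<integral>v. k v \<partial>lborel)" .
    have "norm (\<integral>v. e v \<partial>lborel) \<le> (\<integral>v. C1 * R x powr (-6) * indicator (cball (0::real^3) P) v \<partial>lborel)"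
    proof (rule Bochner_Integration.integral_norm_bound_integral[OF ie])
      show "integrable lborel (\<lambda>v. C1 * R x powr (-6) * indicator (cball (0::real^3) P) v)"
        by (intro integrable_mult_right integrable_real_indicator) (auto intro: emeasure_bounded_finite[unfolded infinity_ennreal_def])
      fix v
      show "norm (e v) \<le> C1 * R x powr (-6) * indicator (cball 0 P) v"
      proof (cases "norm v \<le> P")
        case True
        define d where "d = kick t x v 0 - c"
        have d: "norm d \<le> C * R x powr (-3)" and fd: "\<bar>f (t, x, v) - F (v + c + d)\<bar> \<le> C * R x powr (-6)"
          using track[OF t True x] by (simp_all add: d_def c_def)
        \<comment> \<open>The square of the first-order displacement is what produces the exponent
          6.\<close>
        have "norm d ^ 2 \<le> (C * R x powr (-3)) ^ 2" using d by (intro power_mono) auto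
        also have "\<dots> = C ^ 2 * R x powr (-6)"
          by (simp add: power_mult_distrib power2_eq_square powr_add[symmetric])
        finally have "CF * norm d ^ 2 \<le> CF * (C ^ 2 * R x powr (-6))" using CF_nonneg by (rule mult_left_mono)
        then have "\<bar>F (v + c + d) - F (v + c) - g (v + c) \<bullet> d\<bar> \<le> CF * C ^ 2 * R x powr (-6)"
          using F_taylor[of "v + c" d] by simp
        then have "\<bar>e v\<bar> \<le> C1 * R x powr (-6)"
          using fd unfolding e_def k_def d_def[symmetric] C1_def by (simp add: algebra_simps)
        then show ?thesis using True by simp
      next
        case False
        then have "P < norm v" by simp
        then have "e v = 0" using vc[of v] P t by (simp add: e_def k_def F_support g_support f_support)
        then show ?thesis using C1 by simp
      qed
    qed
    also have "\<dots> = C1 * V * R x powr (-6)" by (simp add: V_def mult_ac)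
    finally have 1: "\<bar>\<integral>v. e v \<partial>lborel\<bar> \<le> C1 * V * R x powr (-6)" by simp
    have "(\<integral>v. k v \<partial>lborel) = (\<integral>u. k (u - c) \<partial>lborel)"
      using lborel_integral_affine(2)[of k 1 "- c"] borel_measurable_continuous_onI[OF ck] by simp
    also have "\<dots> = (\<integral>u. g u \<bullet> (kick t x (u - drift t x 0) 0 - drift t x 0) \<partial>lborel)"
      by (simp add: k_def c_def)
    also have "\<bar>\<dots>\<bar> \<le> I * (\<mu> * exp (K * t) / K)"
      unfolding I_def by (rule integral_g_kick_le[OF t K \<mu> _ F0]) (use m in \<open>auto simp: L_def\<close>)
    finally show ?thesis using r 1 by linarith
  qed
  show ?thesis
  proof (intro exI conjI allI impI)
    show "0 \<le> C1 * V + I" using C1 I by (simp add: V_def)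
    show "0 \<le> L" using T CG_nonneg by (simp add: L_def)
    fix t x \<mu> K assume *: "0 \<le> t" "t \<le> T" "N \<le> R x" "0 < K" "0 \<le> \<mu>"
      "\<forall>s\<in>{0..t}. \<forall>y. norm (y - x) \<le> L \<longrightarrow> \<bar>r s y\<bar> \<le> \<mu> * exp (K * s)"
    have "\<bar>r t x\<bar> \<le> C1 * V * R x powr (-6) + I * (\<mu> * exp (K * t) / K)"
      using * by (intro main) auto
    also have "\<dots> \<le> (C1 * V + I) * R x powr (-6) + (C1 * V + I) * (\<mu> * exp (K * t) / K)"
      using C1 I * by (intro add_mono mult_right_mono) (auto simp: V_def)
    finally show "\<bar>r t x\<bar> \<le> (C1 * V + I) * R x powr (-6) + (C1 * V + I) * (\<mu> * exp (K * t) / K)" .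
  qed
qed

text \<open>Gronwall's argument with the weights \<open>R x powr (-6) + R x powr (-p) / n\<close>: for each \<open>n\<close> the
  supremum of the weighted density is finite a priori, and the bound it satisfies does not depend
  on \<open>n\<close>.\<close>

lemma density_decay:
  assumes F0: "\<And>u. 0 \<le> F u" and p: "0 \<le> p"
    and bd: "\<And>s y. 0 \<le> s \<Longrightarrow> s \<le> T \<Longrightarrow> \<bar>r s y\<bar> \<le> B * R y powr (-p)"
  shows "\<exists>C. \<forall>t x. 0 \<le> t \<longrightarrow> t \<le> T \<longrightarrow> \<bar>r t x\<bar> \<le> C * R x powr (-6)"
proof -
  obtain C0 L N where C0: "0 \<le> C0" and L: "0 \<le> L" and
    est: "\<forall>t x \<mu> K. 0 \<le> t \<longrightarrow> t \<le> T \<longrightarrow> N \<le> R x \<longrightarrow> 0 < K \<longrightarrow> 0 \<le> \<mu> \<longrightarrow>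
      (\<forall>s\<in>{0..t}. \<forall>y. norm (y - x) \<le> L \<longrightarrow> \<bar>r s y\<bar> \<le> \<mu> * exp (K * s)) \<longrightarrow>
      \<bar>r t x\<bar> \<le> C0 * R x powr (-6) + C0 * (\<mu> * exp (K * t) / K)"
    using density_estimate[OF F0] by auto
  have "0 \<le> \<bar>r 0 0\<bar>" by simp
  also have "\<dots> \<le> B * R 0 powr (-p)" using bd[of 0 0] T by simp
  finally have B: "0 \<le> B" by (simp add: zero_le_mult_iff)
  \<comment> \<open>The second term handles \<open>R x < N\<close>: there the weights are comparable
    to constants and the a priori bound suffices.\<close>
  define C where "C = C0 + B * (max N 1) powr 6"
  have C: "0 \<le> C" "C0 \<le> C" using C0 B by (auto simp: C_def)
  define \<Lambda> where "\<Lambda> = (1 + L) powr (6 + p)"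
  have \<Lambda>: "0 \<le> \<Lambda>" "(1 + L) powr 6 \<le> \<Lambda>" "(1 + L) powr p \<le> \<Lambda>"
    unfolding \<Lambda>_def using L p powr_mono[of 6 "6 + p" "1 + L"] powr_mono[of p "6 + p" "1 + L"] by simp_all
  \<comment> \<open>Chosen so that \<open>C * \<Lambda> / K \<le> 1 / 2\<close>, where \<Lambda> is
    the loss in comparing weights at distance \<open>L\<close>.\<close>
  define K where "K = 2 * C * \<Lambda> + 1"
  have K: "0 < K" using C \<Lambda> by (simp add: K_def add_nonneg_pos)
  have step: "\<bar>r t x\<bar> \<le> C * R x powr (-6) + C * (\<mu> * exp (K * t) / K)"
    if t: "0 \<le> t" "t \<le> T" and \<mu>: "0 \<le> \<mu>"
      and m: "\<And>s y. s \<in> {0..t} \<Longrightarrow> norm (y - x) \<le> L \<Longrightarrow> \<bar>r s y\<bar> \<le> \<mu> * exp (K * s)" for t x \<mu>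
  proof (cases "N \<le> R x")
    case True
    have "\<bar>r t x\<bar> \<le> C0 * R x powr (-6) + C0 * (\<mu> * exp (K * t) / K)"
      using True K t \<mu> m by (intro est[rule_format]) auto
    also have "\<dots> \<le> C * R x powr (-6) + C * (\<mu> * exp (K * t) / K)"
      using C \<mu> K by (intro add_mono mult_right_mono) auto
    finally show ?thesis .
  next
    case False
    then have "R x powr 6 \<le> (max N 1) powr 6" by (intro powr_mono2) auto
    then have "1 \<le> (max N 1) powr 6 * R x powr (-6)"
      by (simp add: powr_minus_divide divide_simps)
    then have "B * 1 \<le> B * ((max N 1) powr 6 * R x powr (-6))" using B by (rule mult_left_mono)
    moreover have "B * R x powr (-p) \<le> B * 1" using B p R_powr_minus_le_1 by (intro mult_left_mono) auto
    moreover have "0 \<le> C0 * R x powr (-6)" "0 \<le> C * (\<mu> * exp (K * t) / K)" using C C0 \<mu> K by auto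
    ultimately show ?thesis using bd[OF t, of x] unfolding C_def by (simp add: algebra_simps)
  qed
  define w where "w n x = R x powr (-6) + R x powr (-p) / real (Suc n)" for n x
  have w: "0 < w n x" for n x
    unfolding w_def by (intro add_pos_nonneg) (auto simp: less_le)
  have wL: "w n y \<le> \<Lambda> * w n x" if "norm (y - x) \<le> L" for n x y
  proof -
    have n: "norm (x - y) \<le> L" using that by (simp add: norm_minus_commute)
    have "R y powr (-6) \<le> (1 + L) powr 6 * R x powr (-6)" by (rule R_powr_minus_near[OF n]) simp
    also have "\<dots> \<le> \<Lambda> * R x powr (-6)" using \<Lambda> by (intro mult_right_mono) auto
    finally have 1: "R y powr (-6) \<le> \<Lambda> * R x powr (-6)" .
    have "R y powr (-p) \<le> (1 + L) powr p * R x powr (-p)" by (rule R_powr_minus_near[OF n p])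
    also have "\<dots> \<le> \<Lambda> * R x powr (-p)" using \<Lambda> by (intro mult_right_mono) auto
    finally have "R y powr (-p) / real (Suc n) \<le> \<Lambda> * R x powr (-p) / real (Suc n)"
      by (rule divide_right_mono) simp
    with 1 show ?thesis unfolding w_def by (simp add: algebra_simps)
  qed
  have uniform: "\<bar>r t x\<bar> \<le> 2 * C * exp (K * T) * w n x" if t: "0 \<le> t" "t \<le> T" for t x n
  proof -
    define S where "S = {\<bar>r s y\<bar> / (exp (K * s) * w n y) | s y. s \<in> {0..T}}"
    have le: "\<bar>r s y\<bar> / (exp (K * s) * w n y) \<le> real (Suc n) * B" if s: "s \<in> {0..T}" for s y
    proof -
      have "\<bar>r s y\<bar> \<le> B * R y powr (-p)" using bd s by auto
      also have "\<dots> = (real (Suc n) * B) * (1 * (R y powr (-p) / real (Suc n)))" by simp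
      also have "\<dots> \<le> (real (Suc n) * B) * (exp (K * s) * w n y)"
        using B K s by (intro mult_left_mono mult_mono) (auto simp: w_def)
      finally show ?thesis using w[of n y] by (simp add: divide_le_eq)
    qed
    have bdd: "bdd_above S" unfolding S_def using le by (auto intro!: bdd_aboveI[of _ "real (Suc n) * B"])
    define M where "M = Sup S"
    have M: "\<bar>r s y\<bar> \<le> M * (exp (K * s) * w n y)" if "s \<in> {0..T}" for s y
    proof -
      have "\<bar>r s y\<bar> / (exp (K * s) * w n y) \<le> M"
        unfolding M_def by (rule cSup_upper[OF _ bdd]) (use that in \<open>auto simp: S_def\<close>)
      then show ?thesis using w[of n y] by (simp add: divide_le_eq)
    qed
    have M0: "0 \<le> M"
    proof -
      have "0 \<le> \<bar>r 0 0\<bar>" by simp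
      also have "\<dots> \<le> M * (exp (K * 0) * w n 0)" using T by (intro M) simp
      finally show ?thesis using w[of n 0] by (simp add: zero_le_mult_iff)
    qed
    \<comment> \<open>Each weighted value is estimated through the values that \<open>M\<close>
      bounds. Since \<open>M\<close> is a finite supremum, the half on the right can be
      absorbed.\<close>
    have "M \<le> C + M / 2"
      unfolding M_def
    proof (rule cSup_least)
      have "\<bar>r 0 0\<bar> / (exp (K * 0) * w n 0) \<in> S" unfolding S_def using T by force
      then show "S \<noteq> {}" by blast
      fix q assume "q \<in> S"
      then obtain s y where q: "q = \<bar>r s y\<bar> / (exp (K * s) * w n y)" and s: "s \<in> {0..T}"
        unfolding S_def by blast
      have "\<bar>r s y\<bar> \<le> C * R y powr (-6) + C * ((M * \<Lambda> * w n y) * exp (K * s) / K)"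
      proof (rule step)
        fix s' y' assume s': "s' \<in> {0..s}" and y': "norm (y' - y) \<le> L"
        have "\<bar>r s' y'\<bar> \<le> M * (exp (K * s') * w n y')" using s s' by (intro M) auto
        also have "\<dots> \<le> M * (exp (K * s') * (\<Lambda> * w n y))"
          using M0 wL[OF y'] by (intro mult_left_mono) auto
        finally show "\<bar>r s' y'\<bar> \<le> (M * \<Lambda> * w n y) * exp (K * s')" by (simp add: mult_ac)
      qed (use s M0 \<Lambda> w[of n y] in auto)
      also have "\<dots> \<le> C * (exp (K * s) * w n y) + M / 2 * (exp (K * s) * w n y)"
      proof (rule add_mono)
        have "R y powr (-6) \<le> 1 * w n y" by (simp add: w_def)
        also have "\<dots> \<le> exp (K * s) * w n y" using K s w[of n y] by (intro mult_right_mono) auto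
        finally show "C * R y powr (-6) \<le> C * (exp (K * s) * w n y)" using C by (intro mult_left_mono) auto
        have "C * \<Lambda> / K \<le> 1 / 2" using K by (simp add: K_def divide_simps)
        then have "(C * \<Lambda> / K) * (M * (exp (K * s) * w n y)) \<le> 1 / 2 * (M * (exp (K * s) * w n y))"
          using M0 w[of n y] by (intro mult_right_mono) auto
        then show "C * ((M * \<Lambda> * w n y) * exp (K * s) / K) \<le> M / 2 * (exp (K * s) * w n y)"
          by (simp add: mult_ac)
      qed
      finally show "q \<le> C + Sup S / 2"
        unfolding q M_def[symmetric] using w[of n y] by (simp add: divide_le_eq algebra_simps)
    qed
    then have "M \<le> 2 * C" by simp
    have "\<bar>r t x\<bar> \<le> M * (exp (K * t) * w n x)" using t by (intro M) auto
    also have "\<dots> \<le> 2 * C * (exp (K * T) * w n x)"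
      using \<open>M \<le> 2 * C\<close> C M0 K t w[of n x] by (intro mult_mono) auto
    finally show ?thesis by simp
  qed
  show ?thesis
  proof (intro exI allI impI)
    fix t x assume t: "0 \<le> t" "t \<le> T"
    \<comment> \<open>The bound holds for every \<open>n\<close> with the same constant, so the
      auxiliary part of the weight disappears in the limit.\<close>
    have "(\<lambda>n. 2 * C * exp (K * T) * (R x powr (-6) + R x powr (-p) * (1 / real (Suc n))))
        \<longlonglongrightarrow> 2 * C * exp (K * T) * (R x powr (-6) + R x powr (-p) * 0)"
      by (intro tendsto_intros LIMSEQ_Suc[OF lim_1_over_n])
    then show "\<bar>r t x\<bar> \<le> (2 * C * exp (K * T)) * R x powr (-6)"
      using uniform[OF t, of x] by (intro LIMSEQ_le_const[where a = "\<bar>r t x\<bar>"]) (auto simp: w_def)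
  qed
qed

end

section \<open>The Vlasov-Poisson solution\<close>

lemma background_gradient:
  assumes "background_condition F"
  obtains W g C where "0 < W" "\<And>u. (F has_derivative (\<lambda>h. g u \<bullet> h)) (at u)" "continuous_on UNIV g"
    "\<And>u. W < norm u \<Longrightarrow> F u = 0" "\<And>v d. \<bar>F (v + d) - F v - g v \<bullet> d\<bar> \<le> C * norm d ^ 2"
    "\<And>v w. \<bar>F v - F w\<bar> \<le> C * norm (v - w)"
proof -
  obtain FR W where W: "0 < W" and FR: "\<forall>v. F v = FR (norm v)" "\<forall>u\<ge>W. FR u = 0"
    using assms unfolding background_condition_def by blast
  have zF: "W < norm u \<Longrightarrow> F u = 0" for u using FR by simp
  obtain F' where F': "\<And>z. (F has_derivative blinfun_apply (F' z)) (at z)" and "C1_on F' UNIV"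
    using assms unfolding background_condition_def C2_on_def by auto
  then obtain F'' where F'': "\<And>z. (F' has_derivative blinfun_apply (F'' z)) (at z)" and cF'': "continuous_on UNIV F''"
    unfolding C1_on_def by auto
  have cF': "continuous_on UNIV F'"
    using F'' by (intro continuous_at_imp_continuous_on) (auto intro: has_derivative_continuous)
  \<comment> \<open>Both derivatives inherit the compact support, hence are bounded; this yields the
    global Lipschitz and second-order Taylor bounds.\<close>
  have zF': "F' u = 0" if "W < norm u" for u
    using has_derivative_zero_outside[OF F' zF that] by (intro blinfun_eqI) simp
  have zF'': "F'' u = 0" if "W < norm u" for u
    using has_derivative_zero_outside[OF F'' zF' that] by (intro blinfun_eqI) simp
  obtain C1 where C1: "\<And>u. norm (F' u) \<le> C1" using bounded_compact_support[OF cF' zF'] by blast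
  obtain C2 where C2: "0 < C2" "\<And>u. norm (F'' u) \<le> C2" using bounded_compact_support[OF cF'' zF''] by blast
  define C where "C = max C1 C2"
  define g where "g u = (\<Sum>b\<in>Basis. F' u b *\<^sub>R b)" for u
  have g: "F' u h = g u \<bullet> h" for u h
  proof -
    have "F' u h = F' u (\<Sum>b\<in>Basis. (h \<bullet> b) *\<^sub>R b)" by (simp add: euclidean_representation)
    also have "\<dots> = (\<Sum>b\<in>Basis. F' u b * (b \<bullet> h))"
      unfolding blinfun.sum_right blinfun.scaleR_right by (rule sum.cong) (simp_all add: inner_commute)
    also have "\<dots> = g u \<bullet> h" by (simp add: g_def inner_sum_left)
    finally show ?thesis .
  qed
  show ?thesis
  proof (rule that[OF W, of g C])
    show "(F has_derivative (\<lambda>h. g u \<bullet> h)) (at u)" for u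
    proof -
      have "blinfun_apply (F' u) = (\<lambda>h. g u \<bullet> h)" by (simp add: g fun_eq_iff)
      then show ?thesis using F'[of u] by simp
    qed
    have "continuous_on UNIV (\<lambda>u. F' u b)" for b
      by (rule bounded_linear.continuous_on[OF blinfun.bounded_linear_left cF'])
    then show "continuous_on UNIV g"
      unfolding g_def[abs_def] by (intro continuous_on_sum continuous_on_scaleR continuous_on_const)
    show "F u = 0" if "W < norm u" for u by (rule zF[OF that])
    show "\<bar>F v - F w\<bar> \<le> C * norm (v - w)" for v w
    proof -
      have "norm (F v - F w) \<le> C1 * norm (v - w)"
        by (rule differentiable_bound[of UNIV F "\<lambda>z. blinfun_apply (F' z)"])
          (simp_all add: F' C1[unfolded norm_blinfun.rep_eq])
      also have "\<dots> \<le> C * norm (v - w)" by (intro mult_right_mono) (auto simp: C_def)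
      finally show ?thesis by simp
    qed
    show "\<bar>F (v + d) - F v - g v \<bullet> d\<bar> \<le> C * norm d ^ 2" for v d
    proof -
      have lip: "norm (F' x - F' y) \<le> C2 * norm (x - y)" for x y
        by (rule differentiable_bound[of UNIV F' "\<lambda>z. blinfun_apply (F'' z)"])
          (simp_all add: F'' C2(2)[unfolded norm_blinfun.rep_eq])
      have "norm (F (v + d) - F v - F' v (v + d - v)) \<le> norm (v + d - v) * (C2 * norm d)"
      proof (rule differentiable_bound_linearization[where S = "cball v (norm d)"])
        show "v + t *\<^sub>R (v + d - v) \<in> cball v (norm d)" if "t \<in> {0..1}" for t
          using that by (simp add: dist_norm mult_left_le_one_le)
        show "(F has_derivative blinfun_apply (F' x)) (at x within cball v (norm d))" for x
          by (rule has_derivative_at_withinI[OF F'])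
        show "onorm (blinfun_apply (F' x) - blinfun_apply (F' v)) \<le> C2 * norm d" if "x \<in> cball v (norm d)" for x
        proof -
          have "onorm (blinfun_apply (F' x) - blinfun_apply (F' v)) = norm (F' x - F' v)"
            by (simp add: norm_blinfun.rep_eq minus_blinfun.rep_eq fun_diff_def)
          also have "\<dots> \<le> C2 * norm (x - v)" by (rule lip)
          also have "\<dots> \<le> C2 * norm d" using that C2 by (intro mult_left_mono) (auto simp: dist_norm norm_minus_commute)
          finally show ?thesis .
        qed
      qed simp
      then have "\<bar>F (v + d) - F v - g v \<bullet> d\<bar> \<le> C2 * norm d ^ 2" by (simp add: g power2_eq_square mult_ac)
      also have "\<dots> \<le> C * norm d ^ 2" by (intro mult_right_mono) (auto simp: C_def)
      finally show ?thesis .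
    qed
  qed
qed

lemma has_derivative_slice:
  assumes "(g has_derivative g') (at (t, x) within {0..} \<times> UNIV)" "0 \<le> t"
  shows "((\<lambda>x. g (t, x)) has_derivative (\<lambda>h. g' (0, h))) (at x)"
  by (rule has_derivative_compose_within[where f = "\<lambda>x. (t, x)" and g = g and g' = g' and T = "{0..} \<times> UNIV"])
    (use assms in \<open>auto intro!: derivative_eq_intros\<close>)

text \<open>In the half-weight ball around \<open>x\<close> the bounds on the partial derivatives
  are all comparable to \<open>R x powr (-3)\<close>, and the ball is convex, so the mean value
  inequality gives the increments of \<open>A\<close> directly, without interpolation.\<close>

lemma field_properties:
  assumes "field_condition p A"
  obtains A' C where
    "continuous_on ({0..} \<times> UNIV) A" "\<And>t x. 0 \<le> t \<Longrightarrow> norm (A (t, x)) \<le> C"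
    "\<And>t x. 0 \<le> t \<Longrightarrow> ((\<lambda>x. A (t, x)) has_derivative A' t x) (at x)"
    "\<And>t h. 0 \<le> t \<Longrightarrow> continuous_on UNIV (\<lambda>x. A' t x h)"
    "\<And>t x. 0 \<le> t \<Longrightarrow> (\<Sum>i\<in>UNIV. A' t x (axis i 1) $ i) = 0"
    "\<And>t x y y'. 0 \<le> t \<Longrightarrow> norm (y - x) \<le> R x / 2 \<Longrightarrow> norm (y' - x) \<le> R x / 2 \<Longrightarrow>
       norm (A (t, y) - A (t, y')) \<le> C * R x powr (-3) * norm (y - y')"
    "0 \<le> C"
proof -
  note fc = assms[unfolded field_condition_def]
  obtain DA where DA: "\<And>z. z \<in> {0..} \<times> UNIV \<Longrightarrow> (A has_derivative blinfun_apply (DA z)) (at z within {0..} \<times> UNIV)"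
    and cDA: "continuous_on ({0..} \<times> UNIV) DA"
    using fc[THEN conjunct1] unfolding C1_on_def by blast
  obtain C0 where C0: "C0 > 0" "\<And>t x. 0 \<le> t \<Longrightarrow> norm (A (t, x)) \<le> C0 * R x powr (-2)"
    using fc[THEN conjunct2, THEN conjunct1] by blast
  obtain C1 where C1: "C1 > 0" "\<And>t x i. 0 \<le> t \<Longrightarrow> norm (partial_deriv i (\<lambda>y. A (t, y)) x) \<le> C1 * R x powr (-3)"
    using fc[THEN conjunct2, THEN conjunct2, THEN conjunct1] by blast
  have div: "\<And>t x. 0 \<le> t \<Longrightarrow> divergence (\<lambda>y. A (t, y)) x = 0"
    using fc[THEN conjunct2, THEN conjunct2, THEN conjunct2, THEN conjunct1] by blast
  define A' where "A' t x h = DA (t, x) (0, h)" for t x h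
  have A': "((\<lambda>x. A (t, x)) has_derivative A' t x) (at x)" if "0 \<le> t" for t x
    unfolding A'_def[abs_def] by (rule has_derivative_slice[OF DA that]) (use that in auto)
  \<comment> \<open>24 is 3 partial derivatives times the factor 8 for comparing
    \<open>R z powr (-3)\<close> with \<open>R x powr (-3)\<close> in the half-weight ball.\<close>
  define C where "C = max C0 (24 * C1)"
  show ?thesis
  proof (rule that[of C A'])
    show "continuous_on ({0..} \<times> UNIV) A"
      using DA by (auto simp: continuous_on_eq_continuous_within intro: has_derivative_continuous)
    show "norm (A (t, x)) \<le> C" if "0 \<le> t" for t x
    proof -
      have "norm (A (t, x)) \<le> C0 * R x powr (-2)" by (rule C0(2)[OF that])
      also have "\<dots> \<le> C0 * 1" using C0(1) by (intro mult_left_mono R_powr_minus_le_1) auto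
      finally show ?thesis by (simp add: C_def)
    qed
    show "((\<lambda>x. A (t, x)) has_derivative A' t x) (at x)" if "0 \<le> t" for t x by (rule A'[OF that])
    show "continuous_on UNIV (\<lambda>x. A' t x h)" if "0 \<le> t" for t h
    proof -
      have "continuous_on UNIV (\<lambda>x. DA (t, x))"
        by (rule continuous_on_compose2[OF cDA]) (use that in \<open>auto intro!: continuous_intros\<close>)
      then show ?thesis unfolding A'_def by (rule bounded_linear.continuous_on[OF blinfun.bounded_linear_left])
    qed
    show "(\<Sum>i\<in>UNIV. A' t x (axis i 1) $ i) = 0" if "0 \<le> t" for t x
    proof -
      have "partial_deriv i (\<lambda>y. A (t, y) $ i) x = A' t x (axis i 1) $ i" for i
        by (rule partial_deriv_eq[OF bounded_linear.has_derivative[OF bounded_linear_vec_nth A'[OF that]]])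
      then show ?thesis using div[OF that, of x] by (simp add: divergence_def)
    qed
    show "norm (A (t, y) - A (t, y')) \<le> C * R x powr (-3) * norm (y - y')"
      if t: "0 \<le> t" and y: "norm (y - x) \<le> R x / 2" "norm (y' - x) \<le> R x / 2" for t x y y'
    proof -
      have "norm (A (t, y) - A (t, y')) \<le> (24 * C1 * R x powr (-3)) * norm (y - y')"
      proof (rule differentiable_bound[where S = "cball x (R x / 2)" and f = "\<lambda>y. A (t, y)" and f' = "A' t"])
        fix z assume z: "z \<in> cball x (R x / 2)"
        show "((\<lambda>y. A (t, y)) has_derivative A' t z) (at z within cball x (R x / 2))"
          by (rule has_derivative_at_withinI[OF A'[OF t]])
        have lin: "linear (A' t z)" by (rule has_derivative_linear[OF A'[OF t]])
        have "R z powr (-3) \<le> 2 powr 3 * R x powr (-3)"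
          by (rule R_powr_minus_half) (use z in \<open>auto simp: dist_norm\<close>)
        then have Rz: "C1 * R z powr (-3) \<le> 8 * C1 * R x powr (-3)" using C1(1) by simp
        show "onorm (A' t z) \<le> 24 * C1 * R x powr (-3)"
        proof (rule onorm_le)
          fix h
          have "A' t z h = A' t z (\<Sum>i\<in>UNIV. h $ i *\<^sub>R axis i 1)"
            using basis_expansion[of h] by (simp add: scalar_mult_eq_scaleR)
          also have "\<dots> = (\<Sum>i\<in>UNIV. h $ i *\<^sub>R A' t z (axis i 1))"
            by (simp add: linear_sum[OF lin] linear_cmul[OF lin])
          also have "norm \<dots> \<le> (\<Sum>i\<in>(UNIV::3 set). norm h * (8 * C1 * R x powr (-3)))"
          proof (rule sum_norm_le)
            fix i
            have "norm (A' t z (axis i 1)) \<le> C1 * R z powr (-3)"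
              using C1(2)[OF t, of i z] by (simp add: partial_deriv_eq[OF A'[OF t]])
            then show "norm (h $ i *\<^sub>R A' t z (axis i 1)) \<le> norm h * (8 * C1 * R x powr (-3))"
              unfolding norm_scaleR using Rz component_le_norm_cart[of h i] by (intro mult_mono) auto
          qed
          also have "\<dots> = 24 * C1 * R x powr (-3) * norm h" by simp
          finally show "norm (A' t z h) \<le> 24 * C1 * R x powr (-3) * norm h" .
        qed
      qed (use y in \<open>auto simp: dist_norm norm_minus_commute\<close>)
      also have "\<dots> \<le> C * R x powr (-3) * norm (y - y')"
        by (intro mult_right_mono) (auto simp: C_def)
      finally show ?thesis .
    qed
    show "0 \<le> C" using C0 by (simp add: C_def)
  qed
qed

text \<open>The exponent \<open>\<theta> = (7 - p) / 4\<close> satisfies \<open>-3 \<theta> + (1 - \<theta> - p) = -6\<close>: a displacement of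
  size \<open>R x powr (-3)\<close> changes the field by \<open>R x powr (-6)\<close>.\<close>

lemma coulomb_field_diff_near:
  assumes p: "3 < p" "p < 4"
  obtains K where "0 \<le> K"
    "\<And>r B x y L. r \<in> borel_measurable borel \<Longrightarrow> (\<And>y. \<bar>r y\<bar> \<le> B * R y powr (-p)) \<Longrightarrow>
        norm (y - x) \<le> L \<Longrightarrow> 4 * L \<le> R x \<Longrightarrow>
        norm ((\<integral>z. r z *\<^sub>R coulomb (y - z) \<partial>lborel) - (\<integral>z. r z *\<^sub>R coulomb (x - z) \<partial>lborel))
          \<le> B * K * (L + 1) * R x powr (-3)"
    "\<And>r B x y y' L D. r \<in> borel_measurable borel \<Longrightarrow> (\<And>y. \<bar>r y\<bar> \<le> B * R y powr (-p)) \<Longrightarrow>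
        norm (y - x) \<le> L \<Longrightarrow> norm (y - y') \<le> D * R x powr (-3) \<Longrightarrow> 0 \<le> D \<Longrightarrow> 2 * L \<le> R x \<Longrightarrow> 8 * D \<le> R x \<Longrightarrow>
        norm ((\<integral>z. r z *\<^sub>R coulomb (y - z) \<partial>lborel) - (\<integral>z. r z *\<^sub>R coulomb (y' - z) \<partial>lborel))
          \<le> B * K * (D + 1) * R x powr (-6)"
proof -
  define \<theta> where "\<theta> = (7 - p) / 4"
  \<comment> \<open>The requirement \<theta> < 1 is exactly \<open>p > 3\<close>, which also gives
    \<open>1 - \<theta> - p \<le> -3\<close>, the bound used for displacements of bounded
    size.\<close>
  have \<theta>: "0 < \<theta>" "\<theta> < 1" "1 - \<theta> - p \<le> -3" "(-3) * \<theta> + (1 - \<theta> - p) = -6" "0 \<le> p + \<theta> - 1"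
    using p by (auto simp: \<theta>_def field_simps)
  have powr_le: "d powr \<theta> \<le> d + 1" if "0 \<le> d" for d
  proof (cases "d \<le> 1")
    case True
    then have "d powr \<theta> \<le> 1 powr \<theta>" using that \<theta> by (intro powr_mono2) auto
    then show ?thesis using that by simp
  next
    case False
    then have "d powr \<theta> \<le> d powr 1" using \<theta> by (intro powr_mono) auto
    then show ?thesis using that by simp
  qed
  obtain C where C: "0 < C" and diff: "\<And>r B x y. r \<in> borel_measurable borel \<Longrightarrow> (\<And>y. \<bar>r y\<bar> \<le> B * R y powr (-p)) \<Longrightarrow>
        norm (x - y) \<le> R x / 4 \<Longrightarrow>
        norm ((\<integral>z. r z *\<^sub>R coulomb (x - z) \<partial>lborel) - (\<integral>z. r z *\<^sub>R coulomb (y - z) \<partial>lborel))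
        \<le> B * C * (norm (x - y) * R x powr (-3) + norm (x - y) powr \<theta> * R x powr (1 - \<theta> - p))"
    by (rule coulomb_field_diff[OF p(1), of \<theta>]) (use \<theta> in auto)
  \<comment> \<open>Losses in replacing \<open>R y\<close> by \<open>R x\<close> for the two powers
    that occur, as \<open>y\<close> stays in the half-weight ball around \<open>x\<close>.\<close>
  define c where "c = 2 powr 3 + 2 powr (p + \<theta> - 1)"
  have c: "0 \<le> c" "2 \<le> c" by (auto simp: c_def intro: add_increasing2)
  have B: "0 \<le> B" if "\<And>y. \<bar>r y\<bar> \<le> B * R y powr (-p)" for r B
  proof -
    have "0 \<le> \<bar>r 0\<bar>" by simp
    also have "\<dots> \<le> B * R 0 powr (-p)" by (rule that)
    finally show ?thesis by (simp add: zero_le_mult_iff)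
  qed
  show ?thesis
  proof (rule that[of "C * c"])
    show "0 \<le> C * c" using C c by simp
  next
    fix r B x y L
    assume r: "r \<in> borel_measurable borel" "\<And>y. \<bar>r y\<bar> \<le> B * R y powr (-p)"
      and L: "norm (y - x) \<le> L" "4 * L \<le> R x"
    define d where "d = norm (x - y)"
    have d: "0 \<le> d" "d \<le> L" using L by (auto simp: d_def norm_minus_commute)
    have "norm ((\<integral>z. r z *\<^sub>R coulomb (x - z) \<partial>lborel) - (\<integral>z. r z *\<^sub>R coulomb (y - z) \<partial>lborel))
        \<le> B * C * (d * R x powr (-3) + d powr \<theta> * R x powr (1 - \<theta> - p))"
      unfolding d_def by (rule diff[OF r]) (use L in \<open>simp add: norm_minus_commute\<close>)
    also have "\<dots> \<le> B * C * (L * R x powr (-3) + (L + 1) * R x powr (-3))"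
    proof (intro mult_left_mono add_mono mult_mono)
      show "d powr \<theta> \<le> L + 1" using powr_le[OF d(1)] d by simp
      show "R x powr (1 - \<theta> - p) \<le> R x powr (-3)" using \<theta> R_ge_1[of x] by (intro powr_mono) auto
    qed (use d C B[OF r(2)] in auto)
    also have "\<dots> \<le> B * C * (c * (L + 1) * R x powr (-3))"
    proof (rule mult_left_mono)
      have "2 * (L + 1) * R x powr (-3) \<le> c * (L + 1) * R x powr (-3)"
        using c d by (intro mult_right_mono) auto
      moreover have "L * R x powr (-3) + (L + 1) * R x powr (-3) \<le> 2 * (L + 1) * R x powr (-3)"
        by (simp add: algebra_simps)
      ultimately show "L * R x powr (-3) + (L + 1) * R x powr (-3) \<le> c * (L + 1) * R x powr (-3)" by linarith
    qed (use C B[OF r(2)] in auto)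
    finally show "norm ((\<integral>z. r z *\<^sub>R coulomb (y - z) \<partial>lborel) - (\<integral>z. r z *\<^sub>R coulomb (x - z) \<partial>lborel))
          \<le> B * (C * c) * (L + 1) * R x powr (-3)"
      by (simp add: norm_minus_commute mult_ac)
  next
    fix r B x y y' L D
    assume r: "r \<in> borel_measurable borel" "\<And>y. \<bar>r y\<bar> \<le> B * R y powr (-p)"
      and L: "norm (y - x) \<le> L" "2 * L \<le> R x" and D: "norm (y - y') \<le> D * R x powr (-3)" "0 \<le> D" "8 * D \<le> R x"
    define d where "d = norm (y - y')"
    have d: "0 \<le> d" "d \<le> D * R x powr (-3)" using D by (auto simp: d_def)
    have xy: "norm (x - y) \<le> R x / 2" using L by (simp add: norm_minus_commute)
    have "D * R x powr (-3) \<le> D * 1" using D by (intro mult_left_mono R_powr_minus_le_1) auto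
    then have "norm (y - y') \<le> R x / 8" using D by simp
    moreover have "R x / 2 \<le> R y" using R_triangle[of x y] xy by simp
    ultimately have "norm (y - y') \<le> R y / 4" by simp
    then have "norm ((\<integral>z. r z *\<^sub>R coulomb (y - z) \<partial>lborel) - (\<integral>z. r z *\<^sub>R coulomb (y' - z) \<partial>lborel))
        \<le> B * C * (d * R y powr (-3) + d powr \<theta> * R y powr (1 - \<theta> - p))"
      unfolding d_def by (rule diff[OF r])
    also have "\<dots> \<le> B * C * ((D * R x powr (-3)) * (2 powr 3 * R x powr (-3))
        + ((D + 1) * R x powr (-3 * \<theta>)) * (2 powr (p + \<theta> - 1) * R x powr (1 - \<theta> - p)))"
    proof (intro mult_left_mono add_mono mult_mono)
      show "R y powr (-3) \<le> 2 powr 3 * R x powr (-3)" by (rule R_powr_minus_half[OF xy]) simp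
      show "R y powr (1 - \<theta> - p) \<le> 2 powr (p + \<theta> - 1) * R x powr (1 - \<theta> - p)"
        using R_powr_minus_half[OF xy \<theta>(5)] by (simp add: algebra_simps)
      have "d powr \<theta> \<le> (D * R x powr (-3)) powr \<theta>" using d \<theta> by (intro powr_mono2) auto
      also have "\<dots> = D powr \<theta> * R x powr (-3 * \<theta>)" using D by (simp add: powr_mult powr_powr)
      also have "\<dots> \<le> (D + 1) * R x powr (-3 * \<theta>)" using D powr_le by (intro mult_right_mono) auto
      finally show "d powr \<theta> \<le> (D + 1) * R x powr (-3 * \<theta>)" .
    qed (use d D C B[OF r(2)] in auto)
    also have "\<dots> = B * C * (2 powr 3 * D * (R x powr (-3) * R x powr (-3))
        + 2 powr (p + \<theta> - 1) * (D + 1) * (R x powr (-3 * \<theta>) * R x powr (1 - \<theta> - p)))"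
      by (simp only: mult_ac)
    also have "R x powr (-3) * R x powr (-3) = R x powr (-6)" by (simp add: powr_add[symmetric])
    also have "R x powr (-3 * \<theta>) * R x powr (1 - \<theta> - p) = R x powr (-6)"
      unfolding powr_add[symmetric] \<theta>(4) ..
    also have "B * C * (2 powr 3 * D * R x powr (-6) + 2 powr (p + \<theta> - 1) * (D + 1) * R x powr (-6))
       \<le> B * C * (2 powr 3 * (D + 1) * R x powr (-6) + 2 powr (p + \<theta> - 1) * (D + 1) * R x powr (-6))"
      using C B[OF r(2)] by (intro mult_left_mono add_mono mult_right_mono) auto
    finally show "norm ((\<integral>z. r z *\<^sub>R coulomb (y - z) \<partial>lborel) - (\<integral>z. r z *\<^sub>R coulomb (y' - z) \<partial>lborel))
          \<le> B * (C * c) * (D + 1) * R x powr (-6)"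
      by (simp add: c_def algebra_simps)
  qed
qed

section \<open>Measurability, velocity support and verification of the bounds\<close>

lemma wnorm_le_iff: "wnorm q h \<le> ereal B \<longleftrightarrow> (\<forall>x. \<bar>h x\<bar> \<le> B * R x powr (-q))"
proof -
  have "\<bar>h x\<bar> * R x powr q \<le> B \<longleftrightarrow> \<bar>h x\<bar> \<le> B * R x powr (-q)" for x
  proof -
    have "0 < R x powr q" by (simp add: less_le)
    then show ?thesis by (simp add: powr_minus_divide pos_le_divide_eq)
  qed
  then show ?thesis by (simp add: wnorm_def SUP_le_iff)
qed

lemma continuous_on_C1_on: "C1_on h S \<Longrightarrow> continuous_on S h"
  unfolding C1_on_def continuous_on_eq_continuous_within by (blast intro: has_derivative_continuous)

lemma efield_eq_coulomb: "efield F f t x = (\<integral>y. rho F f t y *\<^sub>R coulomb (x - y) \<partial>lborel)"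
  by (simp add: efield_def coulomb_def)

text \<open>Joint continuity of the integrand suffices, with no knowledge of the velocity support.
  This avoids a circle: bounding the field needs a measurable density, the velocity support needs
  the field bound, and continuity of the density is deduced from the support.\<close>

lemma borel_measurable_rho:
  assumes F: "continuous_on UNIV F" and f: "continuous_on ({0..} \<times> UNIV) f" and t: "0 \<le> t"
  shows "rho F f t \<in> borel_measurable borel"
proof -
  have "continuous_on UNIV (\<lambda>z. F (snd z) - f (t, fst z, snd z))"
    by (intro continuous_intros continuous_on_compose2[OF F] continuous_on_compose2[OF f]) (use t in auto)
  then have "(\<lambda>z. F (snd (fst z, snd z)) - f (t, fst (fst z, snd z), snd (fst z, snd z))) \<in> borel_measurable (borel \<Otimes>\<^sub>M lborel)"
    by (rule borel_measurable_continuous_on) measurable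
  then have "(\<lambda>(x, v). F v - f (t, x, v)) \<in> borel_measurable (borel \<Otimes>\<^sub>M lborel)"
    by (simp add: split_def)
  then show ?thesis
    unfolding rho_def[abs_def] by (rule lborel.borel_measurable_lebesgue_integral)
qed

text \<open>A bounded field moves velocities by at most \<open>CG * T\<close>, so a large final
  velocity traces back to initial velocities outside the support. The maximum principle gives
  \<open>f \<le> 0\<close>, and nonnegativity does the rest.\<close>

lemma velocity_support:
  fixes f :: "real \<times> (real^3) \<times> (real^3) \<Rightarrow> real"
  assumes df: "\<And>s y w. 0 \<le> s \<Longrightarrow> (f has_derivative f' (s, y, w)) (at (s, y, w) within {0..} \<times> UNIV)"
    and transport: "\<And>s y w. 0 \<le> s \<Longrightarrow> s \<le> T \<Longrightarrow> f' (s, y, w) (1, w, - G s y) = 0"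
    and G: "\<And>s y. 0 \<le> s \<Longrightarrow> s \<le> T \<Longrightarrow> norm (G s y) \<le> CG"
    and init: "\<And>y w. Q < norm w \<Longrightarrow> f (0, y, w) = 0" and nonneg: "\<And>s y w. 0 \<le> s \<Longrightarrow> 0 \<le> f (s, y, w)"
    and t: "0 \<le> t" "t \<le> T" and v: "Q + (CG + 1) * T < norm v"
  shows "f (t, x, v) = 0"
proof (cases "t = 0")
  case True
  have "0 \<le> CG" using G[of 0 0] t norm_ge_zero[of "G 0 0"] by linarith
  then have "0 \<le> (CG + 1) * T" using t by simp
  then show ?thesis using init v True by simp
next
  case False
  have CG: "0 \<le> CG" using G[of 0 0] t norm_ge_zero[of "G 0 0"] by linarith
  have "f (t, x - (t - t) *\<^sub>R v, v) \<le> 0"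
  \<comment> \<open>The tube follows free motion, with \<Gamma> equal to 0. The position rate merely
    has to exceed every \<open>norm (w - v)\<close> in the tube, since the initial condition is
    uniform in position.\<close>
  proof (rule tube_principle[where f' = f' and G = G and Y = "\<lambda>s. x - (t - s) *\<^sub>R v" and U = "\<lambda>s. v"
        and P = "\<lambda>s. v" and \<Gamma> = "\<lambda>s. 0" and a = "(CG + 1) * T + 1" and b = "CG + 1"])
    show "((\<lambda>s. x - (t - s) *\<^sub>R v) has_vector_derivative v) (at s within {0..t})" for s
      by (auto intro!: derivative_eq_intros)
    have le: "(CG + 1) * (t - s) \<le> (CG + 1) * T" if "0 \<le> s" for s
      using that t CG by (intro mult_left_mono) auto
    show "norm (w - v) < (CG + 1) * T + 1 \<and> norm (G s y - 0) < CG + 1"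
      if "0 < s" "s \<le> t" "norm (w - v) \<le> (CG + 1) * (t - s)" for s y w
      using that le[of s] G[of s y] t by simp
    show "f (0, y, w) \<le> 0" if "norm (w - v) \<le> (CG + 1) * t" for y w
    proof -
      have "norm v \<le> norm w + norm (w - v)" using norm_triangle_sub[of v w] by (simp add: norm_minus_commute)
      then have "Q < norm w" using that le[of 0] v by simp
      then show ?thesis using init by simp
    qed
  qed (use df transport t False in auto)
  then show ?thesis using nonneg[OF t(1), of x v] by simp
qed

lemma solution_vlasov_bounds:
  assumes p: "3 < p" "p < 4" and F: "background_condition F" and A: "field_condition p A"
    and pert: "perturbation_condition F f0" and T: "0 < T" and sol: "global_VP_solution p F f0 A f"
  shows "\<exists>W Q CF CG g f' B. vlasov_bounds T W Q CF CG F g f f' (\<lambda>s y. efield F f s y + A (s, y)) (rho F f) \<and>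
    (\<forall>s y. 0 \<le> s \<longrightarrow> s \<le> T \<longrightarrow> \<bar>rho F f s y\<bar> \<le> B * R y powr (-p))"
proof -
  have VP: "VP_solution F f0 A f" and f_nonneg: "\<And>t x v. 0 \<le> t \<Longrightarrow> 0 \<le> f (t, x, v)"
    using sol unfolding global_VP_solution_def by blast+
  obtain B where "\<forall>s\<in>{0..T}. wnorm p (rho F f s) \<le> ereal B"
    using sol T unfolding global_VP_solution_def by blast
  then have B: "\<bar>rho F f s y\<bar> \<le> B * R y powr (-p)" if "0 \<le> s" "s \<le> T" for s y
    using that by (simp add: wnorm_le_iff)
  have C1f: "C1_on f ({0..} \<times> UNIV)" and f0: "\<And>x v. f (0, x, v) = f0 (x, v)"
    and pde: "\<And>t x v. 0 \<le> t \<Longrightarrow> vector_derivative (\<lambda>s. f (s, x, v)) (at t within {0..})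
          + v \<bullet> grad (\<lambda>y. f (t, y, v)) x
          - (efield F f t x + A (t, x)) \<bullet> grad (\<lambda>w. f (t, x, w)) v = 0"
    using VP unfolding VP_solution_def by blast+
  obtain f' where f': "\<And>z. z \<in> {0..} \<times> UNIV \<Longrightarrow> (f has_derivative blinfun_apply (f' z)) (at z within {0..} \<times> UNIV)"
    using C1f unfolding C1_on_def by blast
  have df: "(f has_derivative blinfun_apply (f' (s, y, w))) (at (s, y, w) within {0..} \<times> UNIV)" if "0 \<le> s" for s y w
    using that by (intro f') auto
  have cf: "continuous_on ({0..} \<times> UNIV) f" by (rule continuous_on_C1_on[OF C1f])
  have transport: "blinfun_apply (f' (s, y, w)) (1, w, - (efield F f s y + A (s, y))) = 0" if "0 \<le> s" for s y w
    by (rule transport_derivative[OF df[OF that] that pde[OF that]])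
  obtain W g CF where W: "0 < W" and dF: "\<And>u. (F has_derivative (\<lambda>h. g u \<bullet> h)) (at u)" and cg: "continuous_on UNIV g"
    and zF: "\<And>u. W < norm u \<Longrightarrow> F u = 0" and taylor: "\<And>v d. \<bar>F (v + d) - F v - g v \<bullet> d\<bar> \<le> CF * norm d ^ 2"
    and lipF: "\<And>v w. \<bar>F v - F w\<bar> \<le> CF * norm (v - w)"
    by (rule background_gradient[OF F]) blast
  have F0: "0 \<le> F u" for u using F unfolding background_condition_def by blast
  have cF: "continuous_on UNIV F"
    using dF by (intro continuous_at_imp_continuous_on) (auto intro: has_derivative_continuous)
  obtain A' CA where cA: "continuous_on ({0..} \<times> UNIV) A" and CA: "\<And>t x. 0 \<le> t \<Longrightarrow> norm (A (t, x)) \<le> CA"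
    and A': "\<And>t x. 0 \<le> t \<Longrightarrow> ((\<lambda>x. A (t, x)) has_derivative A' t x) (at x)"
    and cA': "\<And>t h. 0 \<le> t \<Longrightarrow> continuous_on UNIV (\<lambda>x. A' t x h)"
    and divA: "\<And>t x. 0 \<le> t \<Longrightarrow> (\<Sum>i\<in>UNIV. A' t x (axis i 1) $ i) = 0"
    and lipA: "\<And>t x y y'. 0 \<le> t \<Longrightarrow> norm (y - x) \<le> R x / 2 \<Longrightarrow> norm (y' - x) \<le> R x / 2 \<Longrightarrow>
       norm (A (t, y) - A (t, y')) \<le> CA * R x powr (-3) * norm (y - y')" and CA0: "0 \<le> CA"
    by (rule field_properties[OF A]) blast
  have meas: "rho F f s \<in> borel_measurable borel" if "0 \<le> s" for s
    by (rule borel_measurable_rho[OF cF cf that])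
  obtain CE where CE: "0 < CE" "\<And>r B x. r \<in> borel_measurable borel \<Longrightarrow> (\<And>y. \<bar>r y\<bar> \<le> B * R y powr (-p)) \<Longrightarrow>
        integrable lborel (\<lambda>y. r y *\<^sub>R coulomb (x - y)) \<and>
        (\<integral>y. norm (r y *\<^sub>R coulomb (x - y)) \<partial>lborel) \<le> B * CE * R x powr (-2)"
    by (rule coulomb_field_bound[OF p(1)]) blast
  have "0 \<le> \<bar>rho F f 0 0\<bar>" by simp
  also have "\<dots> \<le> B * R 0 powr (-p)" using T by (intro B) auto
  finally have B0: "0 \<le> B" by (simp add: zero_le_mult_iff)
  define CG where "CG = B * CE + CA"
  have CG: "norm (efield F f s y + A (s, y)) \<le> CG" if s: "0 \<le> s" "s \<le> T" for s y
  proof -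
    have "norm (efield F f s y) \<le> (\<integral>z. norm (rho F f s z *\<^sub>R coulomb (y - z)) \<partial>lborel)"
      unfolding efield_eq_coulomb by (rule integral_norm_bound)
    also have "\<dots> \<le> B * CE * R y powr (-2)" using CE(2)[OF meas B] s by blast
    also have "\<dots> \<le> B * CE * 1" using B0 CE by (intro mult_left_mono R_powr_minus_le_1) auto
    finally have "norm (efield F f s y) \<le> B * CE" by simp
    then show ?thesis using CA[OF s(1), of y] norm_triangle_ineq[of "efield F f s y" "A (s, y)"] unfolding CG_def by linarith
  qed
  obtain V where V: "bounded V" "\<And>x v. v \<notin> V \<Longrightarrow> F v - f0 (x, v) = 0"
    using pert unfolding perturbation_condition_def by blast
  obtain b where b: "\<And>v. v \<in> V \<Longrightarrow> norm v \<le> b" using V(1) unfolding bounded_iff by blast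
  \<comment> \<open>Beyond \<open>max W b\<close> the initial datum equals \<open>F\<close>, which
    is 0 there; the remaining term is the spread of velocities up to time \<open>T\<close>.\<close>
  define Q where "Q = max W b + (CG + 1) * T"
  have supp: "f (s, y, w) = 0" if "0 \<le> s" "s \<le> T" "Q < norm w" for s y w
  proof (rule velocity_support[OF df transport CG, where Q = "max W b" and T = T])
    show "f (0, y, w) = 0" if "max W b < norm w" for y w
      using that V(2)[of w y] b[of w] zF[of w] f0[of y w] by fastforce
  qed (use that f_nonneg in \<open>auto simp: Q_def\<close>)
  define M where "M = max W Q"
  obtain c where c: "cball 0 M \<subseteq> cbox (- c) (c :: real^3)"
    using bounded_subset_cbox_symmetric[OF bounded_cball] by blast
  \<comment> \<open>One box serves all times up to \<open>T\<close> and all positions, so continuity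
    of the density follows from continuity of integrals in parameters.\<close>
  have rho_cbox: "rho F f s x = integral (cbox (- c) c) (\<lambda>v. F v - f (s, x, v))" if s: "0 \<le> s" "s \<le> T" for s x
    unfolding rho_def
  proof (rule lborel_integral_eq_integral_cbox[OF _ _ c])
    show "continuous_on UNIV (\<lambda>v. F v - f (s, x, v))"
      by (intro continuous_intros cF continuous_on_compose2[OF cf]) (use s in auto)
    show "F u - f (s, x, u) = 0" if "M < norm u" for u
      using that supp[OF s, of u x] zF[of u] by (simp add: M_def)
  qed
  have "continuous_on ({0..T} \<times> UNIV) (\<lambda>z. integral (cbox (- c) c) (\<lambda>v. F v - f (fst z, snd z, v)))"
  proof (rule integral_continuous_on_param)
    show "continuous_on (({0..T} \<times> UNIV) \<times> cbox (- c) c) (\<lambda>(z, v). F v - f (fst z, snd z, v))"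
      unfolding split_def
      by (intro continuous_intros continuous_on_compose2[OF cF] continuous_on_compose2[OF cf]) auto
  qed
  then have crho: "continuous_on ({0..T} \<times> UNIV) (\<lambda>z. rho F f (fst z) (snd z))"
    by (rule continuous_on_eq) (auto simp: rho_cbox)
  have cE: "continuous_on ({0..T} \<times> UNIV) (\<lambda>(s, x). efield F f s x)"
    using continuous_on_coulomb_field[OF p(1) crho, of B] B unfolding efield_eq_coulomb by simp
  have cE1: "continuous_on UNIV (efield F f s)" if "0 \<le> s" "s \<le> T" for s
  proof -
    have "continuous_on UNIV (\<lambda>x. case (s, x) of (s, x) \<Rightarrow> efield F f s x)"
      by (rule continuous_on_compose2[OF cE]) (use that in \<open>auto intro!: continuous_on_Pair\<close>)
    then show ?thesis by simp
  qed
  have cA1: "continuous_on UNIV (\<lambda>x. A (s, x))" if "0 \<le> s" for s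
    by (rule continuous_on_compose2[OF cA]) (use that in \<open>auto intro!: continuous_intros\<close>)
  obtain K where K: "0 \<le> K"
    and near1: "\<And>r B x y L. r \<in> borel_measurable borel \<Longrightarrow> (\<And>y. \<bar>r y\<bar> \<le> B * R y powr (-p)) \<Longrightarrow>
        norm (y - x) \<le> L \<Longrightarrow> 4 * L \<le> R x \<Longrightarrow>
        norm ((\<integral>z. r z *\<^sub>R coulomb (y - z) \<partial>lborel) - (\<integral>z. r z *\<^sub>R coulomb (x - z) \<partial>lborel))
          \<le> B * K * (L + 1) * R x powr (-3)"
    and near2: "\<And>r B x y y' L D. r \<in> borel_measurable borel \<Longrightarrow> (\<And>y. \<bar>r y\<bar> \<le> B * R y powr (-p)) \<Longrightarrow>
        norm (y - x) \<le> L \<Longrightarrow> norm (y - y') \<le> D * R x powr (-3) \<Longrightarrow> 0 \<le> D \<Longrightarrow> 2 * L \<le> R x \<Longrightarrow> 8 * D \<le> R x \<Longrightarrow>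
        norm ((\<integral>z. r z *\<^sub>R coulomb (y - z) \<partial>lborel) - (\<integral>z. r z *\<^sub>R coulomb (y' - z) \<partial>lborel))
          \<le> B * K * (D + 1) * R x powr (-6)"
    by (rule coulomb_field_diff_near[OF p]) blast
  have "vlasov_bounds T W Q CF CG F g f (\<lambda>z. blinfun_apply (f' z)) (\<lambda>s y. efield F f s y + A (s, y)) (rho F f)"
  proof
    show "\<exists>C N. \<forall>y w. N < norm y \<longrightarrow> \<bar>f (0, y, w) - F w\<bar> \<le> C * R y powr (-6)"
      using pert unfolding perturbation_condition_def f0 by (metis abs_minus_commute)
    show "continuous_on ({0..T} \<times> UNIV) (\<lambda>(s, y). efield F f s y + A (s, y))"
    proof -
      have "continuous_on ({0..T} \<times> UNIV) (\<lambda>z. (case z of (s, y) \<Rightarrow> efield F f s y) + A z)"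
        by (intro continuous_on_add cE continuous_on_subset[OF cA]) auto
      then show ?thesis by (simp add: split_def)
    qed
    show "\<exists>C N. \<forall>s\<in>{0..T}. \<forall>x y. N \<le> R x \<longrightarrow> norm (y - x) \<le> L \<longrightarrow>
        norm (efield F f s y + A (s, y) - (efield F f s x + A (s, x))) \<le> C * R x powr (-3)" if L: "0 \<le> L" for L
    proof (intro exI ballI allI impI)
      \<comment> \<open>The witnesses are still schematic: this assumption sets \<open>N\<close> to
        \<open>4 * L\<close>, and the final \<open>show\<close> sets \<open>C\<close>.\<close>
      fix s x y assume s: "s \<in> {0..T}" and x: "4 * L \<le> R x" and y: "norm (y - x) \<le> L"
      have 1: "norm (efield F f s y - efield F f s x) \<le> B * K * (L + 1) * R x powr (-3)"
        unfolding efield_eq_coulomb by (rule near1[OF meas B y x]) (use s in auto)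
      have "norm (A (s, y) - A (s, x)) \<le> CA * R x powr (-3) * norm (y - x)"
        using s x y L by (intro lipA) auto
      also have "\<dots> \<le> CA * R x powr (-3) * L" using CA0 y by (intro mult_left_mono) auto
      finally have 2: "norm (A (s, y) - A (s, x)) \<le> CA * L * R x powr (-3)" by (simp add: mult_ac)
      have e: "efield F f s y + A (s, y) - (efield F f s x + A (s, x)) = (efield F f s y - efield F f s x) + (A (s, y) - A (s, x))"
        by simp
      show "norm (efield F f s y + A (s, y) - (efield F f s x + A (s, x))) \<le> (B * K * (L + 1) + CA * L) * R x powr (-3)"
        unfolding e using norm_triangle_ineq[of "efield F f s y - efield F f s x" "A (s, y) - A (s, x)"] 1 2
        unfolding distrib_right by linarith
    qed
    show "\<exists>C N. \<forall>s\<in>{0..T}. \<forall>x y y'. N \<le> R x \<longrightarrow> norm (y - x) \<le> L \<longrightarrow> norm (y' - x) \<le> L \<longrightarrow> norm (y - y') \<le> D * R x powr (-3) \<longrightarrow>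
        norm (efield F f s y + A (s, y) - (efield F f s y' + A (s, y'))) \<le> C * R x powr (-6)" if L: "0 \<le> L" "0 \<le> D" for L D
    proof (intro exI ballI allI impI)
      \<comment> \<open>A sum serves as \<open>N\<close>: as \<open>L\<close> and \<open>D\<close>
        are nonnegative, it yields both lower bounds on \<open>R x\<close> that the Coulomb estimate
        asks for.\<close>
      fix s x y y' assume s: "s \<in> {0..T}" and x: "2 * L + 8 * D \<le> R x" and y: "norm (y - x) \<le> L" "norm (y' - x) \<le> L"
        and d: "norm (y - y') \<le> D * R x powr (-3)"
      have 1: "norm (efield F f s y - efield F f s y') \<le> B * K * (D + 1) * R x powr (-6)"
        unfolding efield_eq_coulomb by (rule near2[OF meas B y(1) d]) (use s x L in auto)
      have "norm (A (s, y) - A (s, y')) \<le> CA * R x powr (-3) * norm (y - y')"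
        using s x y L by (intro lipA) auto
      also have "\<dots> \<le> CA * R x powr (-3) * (D * R x powr (-3))" using CA0 d by (intro mult_left_mono) auto
      also have "\<dots> = CA * D * (R x powr (-3) * R x powr (-3))" by (simp only: mult_ac)
      also have "R x powr (-3) * R x powr (-3) = R x powr (-6)" by (simp add: powr_add[symmetric])
      finally have 2: "norm (A (s, y) - A (s, y')) \<le> CA * D * R x powr (-6)" .
      have e: "efield F f s y + A (s, y) - (efield F f s y' + A (s, y')) = (efield F f s y - efield F f s y') + (A (s, y) - A (s, y'))"
        by simp
      show "norm (efield F f s y + A (s, y) - (efield F f s y' + A (s, y'))) \<le> (B * K * (D + 1) + CA * D) * R x powr (-6)"
        unfolding e using norm_triangle_ineq[of "efield F f s y - efield F f s y'" "A (s, y) - A (s, y')"] 1 2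
        unfolding distrib_right by linarith
    qed
    show "\<bar>\<integral>u. g u \<bullet> (efield F f s (\<xi> - \<sigma> *\<^sub>R u) + A (s, \<xi> - \<sigma> *\<^sub>R u)) \<partial>lborel\<bar>
        \<le> 3 * unit_ball_vol 3 * \<sigma> * m * (\<integral>u. F u \<partial>lborel)"
      if s: "0 \<le> s" "s \<le> T" and \<sigma>: "0 < \<sigma>" and m: "\<And>y. norm (\<xi> - y) \<le> \<sigma> * W \<Longrightarrow> \<bar>rho F f s y\<bar> \<le> m" for s \<sigma> \<xi> m
    proof -
      have zg: "g u = 0" if "W < norm u" for u
        using fun_cong[OF has_derivative_zero_outside[OF dF zF that], of "g u"] by simp
      have "integrable lborel (\<lambda>u. g u \<bullet> efield F f s (\<xi> - \<sigma> *\<^sub>R u))"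
        by (rule integrable_compact_support[of _ W])
          (auto intro!: continuous_intros cg continuous_on_compose2[OF cE1[OF s]] simp: zg)
      moreover have "integrable lborel (\<lambda>u. g u \<bullet> A (s, \<xi> - \<sigma> *\<^sub>R u))"
        by (rule integrable_compact_support[of _ W])
          (auto intro!: continuous_on_inner cg continuous_on_compose2[OF cA1[OF s(1)]] continuous_on_diff continuous_on_scaleR continuous_on_const continuous_on_id simp: zg)
      ultimately have "(\<integral>u. g u \<bullet> (efield F f s (\<xi> - \<sigma> *\<^sub>R u) + A (s, \<xi> - \<sigma> *\<^sub>R u)) \<partial>lborel)
        = (\<integral>u. g u \<bullet> efield F f s (\<xi> - \<sigma> *\<^sub>R u) \<partial>lborel) + (\<integral>u. g u \<bullet> A (s, \<xi> - \<sigma> *\<^sub>R u) \<partial>lborel)"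
        unfolding inner_add_right by (rule Bochner_Integration.integral_add)
      \<comment> \<open>Because \<open>A\<close> is divergence free, the flux of the total field is
        that of \<open>E\<close>, and so is bounded by the density alone.\<close>
      also have "(\<integral>u. g u \<bullet> A (s, \<xi> - \<sigma> *\<^sub>R u) \<partial>lborel) = 0"
        by (rule integral_gradient_divergence_free[where F = F and a = "\<lambda>x. A (s, x)" and a' = "A' s" and M = W])
          (use dF cg zF A' cA' divA s in auto)
      also have "\<bar>(\<integral>u. g u \<bullet> efield F f s (\<xi> - \<sigma> *\<^sub>R u) \<partial>lborel) + 0\<bar> \<le> 3 * unit_ball_vol 3 * \<sigma> * m * (\<integral>u. F u \<partial>lborel)"
        unfolding efield_eq_coulomb add_0_right
        by (rule integral_gradient_coulomb_field_le[where M = W and B = B and p = p])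
          (use dF cg zF F0 p meas B s \<sigma> m in auto)
      finally show ?thesis .
    qed
  qed (use T dF cg zF taylor lipF df transport supp CG in \<open>auto simp: rho_def\<close>)
  then show ?thesis using B by blast
qed

theorem corollary1:
  fixes p T :: real
    and F :: "real^3 \<Rightarrow> real"
    and f0 :: "(real^3) \<times> (real^3) \<Rightarrow> real"
    and A :: "real \<times> (real^3) \<Rightarrow> real^3"
    and f :: "real \<times> (real^3) \<times> (real^3) \<Rightarrow> real"
  assumes "3 < p" and "p < 4"
    and "background_condition F"
    and "initial_condition f0"
    and "field_condition p A"
    and "perturbation_condition F f0"
    and "0 < T"
    and "global_VP_solution p F f0 A f"
  shows "\<exists>C::real. \<forall>t\<in>{0..T}. wnorm 6 (rho F f t) \<le> ereal C"
proof -
  obtain W Q CF CG g f' B where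
    bounds: "vlasov_bounds T W Q CF CG F g f f' (\<lambda>s y. efield F f s y + A (s, y)) (rho F f)"
    and B: "\<And>s y. 0 \<le> s \<Longrightarrow> s \<le> T \<Longrightarrow> \<bar>rho F f s y\<bar> \<le> B * R y powr (-p)"
    using solution_vlasov_bounds[OF assms(1,2,3,5,6,7,8)] by blast
  have F0: "\<And>u. 0 \<le> F u" using assms(3) unfolding background_condition_def by blast
  have "0 \<le> p" using assms(1) by simp
  from vlasov_bounds.density_decay[OF bounds F0 this B]
  obtain C where "\<forall>t x. 0 \<le> t \<longrightarrow> t \<le> T \<longrightarrow> \<bar>rho F f t x\<bar> \<le> C * R x powr (-6)" by blast
  then show ?thesis by (intro exI[of _ C]) (simp add: wnorm_le_iff)
qed

end
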